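(* Let $q=1$ and let $\tau>1$ be a fixed forecast horizon. Let $h_t$ be a scalar $\mathscr F_t$-measurable test function and $Z_{m,t+\tau}=h_t\,\Delta L_{m,t+\tau}$, $t\ge m$, the transformed loss differential. Suppose that: (1) the sequence $\{Z_{m,t+\tau}: t\ge m\}$ is strongly $\alpha$-mixing with coefficients $\alpha(k)$, and there exists $\eta>0$ such that $\sum_{k=1}^\infty \alpha(k)^{\eta/(2+\eta)}<\infty$; (2) for the same $\eta$, $\sup_{t\ge m}\mathbb E|Z_{m,t+\tau}|^{2+\eta}<\infty$; (3) there exists $\sigma_\tau^2\in(0,\infty)$ such that, for every $r,s\in[0,1]$, $$n^{-1}\mathrm{Cov}\Big(\sum_{t=m}^{m+\lfloor nr\rfloor-1}Z_{m,t+\tau},\ \sum_{t=m}^{m+\lfloor ns\rfloor-1}Z_{m,t+\tau}\Big)\longrightarrow (r\wedge s)\,\sigma_\tau^2\qquad (n\to\infty).$$ Then, under the null hypothesis $H_0:\ \mathbb E[\Delta L_{m,t+\tau}\mid\mathscr F_t]=0$ almost surely for all $t$, as $n\to\infty$, $$Q^h_{m,n,\tau}\Rightarrow \frac{B(1)^2}{\big(\sup_{0\le r\le1}\mathbb B(r)-\inf_{0\le r\le 1}\mathbb B(r)\big)^2},$$ where $B$ is a standard one-dimensional Brownian motion and $\mathbb B(r)=B(r)-rB(1)$.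
   Context: Setting. $W_t=(Y_t,X_t^T)^T$ is an observed process ($Y_t$ real-valued, $X_t$ a vector of predictors) and $\mathscr F_t=\sigma(W_1,\dots,W_t)$. At each forecast origin $t$, two competing forecasts $\widehat f_t,\widehat g_t$ of $Y_{t+\tau}$ are given, both $\mathscr F_t$-measurable and computed from rolling estimation windows whose lengths ($\mathscr F_t$-measurable, possibly random) are uniformly bounded by a finite constant. $L(\cdot,\cdot)$ is a prespecified real-valued (measurable) loss function, and the loss differential is $\Delta L_{m,t+\tau}=L(Y_{t+\tau},\widehat f_t)-L(Y_{t+\tau},\widehat g_t)$. The integer $m$ is the first forecast origin; the evaluation period is $t=m,\dots,T-\tau$, with $n=T-\tau-m+1$ evaluation points. Asymptotics: $m$ and $\tau$ fixed, $n\to\infty$. Mixing. $\alpha(k)$ are the usual strong mixing coefficients of the sequence: $\alpha(k)=\sup_{t}\sup\{|P(A\cap B)-P(A)P(B)|\}$, over $A$ in the $\sigma$-field generated by the terms with index $\le t$ and $B$ in the $\sigma$-field generated by the terms with index $\ge t+k$. Statistic. $\overline Z_{m,n,\tau}=n^{-1}\sum_{t=m}^{T-\tau}Z_{m,t+\tau}$; $$T^h_{m,n,\tau}(r)=\frac1{\sqrt n}\sum_{t=m}^{m+\lfloor nr\rfloor-1}\big(Z_{m,t+\tau}-\overline Z_{m,n,\tau}\big),\quad 0\le r\le1;$$ $R^h_{m,n,\tau}=\sup_{0\le r\le1}T^h_{m,n,\tau}(r)-\inf_{0\le r\le1}T^h_{m,n,\tau}(r)$; $$Q^h_{m,n,\tau}=\frac{n\,\overline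 Z_{m,n,\tau}^{\,2}}{(R^h_{m,n,\tau})^2}\quad\text{whenever } R^h_{m,n,\tau}>0,$$ with an arbitrary fixed value assigned when $R^h_{m,n,\tau}=0$. Here $\Rightarrow$ denotes convergence in distribution. *)

theory Defs
  imports "HOL-Probability.Probability"
begin

text \<open>
  Time is discrete and starts at 1; the value of a process at index 0 is never used.
  Processes are functions of the time index and the sample point.
\<close>

definition gen_sigma ::
  "'a measure \<Rightarrow> nat set \<Rightarrow> (nat \<Rightarrow> 'a \<Rightarrow> 'b::topological_space) \<Rightarrow> 'a measure" where
  "gen_sigma M I V =
     sigma (space M) (\<Union>i\<in>I. {V i -` S \<inter> space M | S. S \<in> sets borel})"

definition obs ::
  "(nat \<Rightarrow> 'a \<Rightarrow> real) \<Rightarrow> (nat \<Rightarrow> 'a \<Rightarrow> real ^ 'p) \<Rightarrow> nat \<Rightarrow> 'a \<Rightarrow> real \<times> (real ^ 'p)" where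
  "obs Y X t \<omega> = (Y t \<omega>, X t \<omega>)"

definition info ::
  "'a measure \<Rightarrow> (nat \<Rightarrow> 'a \<Rightarrow> real) \<Rightarrow> (nat \<Rightarrow> 'a \<Rightarrow> real ^ 'p) \<Rightarrow> nat \<Rightarrow> 'a measure" where
  "info M Y X t = gen_sigma M {1..t} (obs Y X)"

text \<open>
  The forecast made at origin \<open>t\<close> is a measurable function of the window
  \<open>W\<^sub>t, W\<^sub>t\<^sub>-\<^sub>1, \<dots>\<close> of the last \<open>\<kappa> t\<close> observations (addressed by their lag \<open>j\<close>).  The length
  \<open>\<kappa> t\<close> may be random; it is known at time \<open>t\<close>, bounded by a constant \<open>K\<close> that does not
  depend on \<open>t\<close>, and the window does not reach back beyond the first observation.
\<close>

definition rolling_window_forecast ::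
  "'a measure \<Rightarrow> (nat \<Rightarrow> 'a \<Rightarrow> real) \<Rightarrow> (nat \<Rightarrow> 'a \<Rightarrow> real ^ 'p) \<Rightarrow> nat \<Rightarrow>
     (nat \<Rightarrow> 'a \<Rightarrow> real) \<Rightarrow> bool" where
  "rolling_window_forecast M Y X m f \<longleftrightarrow>
     (\<exists>(K::nat) (\<kappa> :: nat \<Rightarrow> 'a \<Rightarrow> nat)
       (\<phi> :: nat \<Rightarrow> nat \<Rightarrow> (nat \<Rightarrow> real \<times> (real ^ 'p)) \<Rightarrow> real).
       \<forall>t\<ge>m. \<kappa> t \<in> measurable (info M Y X t) (count_space UNIV) \<and>
             (\<forall>\<omega>\<in>space M. \<kappa> t \<omega> \<le> K \<and> \<kappa> t \<omega> \<le> t) \<and>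
             (\<forall>k. \<phi> t k \<in> borel_measurable (PiM {..<k} (\<lambda>_. borel))) \<and>
             (\<forall>\<omega>\<in>space M. f t \<omega> = \<phi> t (\<kappa> t \<omega>) (\<lambda>j\<in>{..<\<kappa> t \<omega>}. obs Y X (t - j) \<omega>)))"

text \<open>
  The quantities attached to the target date \<open>t + \<tau>\<close> are indexed by the forecast origin
  \<open>t\<close>: \<open>loss_diff \<dots> t\<close> is \<open>\<Delta>L\<close> and \<open>transformed_loss \<dots> t\<close> is \<open>Z\<close> with second index \<open>t + \<tau>\<close>.
\<close>

definition loss_diff ::
  "(real \<Rightarrow> real \<Rightarrow> real) \<Rightarrow> nat \<Rightarrow> (nat \<Rightarrow> 'a \<Rightarrow> real) \<Rightarrow> (nat \<Rightarrow> 'a \<Rightarrow> real) \<Rightarrow>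
     (nat \<Rightarrow> 'a \<Rightarrow> real) \<Rightarrow> nat \<Rightarrow> 'a \<Rightarrow> real" where
  "loss_diff L \<tau> Y f g t \<omega> = L (Y (t + \<tau>) \<omega>) (f t \<omega>) - L (Y (t + \<tau>) \<omega>) (g t \<omega>)"

definition transformed_loss ::
  "(nat \<Rightarrow> 'a \<Rightarrow> real) \<Rightarrow> (real \<Rightarrow> real \<Rightarrow> real) \<Rightarrow> nat \<Rightarrow> (nat \<Rightarrow> 'a \<Rightarrow> real) \<Rightarrow>
     (nat \<Rightarrow> 'a \<Rightarrow> real) \<Rightarrow> (nat \<Rightarrow> 'a \<Rightarrow> real) \<Rightarrow> nat \<Rightarrow> 'a \<Rightarrow> real" where
  "transformed_loss h L \<tau> Y f g t \<omega> = h t \<omega> * loss_diff L \<tau> Y f g t \<omega>"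

text \<open>
  Strong mixing coefficients of the sequence with terms \<open>Z t\<close>, \<open>t \<ge> m\<close>.  The set is
  nonempty and bounded by 1, so the real-valued supremum is the genuine one.
\<close>

definition mixing_coeff ::
  "'a measure \<Rightarrow> nat \<Rightarrow> (nat \<Rightarrow> 'a \<Rightarrow> real) \<Rightarrow> nat \<Rightarrow> real" where
  "mixing_coeff M m Z k =
     Sup {\<bar>measure M (A \<inter> B) - measure M A * measure M B\<bar> | t A B.
            m \<le> t \<and> A \<in> sets (gen_sigma M {m..t} Z) \<and> B \<in> sets (gen_sigma M {t + k..} Z)}"

definition strongly_mixing :: "'a measure \<Rightarrow> nat \<Rightarrow> (nat \<Rightarrow> 'a \<Rightarrow> real) \<Rightarrow> bool" where
  "strongly_mixing M m Z \<longleftrightarrow> mixing_coeff M m Z \<longlonglongrightarrow> 0"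

definition covar :: "'a measure \<Rightarrow> ('a \<Rightarrow> real) \<Rightarrow> ('a \<Rightarrow> real) \<Rightarrow> real" where
  "covar M U V =
     integral\<^sup>L M (\<lambda>\<omega>. (U \<omega> - integral\<^sup>L M U) * (V \<omega> - integral\<^sup>L M V))"

text \<open>
  The number \<open>n\<close> of evaluation points is the free parameter, so that the sample end is
  \<open>T = m + n + \<tau> - 1\<close> and \<open>t = m, \<dots>, T - \<tau>\<close> becomes \<open>t \<in> {m..<m + n}\<close>.
\<close>

definition psum :: "nat \<Rightarrow> (nat \<Rightarrow> 'a \<Rightarrow> real) \<Rightarrow> nat \<Rightarrow> real \<Rightarrow> 'a \<Rightarrow> real" where
  "psum m Z n r \<omega> = (\<Sum>t\<in>{m..<m + nat \<lfloor>real n * r\<rfloor>}. Z t \<omega>)"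

definition sample_mean :: "nat \<Rightarrow> (nat \<Rightarrow> 'a \<Rightarrow> real) \<Rightarrow> nat \<Rightarrow> 'a \<Rightarrow> real" where
  "sample_mean m Z n \<omega> = (\<Sum>t\<in>{m..<m + n}. Z t \<omega>) / real n"

definition Tproc :: "nat \<Rightarrow> (nat \<Rightarrow> 'a \<Rightarrow> real) \<Rightarrow> nat \<Rightarrow> real \<Rightarrow> 'a \<Rightarrow> real" where
  "Tproc m Z n r \<omega> =
     1 / sqrt (real n) * (\<Sum>t\<in>{m..<m + nat \<lfloor>real n * r\<rfloor>}. Z t \<omega> - sample_mean m Z n \<omega>)"

definition Rstat :: "nat \<Rightarrow> (nat \<Rightarrow> 'a \<Rightarrow> real) \<Rightarrow> nat \<Rightarrow> 'a \<Rightarrow> real" where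
  "Rstat m Z n \<omega> = (SUP r\<in>{0..1}. Tproc m Z n r \<omega>) - (INF r\<in>{0..1}. Tproc m Z n r \<omega>)"

text \<open>The parameter \<open>c\<close> is the value assigned when the range vanishes.\<close>

definition Qstat :: "real \<Rightarrow> nat \<Rightarrow> (nat \<Rightarrow> 'a \<Rightarrow> real) \<Rightarrow> nat \<Rightarrow> 'a \<Rightarrow> real" where
  "Qstat c m Z n \<omega> =
     (if Rstat m Z n \<omega> > 0
      then real n * (sample_mean m Z n \<omega>)\<^sup>2 / (Rstat m Z n \<omega>)\<^sup>2 else c)"

definition brownian_motion :: "'b measure \<Rightarrow> (real \<Rightarrow> 'b \<Rightarrow> real) \<Rightarrow> bool" where
  "brownian_motion N B \<longleftrightarrow>
     prob_space N \<and>
     (\<forall>t\<ge>0. B t \<in> borel_measurable N) \<and>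
     (\<forall>\<omega>\<in>space N. B 0 \<omega> = 0) \<and>
     (\<forall>\<omega>\<in>space N. continuous_on {0..} (\<lambda>t. B t \<omega>)) \<and>
     (\<forall>s t. 0 \<le> s \<and> s < t \<longrightarrow>
        distributed N lborel (\<lambda>\<omega>. B t \<omega> - B s \<omega>) (normal_density 0 (sqrt (t - s)))) \<and>
     (\<forall>(k::nat) (u :: nat \<Rightarrow> real). 0 \<le> u 0 \<and> (\<forall>i<k. u i \<le> u (Suc i)) \<longrightarrow>
        prob_space.indep_vars N (\<lambda>_. borel) (\<lambda>i \<omega>. B (u (Suc i)) \<omega> - B (u i) \<omega>) {..<k})"

definition bridge :: "(real \<Rightarrow> 'b \<Rightarrow> real) \<Rightarrow> real \<Rightarrow> 'b \<Rightarrow> real" where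
  "bridge B r \<omega> = B r \<omega> - r * B 1 \<omega>"

definition Qlimit :: "(real \<Rightarrow> 'b \<Rightarrow> real) \<Rightarrow> 'b \<Rightarrow> real" where
  "Qlimit B \<omega> =
     (B 1 \<omega>)\<^sup>2 / ((SUP r\<in>{0..1}. bridge B r \<omega>) - (INF r\<in>{0..1}. bridge B r \<omega>))\<^sup>2"

end

theory Submission
  imports Defs "HOL-Real_Asymp.Real_Asymp"
begin

text \<open>
  Rio's argument bounds the second moment of the excess of the running maximum of the partial sums over
  a level by covariances between past and future, which Davydov's inequality controls. Applied at level
  0 it makes large maxima improbable; applied again at a high level it shows that the squared maxima
  of normalised block sums are uniformly integrable. This one estimate yields the central limit theorem
  for block sums (cut the block into many short blocks, separate them by gaps, expand the characteristic
  functions to second order) and the tightness of the partial sum process. Blocks separated by growing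
  gaps are asymptotically independent, so the increments over a fixed grid converge jointly to Brownian
  increments. Linear combinations of the absolute final value and the range are Lipschitz in these
  increments, up to an error that vanishes uniformly as the grid is refined, and the event \<open>Q \<le> x\<close>
  says that such a combination is nonpositive.
\<close>

section \<open>Covariance inequalities under strong mixing\<close>

text \<open>For \<tau> > 1 the null hypothesis centres each Z but does not make the sequence a
  martingale difference: the term with origin t is known only at time t + \<tau>. Dependence has to
  be handled by mixing, and without stationarity every bound must be uniform in the starting point
  of a block. With p = 2 + \<eta> the assumed exponent \<eta> / (2 + \<eta>) equals (p - 2) / p, the
  exponent in Davydov's inequality, so covariances are summable over lags; moments of order above 2
  + \<eta> may be infinite, which rules out fourth-moment arguments. Hence both tightness and the
  remainder in the central limit theorem rest on uniform integrability of squares. Weak convergence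
  in a path space is avoided. The limit law involves only |B(1)| and the range of the bridge, and
  comparing Q with x amounts to the sign of a linear combination of the two, so one-dimensional laws
  suffice. A sign does not change under positive scaling, and this is how the unknown \<sigma>2
  drops out.\<close>

lemma space_gen_sigma [simp]: "space (gen_sigma M I V) = space M"
  by (simp add: gen_sigma_def space_measure_of_conv)

lemma sets_gen_sigma:
  "sets (gen_sigma M I V) = sigma_sets (space M) (\<Union>i\<in>I. {V i -` S \<inter> space M | S. S \<in> sets borel})"
  unfolding gen_sigma_def by (rule sets_measure_of) auto

lemma measurable_gen_sigma:
  assumes "i \<in> I"
  shows "V i \<in> borel_measurable (gen_sigma M I V)"
proof (rule measurableI)
  fix S :: "'b set" assume "S \<in> sets borel"
  then show "V i -` S \<inter> space (gen_sigma M I V) \<in> sets (gen_sigma M I V)"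
    using assms by (auto simp: sets_gen_sigma intro!: sigma_sets.Basic)
qed simp

lemma sets_gen_sigma_subset:
  assumes "space F = space M" "\<And>i. i \<in> I \<Longrightarrow> V i \<in> borel_measurable F"
  shows "sets (gen_sigma M I V) \<subseteq> sets F"
proof -
  have "(\<Union>i\<in>I. {V i -` S \<inter> space M | S. S \<in> sets borel}) \<subseteq> sets F"
    using assms by (auto dest!: measurable_sets) (metis assms(1) assms(2) measurable_sets)
  then show ?thesis
    using sets.sigma_sets_subset[of _ F] assms(1) by (simp add: sets_gen_sigma)
qed

lemma subalgebra_gen_sigma:
  assumes "\<And>i. i \<in> I \<Longrightarrow> V i \<in> borel_measurable M"
  shows "subalgebra M (gen_sigma M I V)"
  using sets_gen_sigma_subset[of M M I V] assms by (simp add: subalgebra_def)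

lemma gen_sigma_mono:
  assumes "I \<subseteq> J"
  shows "sets (gen_sigma M I V) \<subseteq> sets (gen_sigma M J V)"
  using assms by (intro sets_gen_sigma_subset) (auto intro: measurable_gen_sigma)

context prob_space
begin

text \<open>Rounding U down to a multiple of 1/n gives the average of the indicators of the level
  sets {n U >= i}, i = 1..n, all of which lie in F. The covariance of this average with W is a mean
  of quantities bounded by \<alpha>, so no constant is lost in passing from events to functions.
  Rounding costs 1/n in the mixed moment and 1/n in the product of the means.\<close>

lemma cov_step:
  fixes U W :: "'a \<Rightarrow> real"
  assumes sub: "subalgebra M F" and U: "U \<in> borel_measurable F"
    and U01: "\<And>x. x \<in> space M \<Longrightarrow> 0 \<le> U x \<and> U x \<le> 1"
    and W: "W \<in> borel_measurable M" and W1: "\<And>x. x \<in> space M \<Longrightarrow> \<bar>W x\<bar> \<le> 1"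
    and A: "\<And>A. A \<in> sets F \<Longrightarrow>
      \<bar>expectation (\<lambda>x. indicator A x * W x) - prob A * expectation W\<bar> \<le> \<alpha>"
  shows "\<bar>expectation (\<lambda>x. U x * W x) - expectation U * expectation W\<bar> \<le> \<alpha>"
proof (rule field_le_epsilon)
  fix e :: real assume "0 < e"
  then obtain n0 :: nat where n0: "2 / e < real n0"
    using reals_Archimedean2 by blast
  define n where "n = Suc n0"
  have n: "real n > 0" "2 / real n \<le> e"
    using n0 \<open>0 < e\<close> by (auto simp: n_def field_simps)
  have UM: "U \<in> borel_measurable M"
    using sub U by (rule measurable_from_subalg)
  have iW: "integrable M W"
    by (rule integrable_const_bound[where B = 1]) (use W W1 in auto)
  have iU: "integrable M U"
    by (rule integrable_const_bound[where B = 1]) (use UM U01 in auto)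
  define A where "A i = {x \<in> space M. real i \<le> real n * U x}" for i
  have AF: "A i \<in> sets F" for i
  proof -
    have "{x \<in> space F. real i \<le> real n * U x} \<in> sets F"
      using U by measurable
    then show ?thesis using sub by (simp add: A_def subalgebra_def)
  qed
  have AM: "A i \<in> events" for i
    using AF sub by (auto simp: subalgebra_def)
  define V where "V x = (\<Sum>i\<in>{1..n}. indicator (A i) x) / real n" for x
  have V_eq: "V x = of_int \<lfloor>real n * U x\<rfloor> / real n" if x: "x \<in> space M" for x
  proof -
    have 1: "0 \<le> real n * U x" "real n * U x \<le> real n"
      using U01[OF x] by (auto simp: mult_left_le)
    have "(\<Sum>i\<in>{1..n}. indicator (A i) x :: real) = (\<Sum>i\<in>{1..n}. if real i \<le> real n * U x then 1 else 0)"
      using x by (intro sum.cong) (auto simp: A_def indicator_def)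
    also have "\<dots> = real (card {i\<in>{1..n}. real i \<le> real n * U x})"
      by (simp add: sum.If_cases Int_def conj_commute)
    also have "{i\<in>{1..n}. real i \<le> real n * U x} = {1..nat \<lfloor>real n * U x\<rfloor>}"
      using 1 by (auto simp: le_nat_iff le_floor_iff)
    finally show ?thesis using 1 by (simp add: V_def)
  qed
  have VU: "\<bar>V x - U x\<bar> \<le> 1 / real n" if x: "x \<in> space M" for x
  proof -
    have "\<bar>of_int \<lfloor>real n * U x\<rfloor> - real n * U x\<bar> \<le> 1" by linarith
    then have "\<bar>of_int \<lfloor>real n * U x\<rfloor> - real n * U x\<bar> / real n \<le> 1 / real n"
      using n by (intro divide_right_mono) auto
    moreover have "of_int \<lfloor>real n * U x\<rfloor> / real n - U x = (of_int \<lfloor>real n * U x\<rfloor> - real n * U x) / real n"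
      using n by (simp add: diff_divide_distrib)
    then have "\<bar>of_int \<lfloor>real n * U x\<rfloor> - real n * U x\<bar> / real n = \<bar>V x - U x\<bar>"
      using n by (simp add: V_eq[OF x])
    ultimately show ?thesis by simp
  qed
  have VM: "V \<in> borel_measurable M"
    unfolding V_def using AM by measurable
  have V1: "0 \<le> V x \<and> V x \<le> 1" for x
  proof -
    have "(\<Sum>i\<in>{1..n}. indicator (A i) x :: real) \<le> (\<Sum>i\<in>{1..n}. 1)"
      by (intro sum_mono) (auto simp: indicator_def)
    then show ?thesis using n by (auto simp: V_def intro!: sum_nonneg divide_nonneg_nonneg)
  qed
  have iV: "integrable M V"
    by (rule integrable_const_bound[where B = 1]) (use VM V1 in auto)
  have iAW: "integrable M (\<lambda>x. indicator (A i) x * W x)" for i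
    by (rule integrable_const_bound[where B = 1]) (use AM W W1 in \<open>auto simp: indicator_def\<close>)
  have iVW: "integrable M (\<lambda>x. V x * W x)" and iUW: "integrable M (\<lambda>x. U x * W x)"
    by (rule integrable_const_bound[where B = 1];
        use UM U01 VM V1 W W1 in \<open>auto simp: abs_mult intro!: mult_le_one\<close>)+
  have EV: "expectation V = (\<Sum>i\<in>{1..n}. prob (A i)) / real n"
    unfolding V_def using AM by (simp add: Bochner_Integration.integral_sum less_top[symmetric])
  have EVW: "expectation (\<lambda>x. V x * W x)
      = (\<Sum>i\<in>{1..n}. expectation (\<lambda>x. indicator (A i) x * W x)) / real n"
  proof -
    have "(\<lambda>x. V x * W x) = (\<lambda>x. (\<Sum>i\<in>{1..n}. indicator (A i) x * W x) / real n)"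
      by (simp only: V_def sum_distrib_right times_divide_eq_left)
    then have "expectation (\<lambda>x. V x * W x) = expectation (\<lambda>x. (\<Sum>i\<in>{1..n}. indicator (A i) x * W x) / real n)"
      by simp
    also have "\<dots> = expectation (\<lambda>x. \<Sum>i\<in>{1..n}. indicator (A i) x * W x) / real n"
      by (rule integral_divide_zero)
    also have "expectation (\<lambda>x. \<Sum>i\<in>{1..n}. indicator (A i) x * W x)
        = (\<Sum>i\<in>{1..n}. expectation (\<lambda>x. indicator (A i) x * W x))"
      using iAW by (intro Bochner_Integration.integral_sum)
    finally show ?thesis .
  qed
  have "\<bar>expectation (\<lambda>x. V x * W x) - expectation V * expectation W\<bar>
    = \<bar>(\<Sum>i\<in>{1..n}. expectation (\<lambda>x. indicator (A i) x * W x) - prob (A i) * expectation W) / real n\<bar>"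
    unfolding EV EVW by (simp only: sum_subtractf sum_distrib_right diff_divide_distrib times_divide_eq_left)
  also have "\<dots> = \<bar>\<Sum>i\<in>{1..n}. expectation (\<lambda>x. indicator (A i) x * W x) - prob (A i) * expectation W\<bar> / real n"
    by (simp only: abs_divide abs_of_nat)
  also have "\<dots> \<le> (\<Sum>i\<in>{1..n}. \<bar>expectation (\<lambda>x. indicator (A i) x * W x) - prob (A i) * expectation W\<bar>) / real n"
    by (intro divide_right_mono sum_abs) simp
  also have "\<dots> \<le> (\<Sum>i\<in>{1..n}. \<alpha>) / real n"
    by (intro divide_right_mono sum_mono A[OF AF]) simp
  also have "\<dots> = \<alpha>" using n by simp
  finally have 1: "\<bar>expectation (\<lambda>x. V x * W x) - expectation V * expectation W\<bar> \<le> \<alpha>" .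
  have EW1: "\<bar>expectation W\<bar> \<le> 1"
  proof -
    have "\<bar>expectation W\<bar> \<le> expectation (\<lambda>x. \<bar>W x\<bar>)" by (rule integral_abs_bound)
    also have "\<dots> \<le> expectation (\<lambda>x. 1)"
      using iW W1 by (intro integral_mono) auto
    finally show ?thesis by (simp add: prob_space)
  qed
  have "\<bar>expectation (\<lambda>x. V x * W x) - expectation (\<lambda>x. U x * W x)\<bar> = \<bar>expectation (\<lambda>x. (V x - U x) * W x)\<bar>"
    using iVW iUW by (simp add: left_diff_distrib)
  also have "\<dots> \<le> expectation (\<lambda>x. \<bar>(V x - U x) * W x\<bar>)" by (rule integral_abs_bound)
  also have "\<dots> \<le> expectation (\<lambda>x. 1 / real n)"
  proof (rule integral_mono)
    show "integrable M (\<lambda>x. \<bar>(V x - U x) * W x\<bar>)"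
      using iVW iUW by (simp add: left_diff_distrib)
    fix x assume x: "x \<in> space M"
    show "\<bar>(V x - U x) * W x\<bar> \<le> 1 / real n"
      using mult_mono[OF VU[OF x] W1[OF x]] n by (simp add: abs_mult)
  qed simp
  finally have 2: "\<bar>expectation (\<lambda>x. V x * W x) - expectation (\<lambda>x. U x * W x)\<bar> \<le> 1 / real n"
    by (simp add: prob_space)
  have "\<bar>expectation V - expectation U\<bar> = \<bar>expectation (\<lambda>x. V x - U x)\<bar>"
    using iV iU by simp
  also have "\<dots> \<le> expectation (\<lambda>x. \<bar>V x - U x\<bar>)" by (rule integral_abs_bound)
  also have "\<dots> \<le> expectation (\<lambda>x. 1 / real n)"
    using iV iU VU by (intro integral_mono) auto
  finally have "\<bar>expectation V - expectation U\<bar> \<le> 1 / real n"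
    by (simp add: prob_space)
  then have "\<bar>expectation V - expectation U\<bar> * \<bar>expectation W\<bar> \<le> 1 / real n * 1"
    using EW1 by (intro mult_mono) auto
  then have 3: "\<bar>expectation V * expectation W - expectation U * expectation W\<bar> \<le> 1 / real n"
    by (simp add: left_diff_distrib[symmetric] abs_mult)
  have "2 / real n = 1 / real n + 1 / real n" by simp
  then show "\<bar>expectation (\<lambda>x. U x * W x) - expectation U * expectation W\<bar> \<le> \<alpha> + e"
    using 1 2 3 n(2) by linarith
qed

text \<open>An upper bound for the strong mixing coefficient of two sub-\<sigma>-algebras. As a
  predicate, rather than a supremum, it survives any enlargement of \<alpha>.\<close>

definition mixing_bound :: "'a measure \<Rightarrow> 'a measure \<Rightarrow> real \<Rightarrow> bool" where
  "mixing_bound F G \<alpha> \<longleftrightarrow> subalgebra M F \<and> subalgebra M G \<and>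
     (\<forall>A\<in>sets F. \<forall>B\<in>sets G. \<bar>prob (A \<inter> B) - prob A * prob B\<bar> \<le> \<alpha>)"

text \<open>Two applications of \<open>cov_step\<close>: with an indicator of an event of G as
  second factor, and then with the roles exchanged, where the first result supplies the hypothesis
  on events.\<close>

lemma cov_unit:
  fixes U V :: "'a \<Rightarrow> real"
  assumes mix: "mixing_bound F G \<alpha>"
    and U: "U \<in> borel_measurable F" and U01: "\<And>x. x \<in> space M \<Longrightarrow> 0 \<le> U x \<and> U x \<le> 1"
    and V: "V \<in> borel_measurable G" and V01: "\<And>x. x \<in> space M \<Longrightarrow> 0 \<le> V x \<and> V x \<le> 1"
  shows "\<bar>expectation (\<lambda>x. U x * V x) - expectation U * expectation V\<bar> \<le> \<alpha>"
proof -
  have sub: "subalgebra M F" "subalgebra M G"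
    and AB: "\<And>A B. A \<in> sets F \<Longrightarrow> B \<in> sets G \<Longrightarrow> \<bar>prob (A \<inter> B) - prob A * prob B\<bar> \<le> \<alpha>"
    using mix by (auto simp: mixing_bound_def)
  have UM: "U \<in> borel_measurable M"
    using sub(1) U by (rule measurable_from_subalg)
  have 1: "\<bar>expectation (\<lambda>x. U x * indicator B x) - expectation U * expectation (indicator B)\<bar> \<le> \<alpha>"
    if B: "B \<in> sets G" for B
  proof (rule cov_step[OF sub(1) U U01])
    have BM: "B \<in> events" using B sub by (auto simp: subalgebra_def)
    show "(indicator B :: 'a \<Rightarrow> real) \<in> borel_measurable M" using BM by measurable
    fix A assume A: "A \<in> sets F"
    then have AM: "A \<in> events" using sub by (auto simp: subalgebra_def)
    show "\<bar>expectation (\<lambda>x. indicator A x * indicator B x) - prob A * expectation (indicator B)\<bar> \<le> \<alpha>"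
      using AB[OF A B] AM BM by (simp add: indicator_inter_arith[symmetric])
  qed (auto simp: indicator_def)
  have "\<bar>expectation (\<lambda>x. V x * U x) - expectation V * expectation U\<bar> \<le> \<alpha>"
  proof (rule cov_step[OF sub(2) V V01 UM])
    fix B assume B: "B \<in> sets G"
    then have BM: "B \<in> events" using sub by (auto simp: subalgebra_def)
    show "\<bar>expectation (\<lambda>x. indicator B x * U x) - prob B * expectation U\<bar> \<le> \<alpha>"
      using 1[OF B] BM by (simp add: mult.commute)
  qed (use U01 in auto)
  then show ?thesis by (simp add: mult.commute)
qed

text \<open>Affine rescaling of both variables to [0,1]; the factor 4 a b is the product of the
  interval lengths 2a and 2b.\<close>

lemma cov_bounded:
  fixes U V :: "'a \<Rightarrow> real"
  assumes mix: "mixing_bound F G \<alpha>" and ab: "a > 0" "b > 0"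
    and U: "U \<in> borel_measurable F" and Ua: "\<And>x. x \<in> space M \<Longrightarrow> \<bar>U x\<bar> \<le> a"
    and V: "V \<in> borel_measurable G" and Vb: "\<And>x. x \<in> space M \<Longrightarrow> \<bar>V x\<bar> \<le> b"
  shows "\<bar>expectation (\<lambda>x. U x * V x) - expectation U * expectation V\<bar> \<le> 4 * \<alpha> * a * b"
proof -
  have sub: "subalgebra M F" "subalgebra M G"
    using mix by (auto simp: mixing_bound_def)
  have UM: "U \<in> borel_measurable M" and VM: "V \<in> borel_measurable M"
    using sub U V by (auto intro: measurable_from_subalg)
  have iU: "integrable M U" and iV: "integrable M V"
    by (rule integrable_const_bound[where B = a], use UM Ua in auto,
        rule integrable_const_bound[where B = b], use VM Vb in auto)
  have iUV: "integrable M (\<lambda>x. U x * V x)"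
    by (rule integrable_const_bound[where B = "a * b"])
       (use UM VM Ua Vb ab in \<open>auto simp: abs_mult intro!: mult_mono\<close>)
  define U' where "U' x = (U x + a) / (2 * a)" for x
  define V' where "V' x = (V x + b) / (2 * b)" for x
  have le: "\<bar>expectation (\<lambda>x. U' x * V' x) - expectation U' * expectation V'\<bar> \<le> \<alpha>"
  proof (rule cov_unit[OF mix])
    show "U' \<in> borel_measurable F" "V' \<in> borel_measurable G"
      unfolding U'_def V'_def using U V by measurable
    fix x assume x: "x \<in> space M"
    show "0 \<le> U' x \<and> U' x \<le> 1" using Ua[OF x] ab by (auto simp: U'_def field_simps)
    show "0 \<le> V' x \<and> V' x \<le> 1" using Vb[OF x] ab by (auto simp: V'_def field_simps)
  qed
  have 1: "expectation U' = (expectation U + a) / (2 * a)" "expectation V' = (expectation V + b) / (2 * b)"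
    unfolding U'_def V'_def using iU iV by (simp_all add: prob_space)
  have "(\<lambda>x. U' x * V' x) = (\<lambda>x. (U x * V x + b * U x + a * V x + a * b) / (4 * a * b))"
    by (auto simp: U'_def V'_def field_simps)
  then have 2: "expectation (\<lambda>x. U' x * V' x)
      = (expectation (\<lambda>x. U x * V x) + b * expectation U + a * expectation V + a * b) / (4 * a * b)"
    using iU iV iUV by (simp add: prob_space)
  have 3: "expectation (\<lambda>x. U' x * V' x) - expectation U' * expectation V'
    = (expectation (\<lambda>x. U x * V x) - expectation U * expectation V) / (4 * a * b)"
    unfolding 1 2 using ab by (simp add: field_simps)
  have "\<bar>expectation (\<lambda>x. U x * V x) - expectation U * expectation V\<bar> / (4 * a * b) \<le> \<alpha>"
    using le ab unfolding 3 by (simp add: abs_mult)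
  then show ?thesis using ab by (simp add: field_simps)
qed

end

text \<open>With w the larger absolute value, the product is at most w^2 = w^p * w^(2 - p); the
  exponent 2 - p is negative and w exceeds a, so a may replace w in the second factor. This is the
  price of truncating a product at level a.\<close>

lemma abs_mult_le_powr_large:
  fixes u v a p :: real
  assumes a: "a > 0" and p: "p > 2" and large: "a < \<bar>u\<bar> \<or> a < \<bar>v\<bar>"
  shows "\<bar>u * v\<bar> \<le> (\<bar>u\<bar> powr p + \<bar>v\<bar> powr p) * a powr (2 - p)"
proof -
  define w where "w = max \<bar>u\<bar> \<bar>v\<bar>"
  have w: "a < w" using large by (auto simp: w_def)
  have "\<bar>u * v\<bar> \<le> w * w"
    unfolding abs_mult by (intro mult_mono) (auto simp: w_def)
  also have "\<dots> = w powr 2" using w a by (simp add: power2_eq_square)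
  also have "\<dots> = w powr p * w powr (2 - p)"
    by (simp add: powr_add[symmetric])
  also have "\<dots> \<le> w powr p * a powr (2 - p)"
    using w a p by (intro mult_left_mono powr_mono2') auto
  also have "\<dots> \<le> (\<bar>u\<bar> powr p + \<bar>v\<bar> powr p) * a powr (2 - p)"
    by (intro mult_right_mono) (auto simp: w_def max_def)
  finally show ?thesis .
qed

lemma abs_le_powr_large:
  fixes v a p :: real
  assumes a: "a > 0" and p: "p > 1" and large: "a < \<bar>v\<bar>"
  shows "\<bar>v\<bar> \<le> \<bar>v\<bar> powr p * a powr (1 - p)"
proof -
  have "\<bar>v\<bar> = \<bar>v\<bar> powr p * \<bar>v\<bar> powr (1 - p)"
    using large a by (simp add: powr_add[symmetric])
  also have "\<dots> \<le> \<bar>v\<bar> powr p * a powr (1 - p)"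
    using a p large by (intro mult_left_mono powr_mono2') auto
  finally show ?thesis .
qed

lemma abs_mult_le_one_add_powr:
  fixes u v p :: real
  assumes "p > 2"
  shows "\<bar>u * v\<bar> \<le> 1 + \<bar>u\<bar> powr p + \<bar>v\<bar> powr p"
proof (cases "1 < \<bar>u\<bar> \<or> 1 < \<bar>v\<bar>")
  case True
  then show ?thesis using abs_mult_le_powr_large[of 1 p u v] assms by simp
next
  case False
  then have "\<bar>u\<bar> * \<bar>v\<bar> \<le> 1" by (intro mult_le_one) auto
  then show ?thesis by (simp add: abs_mult add_increasing2)
qed

section \<open>Davydov's covariance inequality\<close>

context prob_space
begin

lemma integrable_mult_moment:
  fixes U V :: "'a \<Rightarrow> real"
  assumes "U \<in> borel_measurable M" "V \<in> borel_measurable M" "p > 2"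
    and "integrable M (\<lambda>x. \<bar>U x\<bar> powr p)" "integrable M (\<lambda>x. \<bar>V x\<bar> powr p)"
  shows "integrable M (\<lambda>x. U x * V x)"
proof (rule Bochner_Integration.integrable_bound)
  show "integrable M (\<lambda>x. 1 + \<bar>U x\<bar> powr p + \<bar>V x\<bar> powr p)"
    using assms by simp
  show "(\<lambda>x. U x * V x) \<in> borel_measurable M"
    using assms by simp
  show "AE x in M. norm (U x * V x) \<le> norm (1 + \<bar>U x\<bar> powr p + \<bar>V x\<bar> powr p)"
    unfolding real_norm_def
    using abs_mult_le_one_add_powr[OF assms(3)] by (intro AE_I2 order_trans[OF _ abs_ge_self]) blast
qed

lemma integrable_moment:
  fixes U :: "'a \<Rightarrow> real"
  assumes "U \<in> borel_measurable M" "p > 2" "integrable M (\<lambda>x. \<bar>U x\<bar> powr p)"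
  shows "integrable M U"
proof -
  have "integrable M (\<lambda>x. \<bar>1\<bar> powr p)" by simp
  then have "integrable M (\<lambda>x. U x * 1)"
    by (rule integrable_mult_moment[OF assms(1) borel_measurable_const assms(2,3)])
  then show ?thesis by simp
qed

text \<open>
  Truncation at level \<open>a\<close>; choosing \<open>a\<close> of order \<open>\<alpha>\<close> to the power \<open>-1/p\<close> gives Davydov's inequality
  for equal exponents, without any appeal to Hoelder's inequality.
\<close>

lemma cov_moment:
  fixes U V :: "'a \<Rightarrow> real"
  assumes mix: "mixing_bound F G \<alpha>" and p: "p > 2" and a: "a > 0"
    and U: "U \<in> borel_measurable F" and V: "V \<in> borel_measurable G"
    and iU: "integrable M (\<lambda>x. \<bar>U x\<bar> powr p)" and iV: "integrable M (\<lambda>x. \<bar>V x\<bar> powr p)"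
    and CU: "expectation (\<lambda>x. \<bar>U x\<bar> powr p) \<le> C" and CV: "expectation (\<lambda>x. \<bar>V x\<bar> powr p) \<le> C"
    and V0: "expectation V = 0"
  shows "\<bar>expectation (\<lambda>x. U x * V x)\<bar> \<le> 4 * \<alpha> * a\<^sup>2 + 3 * C * a powr (2 - p)"
proof -
  have sub: "subalgebra M F" "subalgebra M G"
    using mix by (auto simp: mixing_bound_def)
  have UM: "U \<in> borel_measurable M" and VM: "V \<in> borel_measurable M"
    using sub U V by (auto intro: measurable_from_subalg)
  define T :: "real \<Rightarrow> real" where "T x = max (- a) (min a x)" for x
  have Ta: "\<bar>T x\<bar> \<le> a" for x using a by (auto simp: T_def)
  have T_id: "T x = x" if "\<bar>x\<bar> \<le> a" for x using that by (auto simp: T_def)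
  have T_same: "\<bar>x - T x\<bar> \<le> \<bar>x\<bar>" for x using a by (auto simp: T_def)
  \<comment> \<open>Truncation multiplies each factor by a number in [0,1], so the error is the
    fraction 1 - s * t of the product.\<close>
  have T_sgn: "\<bar>u * v - T u * T v\<bar> \<le> \<bar>u * v\<bar>" for u v
  proof -
    obtain s t where s: "T u = s * u" "0 \<le> s" "s \<le> 1" and t: "T v = t * v" "0 \<le> t" "t \<le> 1"
    proof -
      have "\<exists>s. T u = s * u \<and> 0 \<le> s \<and> s \<le> 1" for u
      proof (cases "u = 0")
        case True then show ?thesis using a by (intro exI[of _ 1]) (auto simp: T_def)
      next
        case False
        then show ?thesis using a
          by (intro exI[of _ "T u / u"]) (auto simp: T_def field_simps max_def min_def)
      qed
      then show ?thesis using that by blast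
    qed
    have "u * v - T u * T v = (1 - s * t) * (u * v)" using s t by (simp add: algebra_simps)
    moreover have "0 \<le> 1 - s * t" "1 - s * t \<le> 1" using s t by (auto intro: mult_le_one)
    ultimately show ?thesis by (simp add: abs_mult mult_left_le_one_le)
  qed
  have Tm: "(\<lambda>x. T (f x)) \<in> borel_measurable N" if "f \<in> borel_measurable N" for f :: "'a \<Rightarrow> real" and N
    unfolding T_def using that by measurable
  have iUV: "integrable M (\<lambda>x. U x * V x)"
    by (rule integrable_mult_moment[OF UM VM p iU iV])
  have iTT: "integrable M (\<lambda>x. T (U x) * T (V x))"
    by (rule integrable_const_bound[where B = "a * a"])
       (use Tm[OF UM] Tm[OF VM] Ta a in \<open>auto simp: abs_mult intro!: mult_mono\<close>)
  have iV1: "integrable M V" by (rule integrable_moment[OF VM p iV])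
  have iTV: "integrable M (\<lambda>x. T (V x))"
    by (rule integrable_const_bound[where B = a]) (use Tm[OF VM] Ta in auto)
  have iTU: "integrable M (\<lambda>x. T (U x))"
    by (rule integrable_const_bound[where B = a]) (use Tm[OF UM] Ta in auto)
  have 1: "\<bar>expectation (\<lambda>x. T (U x) * T (V x)) - expectation (\<lambda>x. T (U x)) * expectation (\<lambda>x. T (V x))\<bar>
      \<le> 4 * \<alpha> * a * a"
    by (rule cov_bounded[OF mix a a Tm[OF U] Ta Tm[OF V] Ta])
  have "\<bar>expectation (\<lambda>x. U x * V x) - expectation (\<lambda>x. T (U x) * T (V x))\<bar>
      = \<bar>expectation (\<lambda>x. U x * V x - T (U x) * T (V x))\<bar>"
    using iUV iTT by simp
  also have "\<dots> \<le> expectation (\<lambda>x. \<bar>U x * V x - T (U x) * T (V x)\<bar>)" by (rule integral_abs_bound)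
  also have "\<dots> \<le> expectation (\<lambda>x. (\<bar>U x\<bar> powr p + \<bar>V x\<bar> powr p) * a powr (2 - p))"
  proof (rule integral_mono)
    fix x
    show "\<bar>U x * V x - T (U x) * T (V x)\<bar> \<le> (\<bar>U x\<bar> powr p + \<bar>V x\<bar> powr p) * a powr (2 - p)"
    proof (cases "a < \<bar>U x\<bar> \<or> a < \<bar>V x\<bar>")
      case True
      then show ?thesis using abs_mult_le_powr_large[OF a p True] T_sgn[of "U x" "V x"] by linarith
    next
      case False
      then show ?thesis using T_id by simp
    qed
  qed (use iUV iTT iU iV in auto)
  also have "\<dots> = (expectation (\<lambda>x. \<bar>U x\<bar> powr p) + expectation (\<lambda>x. \<bar>V x\<bar> powr p)) * a powr (2 - p)"
    using iU iV by simp
  also have "\<dots> \<le> (C + C) * a powr (2 - p)"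
    using CU CV by (intro mult_right_mono) auto
  finally have 2: "\<bar>expectation (\<lambda>x. U x * V x) - expectation (\<lambda>x. T (U x) * T (V x))\<bar>
      \<le> 2 * C * a powr (2 - p)" by simp
  \<comment> \<open>Truncation destroys the centring of V, so the product of the truncated means
    must be bounded as well. The defect of the mean of \<open>T (V x)\<close> is at most C a^(1 - p)
    and the mean of \<open>T (U x)\<close> at most a, which yields the third of the terms C a^(2 -
    p).\<close>
  have "\<bar>expectation (\<lambda>x. T (V x))\<bar> = \<bar>expectation (\<lambda>x. V x - T (V x))\<bar>"
    using iV1 iTV V0 by simp
  also have "\<dots> \<le> expectation (\<lambda>x. \<bar>V x - T (V x)\<bar>)" by (rule integral_abs_bound)
  also have "\<dots> \<le> expectation (\<lambda>x. \<bar>V x\<bar> powr p * a powr (1 - p))"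
  proof (rule integral_mono)
    fix x
    show "\<bar>V x - T (V x)\<bar> \<le> \<bar>V x\<bar> powr p * a powr (1 - p)"
    proof (cases "a < \<bar>V x\<bar>")
      case True
      then show ?thesis using abs_le_powr_large[OF a _ True, of p] p T_same[of "V x"] by linarith
    next
      case False
      then show ?thesis using T_id by simp
    qed
  qed (use iV1 iTV iV in auto)
  also have "\<dots> \<le> C * a powr (1 - p)"
    using iV CV by (simp add: mult_right_mono)
  finally have 3: "\<bar>expectation (\<lambda>x. T (V x))\<bar> \<le> C * a powr (1 - p)" .
  have "\<bar>expectation (\<lambda>x. T (U x))\<bar> \<le> expectation (\<lambda>x. \<bar>T (U x)\<bar>)" by (rule integral_abs_bound)
  also have "\<dots> \<le> expectation (\<lambda>x. a)" using iTU Ta by (intro integral_mono) auto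
  finally have "\<bar>expectation (\<lambda>x. T (U x))\<bar> \<le> a" by (simp add: prob_space)
  then have "\<bar>expectation (\<lambda>x. T (U x)) * expectation (\<lambda>x. T (V x))\<bar> \<le> a * (C * a powr (1 - p))"
    unfolding abs_mult using 3 a by (intro mult_mono) auto
  also have "\<dots> = C * a powr (2 - p)"
    using a powr_add[of a 1 "1 - p"] by simp
  finally show ?thesis using 1 2 by (simp add: power2_eq_square)
qed

end

section \<open>A maximal inequality of Rio\<close>

definition max_psum :: "(nat \<Rightarrow> real) \<Rightarrow> nat \<Rightarrow> real" where
  "max_psum x n = Max ((\<lambda>k. \<Sum>i<k. x i) ` {..n})"

lemma max_psum_0 [simp]: "max_psum x 0 = 0"
  by (simp add: max_psum_def)

lemma max_psum_Suc: "max_psum x (Suc n) = max (max_psum x n) (\<Sum>i<Suc n. x i)"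
proof -
  have "(\<lambda>k. \<Sum>i<k. x i) ` {..Suc n} = insert (\<Sum>i<Suc n. x i) ((\<lambda>k. \<Sum>i<k. x i) ` {..n})"
    by (simp add: atMost_Suc)
  then show ?thesis by (simp add: max_psum_def max.commute)
qed

lemma max_psum_mono: "m \<le> n \<Longrightarrow> max_psum x m \<le> max_psum x n"
  by (rule lift_Suc_mono_le[of "max_psum x"]) (auto simp: max_psum_Suc)

lemma psum_le_max_psum: "k \<le> n \<Longrightarrow> (\<Sum>i<k. x i) \<le> max_psum x n"
  by (auto simp: max_psum_def)

lemma max_psum_nonneg: "0 \<le> max_psum x n"
  using psum_le_max_psum[of 0 n x] by simp

text \<open>
  If the truncated maximum increases at a step, it equals the truncated partial sum there; summation
  by parts then bounds its square by the last truncated partial sum and by a martingale-transform-like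
  sum. The same argument controls the truncated partial sum itself.
\<close>

definition rio_weight :: "real \<Rightarrow> (nat \<Rightarrow> real) \<Rightarrow> nat \<Rightarrow> real" where
  "rio_weight l x k = 8 * max 0 ((\<Sum>i<k. x i) - l) - 4 * max 0 (max_psum x k - l)"

lemma rio_weight_0: "l \<ge> 0 \<Longrightarrow> rio_weight l x 0 = 0"
  by (simp add: rio_weight_def)

text \<open>Both truncated terms are 1-Lipschitz in the step, whence 12 = 8 + 4. The gain lies in
  the indicator: as long as the maximum over the whole stretch stays at or below l, all truncations
  are 0 and the weight does not move. Every covariance is thereby restricted to the event of a large
  maximum.\<close>

lemma rio_weight_diff:
  assumes "j < n" "l \<ge> 0"
  shows "\<bar>rio_weight l x (Suc j) - rio_weight l x j\<bar> \<le> 12 * \<bar>x j\<bar> * of_bool (l < max_psum x n)"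
proof -
  define s where "s = (\<Sum>i<j. x i)"
  define m where "m = max_psum x j"
  have sm: "s \<le> m" unfolding s_def m_def by (rule psum_le_max_psum) simp
  have m': "max_psum x (Suc j) = max m (s + x j)"
    by (simp add: max_psum_Suc m_def s_def)
  have le: "max m (s + x j) \<le> max_psum x n"
    using max_psum_mono[of "Suc j" n x] assms m' by simp
  have d: "rio_weight l x (Suc j) - rio_weight l x j
     = 8 * (max 0 (s + x j - l) - max 0 (s - l)) - 4 * (max 0 (max m (s + x j) - l) - max 0 (m - l))"
    unfolding rio_weight_def m' by (simp add: s_def m_def)
  show ?thesis
  proof (cases "l < max_psum x n")
    case True
    have *: "\<bar>8 * P - 4 * Q\<bar> \<le> 12 * r" if "\<bar>P\<bar> \<le> r" "\<bar>Q\<bar> \<le> r" for P Q r :: real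
      using that by linarith
    have "\<bar>max 0 (s + x j - l) - max 0 (s - l)\<bar> \<le> \<bar>x j\<bar>" by linarith
    moreover have "\<bar>max 0 (max m (s + x j) - l) - max 0 (m - l)\<bar> \<le> \<bar>x j\<bar>" using sm by linarith
    ultimately have "\<bar>rio_weight l x (Suc j) - rio_weight l x j\<bar> \<le> 12 * \<bar>x j\<bar>"
      unfolding d by (rule *)
    then show ?thesis using True by simp
  next
    case False
    then have "max 0 (s + x j - l) = 0" "max 0 (s - l) = 0" "max 0 (max m (s + x j) - l) = 0" "max 0 (m - l) = 0"
      using le sm by auto
    then show ?thesis unfolding d by simp
  qed
qed

lemma max_psum_excess_aux1:
  assumes "l \<ge> 0"
  shows "(max 0 (max_psum x n - l))\<^sup>2 \<le> 2 * max 0 (max_psum x n - l) * ((\<Sum>i<n. x i) - l)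
     - 2 * (\<Sum>k<n. max 0 (max_psum x k - l) * x k)"
proof (induction n)
  case 0
  then show ?case using assms by simp
next
  case (Suc n)
  define s where "s = (\<Sum>i<n. x i)"
  define m where "m = max_psum x n"
  define m' where "m' = max_psum x (Suc n)"
  have m': "m' = max m (s + x n)"
    by (simp add: max_psum_Suc m_def s_def m'_def)
  define a where "a = max 0 (m - l)"
  define a' where "a' = max 0 (m' - l)"
  have "a'\<^sup>2 - a\<^sup>2 \<le> 2 * (a' - a) * (s + x n - l)"
  proof (cases "a' = a")
    case False
    then have *: "s + x n - l = a'" by (auto simp: a_def a'_def m' max_def split: if_splits)
    have "2 * (a' - a) * (s + x n - l) - (a'\<^sup>2 - a\<^sup>2) = (a' - a)\<^sup>2"
      unfolding * by (simp add: power2_eq_square algebra_simps)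
    then show ?thesis using zero_le_power2[of "a' - a"] by linarith
  qed simp
  moreover have "a\<^sup>2 \<le> 2 * a * (s - l) - 2 * (\<Sum>k<n. max 0 (max_psum x k - l) * x k)"
    using Suc by (simp add: a_def m_def s_def)
  ultimately have "a'\<^sup>2 \<le> 2 * a' * (s + x n - l) - 2 * ((\<Sum>k<n. max 0 (max_psum x k - l) * x k) + a * x n)"
    by (simp add: algebra_simps)
  then show ?case by (simp add: a_def a'_def m_def m'_def s_def)
qed

lemma max_psum_excess_aux2:
  assumes "l \<ge> 0"
  shows "(max 0 ((\<Sum>i<n. x i) - l))\<^sup>2 \<le> (\<Sum>k<n. (x k)\<^sup>2 * of_bool (l < max_psum x n))
     + (\<Sum>k<n. 2 * max 0 ((\<Sum>i<k. x i) - l) * x k)"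
proof -
  \<comment> \<open>The induction is on the prefix length k, while the event is kept at the full
    length n: a partial sum above l at any time k <= n already lifts the final maximum above
    l.\<close>
  have "k \<le> n \<Longrightarrow> (max 0 ((\<Sum>i<k. x i) - l))\<^sup>2 \<le> (\<Sum>k<k. (x k)\<^sup>2 * of_bool (l < max_psum x n))
     + (\<Sum>k<k. 2 * max 0 ((\<Sum>i<k. x i) - l) * x k)" for k
  proof (induction k)
    case 0
    then show ?case using assms by simp
  next
    case (Suc k)
    define s where "s = (\<Sum>i<k. x i)"
    define b where "b = max 0 (s - l)"
    define b' where "b' = max 0 (s + x k - l)"
    have "s \<le> max_psum x n" "s + x k \<le> max_psum x n"
      using psum_le_max_psum[of k n x] psum_le_max_psum[of "Suc k" n x] Suc.prems by (auto simp: s_def)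
    then have "b'\<^sup>2 \<le> b\<^sup>2 + 2 * b * x k + (x k)\<^sup>2 * of_bool (l < max_psum x n)"
    proof (cases "l < max_psum x n")
      case True
      have "\<bar>b'\<bar> \<le> \<bar>b + x k\<bar>" by (auto simp: b_def b'_def)
      then have "b'\<^sup>2 \<le> (b + x k)\<^sup>2" by (rule abs_le_square_iff[THEN iffD1])
      then show ?thesis using True by (simp add: power2_eq_square algebra_simps)
    next
      case False
      then have "b = 0" "b' = 0" using \<open>s \<le> _\<close> \<open>s + x k \<le> _\<close> by (auto simp: b_def b'_def)
      then show ?thesis by simp
    qed
    then show ?case using Suc by (simp add: b_def b'_def s_def)
  qed
  then show ?thesis by blast
qed

text \<open>Let a and b be the excesses over l of the maximum and of the last partial sum. The mixed
  term in a^2 <= 2ab - 2A is absorbed by 2ab <= a^2/2 + 2b^2, which leaves a^2 <= 4b^2 - 4A;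
  inserting b^2 <= S + 2B produces the coefficients 8 and 4 of \<open>rio_weight\<close>.\<close>

lemma max_psum_excess:
  assumes "l \<ge> 0"
  shows "(max 0 (max_psum x n - l))\<^sup>2
    \<le> 4 * (\<Sum>k<n. (x k)\<^sup>2 * of_bool (l < max_psum x n)) + (\<Sum>k<n. rio_weight l x k * x k)"
proof -
  define a where "a = max 0 (max_psum x n - l)"
  define b where "b = max 0 ((\<Sum>i<n. x i) - l)"
  define A where "A = (\<Sum>k<n. max 0 (max_psum x k - l) * x k)"
  define B where "B = (\<Sum>k<n. max 0 ((\<Sum>i<k. x i) - l) * x k)"
  define S where "S = (\<Sum>k<n. (x k)\<^sup>2 * of_bool (l < max_psum x n))"
  have "a\<^sup>2 \<le> 2 * a * ((\<Sum>i<n. x i) - l) - 2 * A"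
    using max_psum_excess_aux1[OF assms, of x n] by (simp add: a_def A_def)
  also have "\<dots> \<le> 2 * a * b - 2 * A"
    by (intro diff_right_mono mult_left_mono) (auto simp: a_def b_def)
  finally have 1: "a\<^sup>2 \<le> 2 * a * b - 2 * A" .
  have "0 \<le> (a - 2 * b)\<^sup>2" by simp
  then have "4 * (a * b) \<le> a\<^sup>2 + 4 * b\<^sup>2" by (simp add: power2_eq_square algebra_simps)
  with 1 have 2: "a\<^sup>2 \<le> 4 * b\<^sup>2 - 4 * A" by (simp add: algebra_simps)
  have "b\<^sup>2 \<le> S + 2 * B"
    using max_psum_excess_aux2[OF assms, of x n] by (simp add: b_def S_def B_def sum_distrib_left mult.assoc)
  with 2 have "a\<^sup>2 \<le> 4 * S + (8 * B - 4 * A)" by simp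
  also have "8 * B - 4 * A = (\<Sum>k<n. rio_weight l x k * x k)"
    by (simp add: rio_weight_def A_def B_def sum_subtractf sum_distrib_left left_diff_distrib mult.assoc)
  finally show ?thesis by (simp add: a_def S_def)
qed

lemma measurable_max_psum:
  assumes "\<And>i. i < n \<Longrightarrow> X i \<in> borel_measurable F"
  shows "(\<lambda>\<omega>. max_psum (\<lambda>i. X i \<omega>) n) \<in> borel_measurable F"
  using assms
proof (induction n)
  case (Suc n)
  then have "(\<lambda>\<omega>. max_psum (\<lambda>i. X i \<omega>) n) \<in> borel_measurable F"
    "(\<lambda>\<omega>. \<Sum>i<Suc n. X i \<omega>) \<in> borel_measurable F" by (auto intro!: borel_measurable_sum)
  then show ?case unfolding max_psum_Suc by measurable
qed simp

text \<open>The diagonal terms contribute 4 e, where e bounds second moments on the event of a large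
  maximum. Each off-diagonal term may use the better of the mixing bound at its lag and e, with the
  factor 12 of \<open>rio_weight_diff\<close>.\<close>

definition rio_const :: "(nat \<Rightarrow> real) \<Rightarrow> real \<Rightarrow> real" where
  "rio_const \<rho> e = 4 * e + 12 * (\<Sum>l. min (\<rho> l) e)"

lemma summable_min:
  fixes \<rho> :: "nat \<Rightarrow> real"
  assumes "summable \<rho>" "\<And>l. 0 \<le> \<rho> l" "0 \<le> e"
  shows "summable (\<lambda>l. min (\<rho> l) e)"
  by (rule summable_comparison_test[OF _ assms(1)]) (use assms in auto)

text \<open>Each \<open>min (\<rho> l) e\<close> vanishes with e under a summable majorant. A tail
  of \<rho> below \<epsilon> / 24 costs \<epsilon> / 2, and e is chosen so that the first N lags and
  the diagonal together cost the other half.\<close>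

lemma rio_const_small:
  fixes \<rho> :: "nat \<Rightarrow> real"
  assumes \<rho>: "summable \<rho>" "\<And>l. 0 \<le> \<rho> l" and \<epsilon>: "\<epsilon> > 0"
  shows "\<exists>e>0. rio_const \<rho> e \<le> \<epsilon>"
proof -
  obtain N where N: "\<And>n. n \<ge> N \<Longrightarrow> norm (\<Sum>i. \<rho> (i + n)) < \<epsilon> / 24"
    using suminf_exist_split[OF _ \<rho>(1), of "\<epsilon> / 24"] \<epsilon> by auto
  define e where "e = \<epsilon> / (2 * (4 + 12 * real N))"
  have e: "e > 0" using \<epsilon> by (auto simp: e_def)
  have sm: "summable (\<lambda>l. min (\<rho> l) e)" using summable_min[OF \<rho>, of e] e by simp
  have "(\<Sum>l. min (\<rho> l) e) = (\<Sum>l. min (\<rho> (l + N)) e) + (\<Sum>l<N. min (\<rho> l) e)"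
    by (rule suminf_split_initial_segment[OF sm])
  also have "(\<Sum>l. min (\<rho> (l + N)) e) \<le> (\<Sum>l. \<rho> (l + N))"
    using sm \<rho> by (intro suminf_le) (auto intro: summable_ignore_initial_segment)
  also have "\<dots> \<le> \<epsilon> / 24" using N[of N] by simp
  also have "(\<Sum>l<N. min (\<rho> l) e) \<le> (\<Sum>l<N. e)" by (intro sum_mono) auto
  finally have "(\<Sum>l. min (\<rho> l) e) \<le> \<epsilon> / 24 + real N * e" by simp
  then have "rio_const \<rho> e \<le> 4 * e + 12 * (\<epsilon> / 24 + real N * e)" by (simp add: rio_const_def)
  also have "\<dots> = e * (4 + 12 * real N) + \<epsilon> / 2" by (simp add: algebra_simps)
  also have "e * (4 + 12 * real N) = \<epsilon> / 2" unfolding e_def by (simp add: field_simps add_pos_nonneg)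
  finally show ?thesis using e by (intro exI[of _ e]) auto
qed

text \<open>\<open>\<beta>\<close> is a positive majorant of the mixing coefficients because
  negative powers of it are taken. The past \<open>{..<t}\<close> ends one index before t, so k = 0
  is the lag between neighbours. All bounds are uniform in the index, which makes the hypotheses
  stable under shifts of the sequence.\<close>

locale mixing_seq = prob_space M for M :: "'a measure" +
  fixes X :: "nat \<Rightarrow> 'a \<Rightarrow> real" and p C :: real and \<beta> :: "nat \<Rightarrow> real"
  assumes X_meas [measurable]: "\<And>i. X i \<in> borel_measurable M"
    and p: "p > 2"
    and X_int: "\<And>i. integrable M (\<lambda>x. \<bar>X i x\<bar> powr p)"
    and X_mom: "\<And>i. expectation (\<lambda>x. \<bar>X i x\<bar> powr p) \<le> C"
    and X_0: "\<And>i. expectation (X i) = 0"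
    and mix: "\<And>t k. mixing_bound (gen_sigma M {..<t} X) (gen_sigma M {t + k..} X) (\<beta> k)"
    and \<beta>_pos: "\<And>k. 0 < \<beta> k"
    and \<beta>_sum: "summable (\<lambda>k. \<beta> k powr ((p - 2) / p))"
begin

lemma C_nonneg: "0 \<le> C"
  using X_mom[of 0] by (rule order_trans[rotated]) simp

text \<open>Davydov's bound for the covariance at lag k. At the balanced truncation level the mixing
  term contributes the factor 4 and the truncation errors contribute 3 C.\<close>

definition \<rho> :: "nat \<Rightarrow> real" where
  "\<rho> k = (4 + 3 * C) * \<beta> k powr ((p - 2) / p)"

lemma \<rho>_nonneg: "0 \<le> \<rho> k"
  using C_nonneg by (simp add: \<rho>_def)

lemma cov_past_future:
  assumes U: "U \<in> borel_measurable (gen_sigma M {..<t} X)"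
    and iU: "integrable M (\<lambda>x. \<bar>U x\<bar> powr p)" and CU: "expectation (\<lambda>x. \<bar>U x\<bar> powr p) \<le> C"
  shows "\<bar>expectation (\<lambda>x. U x * X (t + k) x)\<bar> \<le> \<rho> k"
proof -
  define a where "a = \<beta> k powr (- 1 / p)"
  have a: "a > 0" using \<beta>_pos[of k] by (simp add: a_def)
  have V: "X (t + k) \<in> borel_measurable (gen_sigma M {t + k..} X)"
    by (rule measurable_gen_sigma) simp
  have "\<bar>expectation (\<lambda>x. U x * X (t + k) x)\<bar> \<le> 4 * \<beta> k * a\<^sup>2 + 3 * C * a powr (2 - p)"
    by (rule cov_moment[OF mix p a U V iU X_int CU X_mom X_0])
  also have "a powr (2 - p) = \<beta> k powr ((p - 2) / p)"
    by (simp add: a_def powr_powr diff_divide_distrib)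
  finally have 1: "\<bar>expectation (\<lambda>x. U x * X (t + k) x)\<bar> \<le> 4 * (\<beta> k * a\<^sup>2) + 3 * C * \<beta> k powr ((p - 2) / p)"
    by (simp add: mult.assoc)
  have "\<beta> k * a\<^sup>2 = \<beta> k powr ((p - 2) / p)"
  proof -
    have "\<beta> k * a\<^sup>2 = \<beta> k powr 1 * (\<beta> k powr (- 1 / p)) powr 2"
      using \<beta>_pos[of k] by (simp add: a_def)
    also have "\<dots> = \<beta> k powr (1 + (- 1 / p) * 2)" by (simp only: powr_powr powr_add)
    also have "1 + (- 1 / p) * 2 = (p - 2) / p" using p by (simp add: field_simps)
    finally show ?thesis .
  qed
  with 1 show ?thesis by (simp add: \<rho>_def distrib_right mult.assoc)
qed

lemma integrable_XX: "integrable M (\<lambda>x. X i x * X j x)"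
  by (rule integrable_mult_moment[OF X_meas X_meas p X_int X_int])

lemma integrable_X: "integrable M (X i)"
  by (rule integrable_moment[OF X_meas p X_int])

text \<open>A covariance bound that owes nothing to mixing but is small when E is improbable: where
  both variables are at most a, the product is at most a^2 on E, and elsewhere the p-th moments pay.
  It complements \<open>cov_past_future\<close> at short lags.\<close>

lemma expectation_on_event:
  assumes U: "U \<in> borel_measurable M" and E: "E \<in> events"
    and UE: "\<And>x. x \<in> space M \<Longrightarrow> \<bar>U x\<bar> \<le> \<bar>X j x\<bar> * indicator E x" and a: "a > 0"
  shows "\<bar>expectation (\<lambda>x. U x * X k x)\<bar> \<le> a\<^sup>2 * prob E + 2 * C * a powr (2 - p)"
proof -
  have "\<bar>expectation (\<lambda>x. U x * X k x)\<bar> \<le> expectation (\<lambda>x. \<bar>U x * X k x\<bar>)" by (rule integral_abs_bound)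
  also have "\<dots> \<le> expectation (\<lambda>x. a\<^sup>2 * indicator E x + (\<bar>X j x\<bar> powr p + \<bar>X k x\<bar> powr p) * a powr (2 - p))"
  proof (rule integral_mono_AE)
    have le: "\<bar>U x * X k x\<bar> \<le> \<bar>X j x * X k x\<bar>" if "x \<in> space M" for x
      using UE[OF that] unfolding abs_mult
      by (intro mult_right_mono) (auto simp: indicator_def of_bool_def split: if_splits)
    show "integrable M (\<lambda>x. \<bar>U x * X k x\<bar>)"
      by (rule Bochner_Integration.integrable_bound[OF integrable_XX[of j k]])
         (use U le in auto)
    show "integrable M (\<lambda>x. a\<^sup>2 * indicator E x + (\<bar>X j x\<bar> powr p + \<bar>X k x\<bar> powr p) * a powr (2 - p))"
      using X_int E by (auto simp: less_top[symmetric])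
    show "AE x in M. \<bar>U x * X k x\<bar> \<le> a\<^sup>2 * indicator E x + (\<bar>X j x\<bar> powr p + \<bar>X k x\<bar> powr p) * a powr (2 - p)"
    proof (rule AE_I2)
      fix x assume x: "x \<in> space M"
      show "\<bar>U x * X k x\<bar> \<le> a\<^sup>2 * indicator E x + (\<bar>X j x\<bar> powr p + \<bar>X k x\<bar> powr p) * a powr (2 - p)"
      proof (cases "x \<in> E")
        case False
        then show ?thesis using UE[OF x] by simp
      next
        case True
        show ?thesis
        proof (cases "a < \<bar>X j x\<bar> \<or> a < \<bar>X k x\<bar>")
          case large: True
          then show ?thesis
            using order_trans[OF le[OF x] abs_mult_le_powr_large[OF a p large]] zero_le_power2[of a] True
            by (simp add: add_increasing)
        next
          case False
          then have "\<bar>X j x * X k x\<bar> \<le> a * a" unfolding abs_mult using a by (intro mult_mono) auto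
          moreover have "0 \<le> (\<bar>X j x\<bar> powr p + \<bar>X k x\<bar> powr p) * a powr (2 - p)" by simp
          ultimately have "\<bar>U x * X k x\<bar> \<le> a * a + (\<bar>X j x\<bar> powr p + \<bar>X k x\<bar> powr p) * a powr (2 - p)"
            using le[OF x] by linarith
          then show ?thesis using True by (simp add: power2_eq_square)
        qed
      qed
    qed
  qed
  also have "\<dots> = a\<^sup>2 * prob E + (expectation (\<lambda>x. \<bar>X j x\<bar> powr p) + expectation (\<lambda>x. \<bar>X k x\<bar> powr p)) * a powr (2 - p)"
    using X_int E by (simp add: less_top[symmetric])
  also have "\<dots> \<le> a\<^sup>2 * prob E + (C + C) * a powr (2 - p)"
    using X_mom by (intro add_left_mono mult_right_mono add_mono) auto
  finally show ?thesis by simp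
qed

text \<open>The weight at time k is the sum of its increments \<open>d j\<close>, j < k. Each
  increment is known after time j and is dominated by 12 |X j| on E, so its mixed moment with
  \<open>X k\<close> is bounded both by mixing across the lag and by e. Summing the minimum of the
  two bounds over j gives a constant, hence a total that is linear in n.\<close>

lemma max_psum_moment:
  assumes l: "l \<ge> 0" and a: "a > 0"
    and e: "a\<^sup>2 * prob {\<omega> \<in> space M. l < max_psum (\<lambda>i. X i \<omega>) n} + 2 * C * a powr (2 - p) \<le> e"
  shows "integrable M (\<lambda>\<omega>. (max 0 (max_psum (\<lambda>i. X i \<omega>) n - l))\<^sup>2)"
    and "expectation (\<lambda>\<omega>. (max 0 (max_psum (\<lambda>i. X i \<omega>) n - l))\<^sup>2) \<le> real n * rio_const \<rho> e"
proof -
  define E where "E = {\<omega> \<in> space M. l < max_psum (\<lambda>i. X i \<omega>) n}"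
  have mm [measurable]: "(\<lambda>\<omega>. max_psum (\<lambda>i. X i \<omega>) k) \<in> borel_measurable M" for k
    by (rule measurable_max_psum) simp
  have EM [measurable]: "E \<in> events" unfolding E_def by measurable
  have E_ind: "indicator E \<omega> = (of_bool (l < max_psum (\<lambda>i. X i \<omega>) n) :: real)" if "\<omega> \<in> space M" for \<omega>
    using that by (simp add: E_def indicator_def)
  have e0: "0 \<le> e"
    using C_nonneg by (intro order_trans[OF _ e]) auto
  define w where "w k \<omega> = rio_weight l (\<lambda>i. X i \<omega>) k" for k \<omega>
  define d where "d j \<omega> = w (Suc j) \<omega> - w j \<omega>" for j \<omega>
  have w_meas: "w k \<in> borel_measurable (gen_sigma M {..<t} X)" if "k \<le> t" for k t
  proof -
    have X: "X i \<in> borel_measurable (gen_sigma M {..<t} X)" if "i < k" for i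
      using that \<open>k \<le> t\<close> by (intro measurable_gen_sigma) auto
    note [measurable] = measurable_max_psum[of k X, OF X]
    have [measurable]: "(\<lambda>\<omega>. \<Sum>i<k. X i \<omega>) \<in> borel_measurable (gen_sigma M {..<t} X)"
      using X by (intro borel_measurable_sum) auto
    show ?thesis unfolding w_def rio_weight_def by measurable
  qed
  have d_meas: "d j \<in> borel_measurable (gen_sigma M {..<Suc j} X)" for j
    unfolding d_def by (intro borel_measurable_diff w_meas) auto
  have d_measM: "d j \<in> borel_measurable M" for j
    using d_meas by (rule measurable_from_subalg[OF subalgebra_gen_sigma[OF X_meas]])
  have w_sum: "w k \<omega> = (\<Sum>j<k. d j \<omega>)" for k \<omega>
    unfolding d_def using rio_weight_0[OF l] by (simp add: sum_lessThan_telescope w_def)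
  have d_le: "\<bar>d j \<omega> / 12\<bar> \<le> \<bar>X j \<omega>\<bar> * indicator E \<omega>" if "j < n" "\<omega> \<in> space M" for j \<omega>
    using rio_weight_diff[OF that(1) l, of "\<lambda>i. X i \<omega>"] E_ind[OF that(2)]
    by (simp add: d_def w_def)
  then have d_le': "\<bar>d j \<omega> / 12\<bar> \<le> \<bar>X j \<omega>\<bar>" if "j < n" "\<omega> \<in> space M" for j \<omega>
    using order_trans[OF d_le[OF that]] by (simp add: indicator_def)
  have dX_int: "integrable M (\<lambda>x. d j x * X k x)" if j: "j < n" for j k
  proof (rule Bochner_Integration.integrable_bound)
    show "integrable M (\<lambda>x. 12 * (X j x * X k x))" using integrable_XX by simp
    show "AE x in M. norm (d j x * X k x) \<le> norm (12 * (X j x * X k x))"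
    proof (rule AE_I2)
      fix x assume "x \<in> space M"
      from d_le'[OF j this] have "\<bar>d j x\<bar> \<le> 12 * \<bar>X j x\<bar>" by simp
      then have "\<bar>d j x\<bar> * \<bar>X k x\<bar> \<le> 12 * \<bar>X j x\<bar> * \<bar>X k x\<bar>" by (intro mult_right_mono) auto
      then show "norm (d j x * X k x) \<le> norm (12 * (X j x * X k x))" by (simp add: abs_mult)
    qed
  qed (use d_measM in measurable)
  have dX: "expectation (\<lambda>x. d j x * X k x) \<le> 12 * min (\<rho> (k - Suc j)) e" if j: "j < k" "k < n" for j k
  proof -
    have jn: "j < n" using j by simp
    \<comment> \<open>Division by 12 makes the increment dominated by |X j|, so that its p-th moment
      is bounded by the same C.\<close>
    have iU: "integrable M (\<lambda>x. \<bar>d j x / 12\<bar> powr p)"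
      by (rule Bochner_Integration.integrable_bound[OF X_int[of j]])
         (use d_measM d_le'[OF jn] p in \<open>auto intro!: powr_mono2\<close>)
    have CU: "expectation (\<lambda>x. \<bar>d j x / 12\<bar> powr p) \<le> C"
      by (rule order_trans[OF integral_mono[OF iU X_int[of j]] X_mom])
         (use d_le'[OF jn] p in \<open>auto intro!: powr_mono2\<close>)
    have "(\<lambda>x. d j x / 12) \<in> borel_measurable (gen_sigma M {..<Suc j} X)"
      using d_meas by measurable
    \<comment> \<open>\<open>d j\<close> is a function of X 0, ..., X j: the past ends just before
      \<open>Suc j\<close>, and \<open>X k\<close> lies \<open>k - Suc j\<close> steps into the
      future.\<close>
    from cov_past_future[OF this iU CU, of "k - Suc j"]
    have 1: "\<bar>expectation (\<lambda>x. d j x / 12 * X k x)\<bar> \<le> \<rho> (k - Suc j)" using j by simp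
    have "(\<lambda>x. d j x / 12) \<in> borel_measurable M"
      using d_measM by measurable
    from expectation_on_event[OF this EM d_le[OF jn] a, of k]
    have 2: "\<bar>expectation (\<lambda>x. d j x / 12 * X k x)\<bar> \<le> e" using e by (simp add: E_def)
    have "expectation (\<lambda>x. d j x / 12 * X k x) = expectation (\<lambda>x. d j x * X k x) / 12"
      by simp
    with 1 2 show ?thesis by simp
  qed
  have XE: "expectation (\<lambda>x. (X k x)\<^sup>2 * indicator E x) \<le> e" for k
  proof -
    have "\<bar>expectation (\<lambda>x. (X k x * indicator E x) * X k x)\<bar> \<le> a\<^sup>2 * prob E + 2 * C * a powr (2 - p)"
      by (rule expectation_on_event[OF _ EM _ a, of _ k]) (auto simp: indicator_def)
    moreover have "(\<lambda>x. (X k x * indicator E x) * X k x) = (\<lambda>x. (X k x)\<^sup>2 * indicator E x)"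
      by (simp add: power2_eq_square ac_simps)
    ultimately show ?thesis using e by (simp add: E_def)
  qed
  have XE_int: "integrable M (\<lambda>x. (X k x)\<^sup>2 * indicator E x)" for k
    using integrable_real_mult_indicator[OF EM integrable_XX[of k k]] by (simp add: power2_eq_square)
  define R where "R \<omega> = 4 * (\<Sum>k<n. (X k \<omega>)\<^sup>2 * indicator E \<omega>) + (\<Sum>k<n. \<Sum>j<k. d j \<omega> * X k \<omega>)" for \<omega>
  have R_int: "integrable M R"
    unfolding R_def
    by (intro Bochner_Integration.integrable_add integrable_mult_right Bochner_Integration.integrable_sum)
       (use XE_int dX_int in auto)
  have le: "(max 0 (max_psum (\<lambda>i. X i \<omega>) n - l))\<^sup>2 \<le> R \<omega>" if "\<omega> \<in> space M" for \<omega>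
  proof -
    have "(\<Sum>k<n. rio_weight l (\<lambda>i. X i \<omega>) k * X k \<omega>) = (\<Sum>k<n. \<Sum>j<k. d j \<omega> * X k \<omega>)"
      using w_sum[of _ \<omega>] unfolding w_def by (simp only: sum_distrib_right)
    then show ?thesis
      using max_psum_excess[OF l, of "\<lambda>i. X i \<omega>" n] unfolding R_def E_ind[OF that] by simp
  qed
  show int: "integrable M (\<lambda>\<omega>. (max 0 (max_psum (\<lambda>i. X i \<omega>) n - l))\<^sup>2)"
    by (rule Bochner_Integration.integrable_bound[OF R_int])
       (use le in \<open>auto intro!: order_trans[OF _ abs_ge_self]\<close>)
  have "expectation (\<lambda>\<omega>. (max 0 (max_psum (\<lambda>i. X i \<omega>) n - l))\<^sup>2) \<le> expectation R"
    by (rule integral_mono[OF int R_int le])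
  also have "\<dots> = 4 * (\<Sum>k<n. expectation (\<lambda>\<omega>. (X k \<omega>)\<^sup>2 * indicator E \<omega>))
      + (\<Sum>k<n. \<Sum>j<k. expectation (\<lambda>\<omega>. d j \<omega> * X k \<omega>))"
  proof -
    have "expectation R = expectation (\<lambda>\<omega>. 4 * (\<Sum>k<n. (X k \<omega>)\<^sup>2 * indicator E \<omega>))
        + expectation (\<lambda>\<omega>. \<Sum>k<n. \<Sum>j<k. d j \<omega> * X k \<omega>)"
      unfolding R_def using XE_int dX_int
      by (intro Bochner_Integration.integral_add integrable_mult_right Bochner_Integration.integrable_sum) auto
    also have "expectation (\<lambda>\<omega>. 4 * (\<Sum>k<n. (X k \<omega>)\<^sup>2 * indicator E \<omega>))
        = 4 * (\<Sum>k<n. expectation (\<lambda>\<omega>. (X k \<omega>)\<^sup>2 * indicator E \<omega>))"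
      using XE_int by (subst integral_mult_right_zero) (subst Bochner_Integration.integral_sum; simp)
    also have "expectation (\<lambda>\<omega>. \<Sum>k<n. \<Sum>j<k. d j \<omega> * X k \<omega>)
        = (\<Sum>k<n. expectation (\<lambda>\<omega>. \<Sum>j<k. d j \<omega> * X k \<omega>))"
      using dX_int by (intro Bochner_Integration.integral_sum Bochner_Integration.integrable_sum) auto
    also have "\<dots> = (\<Sum>k<n. \<Sum>j<k. expectation (\<lambda>\<omega>. d j \<omega> * X k \<omega>))"
      using dX_int by (intro sum.cong refl Bochner_Integration.integral_sum) auto
    finally show ?thesis .
  qed
  also have "\<dots> \<le> 4 * (\<Sum>k<n. e) + (\<Sum>k<n. \<Sum>j<k. 12 * min (\<rho> (k - Suc j)) e)"
    using XE dX by (intro add_mono mult_left_mono sum_mono) auto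
  \<comment> \<open>For fixed k the lags \<open>k - Suc j\<close> run once through 0, ..., k - 1, so
    the inner sum is a partial sum of the series in \<open>rio_const\<close>.\<close>
  also have "(\<Sum>k<n. \<Sum>j<k. 12 * min (\<rho> (k - Suc j)) e) \<le> (\<Sum>k<n. 12 * (\<Sum>l. min (\<rho> l) e))"
  proof (rule sum_mono)
    fix k
    have "(\<Sum>j<k. 12 * min (\<rho> (k - Suc j)) e) = 12 * (\<Sum>j<k. min (\<rho> j) e)"
      using sum.nat_diff_reindex[of "\<lambda>j. 12 * min (\<rho> j) e" k] by (simp add: sum_distrib_left)
    also have "\<dots> \<le> 12 * (\<Sum>l. min (\<rho> l) e)"
    proof -
      have "summable \<rho>" unfolding \<rho>_def[abs_def] using \<beta>_sum by (rule summable_mult)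
      then show ?thesis
        using e0 \<rho>_nonneg by (intro mult_left_mono sum_le_suminf summable_min) auto
    qed
    finally show "(\<Sum>j<k. 12 * min (\<rho> (k - Suc j)) e) \<le> 12 * (\<Sum>l. min (\<rho> l) e)" .
  qed
  finally show "expectation (\<lambda>\<omega>. (max 0 (max_psum (\<lambda>i. X i \<omega>) n - l))\<^sup>2) \<le> real n * rio_const \<rho> e"
    by (simp add: rio_const_def algebra_simps)
qed

text \<open>Pasts and futures of the shifted sequence generate \<sigma>-algebras contained in those
  of the original one, at the same lag. Blocks may therefore start anywhere without any change of
  constants.\<close>

lemma mixing_seq_shift: "mixing_seq M (\<lambda>i. X (s + i)) p C \<beta>"
proof
  have "gen_sigma M I (\<lambda>i. X (s + i)) = gen_sigma M ((+) s ` I) X" for I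
    by (simp add: gen_sigma_def)
  moreover have "sets (gen_sigma M ((+) s ` {..<t}) X) \<subseteq> sets (gen_sigma M {..<s + t} X)" for t
    by (rule gen_sigma_mono) auto
  moreover have "sets (gen_sigma M ((+) s ` {t + k..}) X) \<subseteq> sets (gen_sigma M {s + t + k..} X)" for t k
    by (rule gen_sigma_mono) auto
  ultimately show "mixing_bound (gen_sigma M {..<t} (\<lambda>i. X (s + i))) (gen_sigma M {t + k..} (\<lambda>i. X (s + i))) (\<beta> k)" for t k
    using mix[of "s + t" k] unfolding mixing_bound_def
    by (auto simp: subset_eq intro!: subalgebra_gen_sigma)
qed (use p X_int X_mom X_0 \<beta>_pos \<beta>_sum in auto)

lemma mixing_seq_uminus: "mixing_seq M (\<lambda>i x. - X i x) p C \<beta>"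
proof
  have "sets (gen_sigma M I (\<lambda>i x. - X i x)) \<subseteq> sets (gen_sigma M I X)" for I
    by (rule sets_gen_sigma_subset) (auto intro!: borel_measurable_uminus measurable_gen_sigma)
  then show "mixing_bound (gen_sigma M {..<t} (\<lambda>i x. - X i x)) (gen_sigma M {t + k..} (\<lambda>i x. - X i x)) (\<beta> k)" for t k
    using mix[of t k] unfolding mixing_bound_def
    by (auto simp: subset_eq intro!: subalgebra_gen_sigma)
qed (use p X_int X_mom X_0 \<beta>_pos \<beta>_sum in auto)

text \<open>
  The moment bound at level 0 makes the event of a large maximum improbable; feeding this
  probability back into the inequality at a high level gives uniform integrability.
\<close>

lemma max_psum_uniform_excess:
  assumes \<epsilon>: "\<epsilon> > 0"
  shows "\<exists>A>0. \<forall>Y n. mixing_seq M Y p C \<beta> \<longrightarrow>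
    integrable M (\<lambda>\<omega>. (max 0 (max_psum (\<lambda>i. Y i \<omega>) n - A * sqrt (real n)))\<^sup>2) \<and>
    expectation (\<lambda>\<omega>. (max 0 (max_psum (\<lambda>i. Y i \<omega>) n - A * sqrt (real n)))\<^sup>2) \<le> \<epsilon> * real n"
proof -
  have "summable \<rho>" unfolding \<rho>_def[abs_def] using \<beta>_sum by (rule summable_mult)
  from rio_const_small[OF this \<rho>_nonneg \<epsilon>]
  obtain e where e: "e > 0" "rio_const \<rho> e \<le> \<epsilon>" by auto
  \<comment> \<open>At level 0 with truncation level 1 the hypothesis of
    \<open>max_psum_moment\<close> holds for e = 1 + 2C, as a probability is at most 1. K is a
    positive bound for the resulting constant.\<close>
  define K where "K = \<bar>rio_const \<rho> (1 + 2 * C)\<bar> + 1"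
  have K: "K > 0" "rio_const \<rho> (1 + 2 * C) \<le> K" by (auto simp: K_def)
  \<comment> \<open>The truncation level is fixed so that the moment term uses up only half of e;
    this is possible because 2 - p is negative.\<close>
  obtain a :: real where a: "a > 0" "2 * C * a powr (2 - p) \<le> e / 2"
  proof -
    have "((\<lambda>a. 2 * C * a powr (2 - p)) \<longlongrightarrow> 2 * C * 0) at_top"
      using p by (intro tendsto_mult tendsto_const tendsto_neg_powr filterlim_ident) auto
    then have "eventually (\<lambda>a. 2 * C * a powr (2 - p) < e / 2) at_top"
      using e by (intro order_tendstoD(2)) auto
    then have "eventually (\<lambda>a::real. a > 0 \<and> 2 * C * a powr (2 - p) < e / 2) at_top"
      using eventually_gt_at_top[of 0] by eventually_elim auto
    then show ?thesis using that by (auto simp: eventually_at_top_linorder)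
  qed
  \<comment> \<open>Markov's inequality bounds the probability of a maximum above A sqrt n by K /
    A^2, and this A makes a^2 K / A^2 the other half of e. It depends neither on the sequence nor on
    n.\<close>
  define A where "A = sqrt (2 * a\<^sup>2 * K / e)"
  have A: "A > 0" using a e K by (auto simp: A_def)
  have A2: "A\<^sup>2 = 2 * a\<^sup>2 * K / e" using a e K by (simp add: A_def)
  show ?thesis
  proof (intro exI[of _ A] conjI A allI impI)
    fix Y n assume Y: "mixing_seq M Y p C \<beta>"
    note Ym = mixing_seq.max_psum_moment[OF Y]
    note [measurable] = mixing_seq.X_meas[OF Y]
    have [measurable]: "(\<lambda>\<omega>. max_psum (\<lambda>i. Y i \<omega>) n) \<in> borel_measurable M"
      by (rule measurable_max_psum) simp
    have P: "prob {\<omega> \<in> space M. A * sqrt (real n) < max_psum (\<lambda>i. Y i \<omega>) n} \<le> K / A\<^sup>2"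
    proof (cases "n = 0")
      case True
      then show ?thesis using K by simp
    next
      case False
      have "1\<^sup>2 * prob {\<omega> \<in> space M. 0 < max_psum (\<lambda>i. Y i \<omega>) n} + 2 * C * 1 powr (2 - p) \<le> 1 + 2 * C"
        by simp
      note M0 = Ym[OF order_refl zero_less_one this]
      have sq: "(\<lambda>\<omega>. (max 0 (max_psum (\<lambda>i. Y i \<omega>) n - 0))\<^sup>2) = (\<lambda>\<omega>. (max_psum (\<lambda>i. Y i \<omega>) n)\<^sup>2)"
        using max_psum_nonneg by (simp add: max_def)
      have "prob {\<omega> \<in> space M. A * sqrt (real n) < max_psum (\<lambda>i. Y i \<omega>) n}
          \<le> prob {\<omega> \<in> space M. A\<^sup>2 * real n \<le> (max_psum (\<lambda>i. Y i \<omega>) n)\<^sup>2}"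
      proof (rule finite_measure_mono)
        show "{\<omega> \<in> space M. A * sqrt (real n) < max_psum (\<lambda>i. Y i \<omega>) n}
          \<subseteq> {\<omega> \<in> space M. A\<^sup>2 * real n \<le> (max_psum (\<lambda>i. Y i \<omega>) n)\<^sup>2}"
        proof clarsimp
          fix \<omega> assume "A * sqrt (real n) < max_psum (\<lambda>i. Y i \<omega>) n"
          then have "(A * sqrt (real n))\<^sup>2 \<le> (max_psum (\<lambda>i. Y i \<omega>) n)\<^sup>2"
            using A by (intro power_mono) auto
          then show "A\<^sup>2 * real n \<le> (max_psum (\<lambda>i. Y i \<omega>) n)\<^sup>2" by (simp add: power_mult_distrib)
        qed
      qed measurable
      also have "\<dots> \<le> expectation (\<lambda>\<omega>. (max_psum (\<lambda>i. Y i \<omega>) n)\<^sup>2) / (A\<^sup>2 * real n)"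
        by (rule integral_Markov_inequality_measure[OF M0(1)[unfolded sq]]) (use A False in auto)
      also have "\<dots> \<le> (real n * K) / (A\<^sup>2 * real n)"
      proof (rule divide_right_mono)
        have "expectation (\<lambda>\<omega>. (max_psum (\<lambda>i. Y i \<omega>) n)\<^sup>2) \<le> real n * rio_const \<rho> (1 + 2 * C)"
          using M0(2) unfolding sq .
        also have "\<dots> \<le> real n * K" using K by (intro mult_left_mono) auto
        finally show "expectation (\<lambda>\<omega>. (max_psum (\<lambda>i. Y i \<omega>) n)\<^sup>2) \<le> real n * K" .
      qed simp
      also have "\<dots> = K / A\<^sup>2" using False by simp
      finally show ?thesis .
    qed
    have "a\<^sup>2 * prob {\<omega> \<in> space M. A * sqrt (real n) < max_psum (\<lambda>i. Y i \<omega>) n} \<le> a\<^sup>2 * (K / A\<^sup>2)"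
      using P by (intro mult_left_mono) auto
    also have "\<dots> = e / 2" unfolding A2 using a K e by simp
    finally have "a\<^sup>2 * prob {\<omega> \<in> space M. A * sqrt (real n) < max_psum (\<lambda>i. Y i \<omega>) n}
        + 2 * C * a powr (2 - p) \<le> e" using a by simp
    note M1 = Ym[OF _ a(1) this]
    show "integrable M (\<lambda>\<omega>. (max 0 (max_psum (\<lambda>i. Y i \<omega>) n - A * sqrt (real n)))\<^sup>2)"
      using M1(1) A by simp
    have "expectation (\<lambda>\<omega>. (max 0 (max_psum (\<lambda>i. Y i \<omega>) n - A * sqrt (real n)))\<^sup>2) \<le> real n * rio_const \<rho> e"
      using M1(2) A by simp
    also have "\<dots> \<le> \<epsilon> * real n" using mult_left_mono[OF e(2), of "real n"] by (simp add: mult.commute)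
    finally show "expectation (\<lambda>\<omega>. (max 0 (max_psum (\<lambda>i. Y i \<omega>) n - A * sqrt (real n)))\<^sup>2) \<le> \<epsilon> * real n" .
  qed
qed

section \<open>Two-sided maxima of block sums\<close>

definition block_max :: "nat \<Rightarrow> nat \<Rightarrow> 'a \<Rightarrow> real" where
  "block_max s n \<omega> = max (max_psum (\<lambda>i. X (s + i) \<omega>) n) (max_psum (\<lambda>i. - X (s + i) \<omega>) n)"

lemma measurable_block_max [measurable]: "block_max s n \<in> borel_measurable M"
  unfolding block_max_def by (intro borel_measurable_max measurable_max_psum) auto

lemma block_max_nonneg: "0 \<le> block_max s n \<omega>"
  using max_psum_nonneg[of "\<lambda>i. X (s + i) \<omega>" n] by (simp add: block_max_def le_max_iff_disj)

lemma block_sum_le_block_max: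
  assumes "s \<le> t" "t \<le> s + n"
  shows "\<bar>\<Sum>i\<in>{s..<t}. X i \<omega>\<bar> \<le> block_max s n \<omega>"
proof -
  have "(\<Sum>i\<in>{s..<t}. X i \<omega>) = (\<Sum>i<t - s. X (s + i) \<omega>)"
    using sum.shift_bounds_nat_ivl[of "\<lambda>i. X i \<omega>" 0 s "t - s"] assms
    by (simp add: atLeast0LessThan add.commute)
  moreover have "t - s \<le> n" using assms by simp
  ultimately show ?thesis
    using psum_le_max_psum[OF \<open>t - s \<le> n\<close>, of "\<lambda>i. X (s + i) \<omega>"]
      psum_le_max_psum[OF \<open>t - s \<le> n\<close>, of "\<lambda>i. - X (s + i) \<omega>"]
    by (auto simp: block_max_def sum_negf)
qed

lemma block_max_uniform_excess:
  assumes "\<epsilon> > 0"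
  shows "\<exists>A>0. \<forall>s n.
    integrable M (\<lambda>\<omega>. (max 0 (block_max s n \<omega> - A * sqrt (real n)))\<^sup>2) \<and>
    expectation (\<lambda>\<omega>. (max 0 (block_max s n \<omega> - A * sqrt (real n)))\<^sup>2) \<le> \<epsilon> * real n"
proof -
  have "\<epsilon> / 2 > 0" using assms by simp
  from max_psum_uniform_excess[OF this] obtain A where A: "A > 0"
    and A1: "\<And>Y n. mixing_seq M Y p C \<beta> \<Longrightarrow>
      integrable M (\<lambda>\<omega>. (max 0 (max_psum (\<lambda>i. Y i \<omega>) n - A * sqrt (real n)))\<^sup>2)"
    and A2: "\<And>Y n. mixing_seq M Y p C \<beta> \<Longrightarrow>
      expectation (\<lambda>\<omega>. (max 0 (max_psum (\<lambda>i. Y i \<omega>) n - A * sqrt (real n)))\<^sup>2) \<le> \<epsilon> / 2 * real n"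
    by blast
  show ?thesis
  proof (intro exI[of _ A] conjI A allI)
    fix s n
    have pos: "mixing_seq M (\<lambda>i. X (s + i)) p C \<beta>" by (rule mixing_seq_shift)
    have neg: "mixing_seq M (\<lambda>i x. - X (s + i) x) p C \<beta>" by (rule mixing_seq.mixing_seq_uminus[OF pos])
    define f where "f \<omega> = (max 0 (max_psum (\<lambda>i. X (s + i) \<omega>) n - A * sqrt (real n)))\<^sup>2
      + (max 0 (max_psum (\<lambda>i. - X (s + i) \<omega>) n - A * sqrt (real n)))\<^sup>2" for \<omega>
    have f: "integrable M f" unfolding f_def using A1[OF pos] A1[OF neg] by simp
    have le: "(max 0 (block_max s n \<omega> - A * sqrt (real n)))\<^sup>2 \<le> f \<omega>" for \<omega>
      by (auto simp: block_max_def f_def max_def)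
    show int: "integrable M (\<lambda>\<omega>. (max 0 (block_max s n \<omega> - A * sqrt (real n)))\<^sup>2)"
      by (rule Bochner_Integration.integrable_bound[OF f])
         (use le in \<open>auto intro!: order_trans[OF _ abs_ge_self]\<close>)
    have "expectation (\<lambda>\<omega>. (max 0 (block_max s n \<omega> - A * sqrt (real n)))\<^sup>2) \<le> expectation f"
      by (rule integral_mono[OF int f le])
    also have "\<dots> \<le> \<epsilon> / 2 * real n + \<epsilon> / 2 * real n"
      unfolding f_def using A1[OF pos] A1[OF neg] A2[OF pos, of n] A2[OF neg, of n] by simp
    finally show "expectation (\<lambda>\<omega>. (max 0 (block_max s n \<omega> - A * sqrt (real n)))\<^sup>2) \<le> \<epsilon> * real n"
      by simp
  qed
qed

text \<open>A block maximum is at most its excess over A sqrt n plus A sqrt n, and both squares have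
  mean of order n; the excess bound is taken with \<epsilon> = 1.\<close>

lemma block_max_square:
  "\<exists>K>0. \<forall>s n. integrable M (\<lambda>\<omega>. (block_max s n \<omega>)\<^sup>2) \<and>
     expectation (\<lambda>\<omega>. (block_max s n \<omega>)\<^sup>2) \<le> K * real n"
proof -
  obtain A where A: "A > 0"
    and A1: "\<And>s n. integrable M (\<lambda>\<omega>. (max 0 (block_max s n \<omega> - A * sqrt (real n)))\<^sup>2)"
    and A2: "\<And>s n. expectation (\<lambda>\<omega>. (max 0 (block_max s n \<omega> - A * sqrt (real n)))\<^sup>2) \<le> 1 * real n"
    using block_max_uniform_excess[OF zero_less_one] by blast
  show ?thesis
  proof (intro exI[of _ "2 + 2 * A\<^sup>2"] conjI allI)
    show "0 < 2 + 2 * A\<^sup>2" by (simp add: add_pos_nonneg)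
    fix s n
    define g where "g \<omega> = max 0 (block_max s n \<omega> - A * sqrt (real n))" for \<omega>
    have le: "(block_max s n \<omega>)\<^sup>2 \<le> 2 * (g \<omega>)\<^sup>2 + 2 * A\<^sup>2 * real n" for \<omega>
    proof -
      have "\<bar>block_max s n \<omega>\<bar> \<le> \<bar>g \<omega> + A * sqrt (real n)\<bar>"
        using block_max_nonneg[of s n \<omega>] A by (auto simp: g_def)
      then have "(block_max s n \<omega>)\<^sup>2 \<le> (g \<omega> + A * sqrt (real n))\<^sup>2" by (rule abs_le_square_iff[THEN iffD1])
      also have "\<dots> \<le> 2 * (g \<omega>)\<^sup>2 + 2 * (A * sqrt (real n))\<^sup>2"
        using zero_le_power2[of "g \<omega> - A * sqrt (real n)"] by (simp add: power2_sum power2_diff)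
      finally show ?thesis by (simp add: power_mult_distrib)
    qed
    have int': "integrable M (\<lambda>\<omega>. 2 * (g \<omega>)\<^sup>2 + 2 * A\<^sup>2 * real n)" using A1[of s n] by (simp add: g_def)
    show int: "integrable M (\<lambda>\<omega>. (block_max s n \<omega>)\<^sup>2)"
      by (rule Bochner_Integration.integrable_bound[OF int'])
         (use le in \<open>auto intro!: order_trans[OF _ abs_ge_self]\<close>)
    have "expectation (\<lambda>\<omega>. (block_max s n \<omega>)\<^sup>2) \<le> expectation (\<lambda>\<omega>. 2 * (g \<omega>)\<^sup>2 + 2 * A\<^sup>2 * real n)"
      by (rule integral_mono[OF int int' le])
    also have "\<dots> = 2 * expectation (\<lambda>\<omega>. (g \<omega>)\<^sup>2) + 2 * A\<^sup>2 * real n"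
      using A1[of s n] by (simp add: g_def prob_space)
    also have "\<dots> \<le> (2 + 2 * A\<^sup>2) * real n" using A2[of s n] by (simp add: g_def algebra_simps)
    finally show "expectation (\<lambda>\<omega>. (block_max s n \<omega>)\<^sup>2) \<le> (2 + 2 * A\<^sup>2) * real n" .
  qed
qed

end

section \<open>The central limit theorem for block sums\<close>

definition idx :: "nat \<Rightarrow> real \<Rightarrow> nat" where
  "idx n r = nat \<lfloor>real n * r\<rfloor>"

lemma idx_mono: "s \<le> t \<Longrightarrow> idx n s \<le> idx n t"
  unfolding idx_def by (intro nat_mono floor_mono mult_left_mono) auto

lemma idx_diff_le:
  assumes "0 \<le> s" "s \<le> t"
  shows "real (idx n t - idx n s) \<le> real n * (t - s) + 1"
proof -
  have "0 \<le> real n * s" "0 \<le> real n * t" using assms by auto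
  then have "real (idx n t) \<le> real n * t" "real n * s < real (idx n s) + 1"
    unfolding idx_def by (auto simp: of_nat_nat floor_correct)
  moreover have "real (idx n t - idx n s) = real (idx n t) - real (idx n s)"
    using idx_mono[OF assms(2), of n] by simp
  ultimately show ?thesis by (simp add: algebra_simps)
qed

text \<open>The square root grows, so dependence across a gap vanishes, yet it is small compared
  with n: a sum over a gap, divided by sqrt n, has mean absolute value of order at most
  n^(-1/4).\<close>

definition gap :: "nat \<Rightarrow> nat" where
  "gap n = nat \<lfloor>sqrt (real n)\<rfloor>"

lemma gap_le: "real (gap n) \<le> sqrt (real n)"
  by (simp add: gap_def of_nat_nat)

lemma filterlim_gap: "filterlim gap at_top at_top"
proof -
  have "filterlim (\<lambda>n. \<lfloor>sqrt (real n)\<rfloor>) at_top at_top"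
    by (intro filterlim_compose[OF filterlim_floor_sequentially] filterlim_compose[OF sqrt_at_top] filterlim_real_sequentially)
  then show ?thesis unfolding gap_def by (rule filterlim_compose[OF filterlim_nat_sequentially])
qed

section \<open>Characteristic functions under mixing\<close>

context prob_space
begin

lemma expectation_iexp:
  assumes [measurable]: "U \<in> borel_measurable M"
  shows "expectation (\<lambda>x. iexp (U x)) = of_real (expectation (\<lambda>x. cos (U x))) + \<i> * of_real (expectation (\<lambda>x. sin (U x)))"
proof -
  have "integrable M (\<lambda>x. cos (U x))" "integrable M (\<lambda>x. sin (U x))"
    by (auto intro!: integrable_const_bound[where B = 1])
  then show ?thesis unfolding cis_conv_exp[symmetric]
    by (simp add: cis.ctr Complex_eq complex_eq_iff)
qed

text \<open>The addition theorems split the real and the imaginary part into four products of sines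
  and cosines, each with covariance at most 4 \<alpha>.\<close>

lemma cov_iexp:
  fixes U V :: "'a \<Rightarrow> real"
  assumes mix: "mixing_bound F G \<alpha>" and U: "U \<in> borel_measurable F" and V: "V \<in> borel_measurable G"
  shows "cmod (expectation (\<lambda>x. iexp (U x + V x)) - expectation (\<lambda>x. iexp (U x)) * expectation (\<lambda>x. iexp (V x))) \<le> 16 * \<alpha>"
proof -
  have sub: "subalgebra M F" "subalgebra M G"
    using mix by (auto simp: mixing_bound_def)
  have [measurable]: "U \<in> borel_measurable M" "V \<in> borel_measurable M"
    using sub U V by (auto intro: measurable_from_subalg)
  have Um: "(\<lambda>x. cos (U x)) \<in> borel_measurable F" "(\<lambda>x. sin (U x)) \<in> borel_measurable F"
    and Vm: "(\<lambda>x. cos (V x)) \<in> borel_measurable G" "(\<lambda>x. sin (V x)) \<in> borel_measurable G"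
    using U V by measurable
  note C = cov_bounded[OF mix zero_less_one zero_less_one]
  define cc where "cc = expectation (\<lambda>x. cos (U x) * cos (V x)) - expectation (\<lambda>x. cos (U x)) * expectation (\<lambda>x. cos (V x))"
  define ss where "ss = expectation (\<lambda>x. sin (U x) * sin (V x)) - expectation (\<lambda>x. sin (U x)) * expectation (\<lambda>x. sin (V x))"
  define cs where "cs = expectation (\<lambda>x. cos (U x) * sin (V x)) - expectation (\<lambda>x. cos (U x)) * expectation (\<lambda>x. sin (V x))"
  define sc where "sc = expectation (\<lambda>x. sin (U x) * cos (V x)) - expectation (\<lambda>x. sin (U x)) * expectation (\<lambda>x. cos (V x))"
  have le: "\<bar>cc\<bar> \<le> 4 * \<alpha>" "\<bar>ss\<bar> \<le> 4 * \<alpha>" "\<bar>cs\<bar> \<le> 4 * \<alpha>" "\<bar>sc\<bar> \<le> 4 * \<alpha>"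
    unfolding cc_def ss_def cs_def sc_def
    using C[OF Um(1) _ Vm(1)] C[OF Um(2) _ Vm(2)] C[OF Um(1) _ Vm(2)] C[OF Um(2) _ Vm(1)] by auto
  have int: "integrable M (\<lambda>x. cos (U x) * cos (V x))" "integrable M (\<lambda>x. sin (U x) * sin (V x))"
    "integrable M (\<lambda>x. cos (U x) * sin (V x))" "integrable M (\<lambda>x. sin (U x) * cos (V x))"
    by (auto intro!: integrable_const_bound[where B = 1] mult_le_one AE_I2 simp: abs_mult)
  have "(\<lambda>x. U x + V x) \<in> borel_measurable M" by measurable
  then have "expectation (\<lambda>x. iexp (U x + V x))
      = of_real (expectation (\<lambda>x. cos (U x) * cos (V x)) - expectation (\<lambda>x. sin (U x) * sin (V x)))
        + \<i> * of_real (expectation (\<lambda>x. sin (U x) * cos (V x)) + expectation (\<lambda>x. cos (U x) * sin (V x)))"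
    using int by (subst expectation_iexp) (auto simp: cos_add sin_add)
  then have "expectation (\<lambda>x. iexp (U x + V x)) - expectation (\<lambda>x. iexp (U x)) * expectation (\<lambda>x. iexp (V x))
      = of_real (cc - ss) + \<i> * of_real (sc + cs)"
    by (simp add: expectation_iexp cc_def ss_def cs_def sc_def complex_eq_iff algebra_simps)
  also have "cmod \<dots> \<le> \<bar>cc - ss\<bar> + \<bar>sc + cs\<bar>"
    by (rule order_trans[OF norm_triangle_ineq]) (simp only: norm_mult norm_of_real norm_ii mult_1 order_refl)
  also have "\<dots> \<le> 16 * \<alpha>" using le by linarith
  finally show ?thesis .
qed

lemma iexp_diff_le:
  fixes U V :: "'a \<Rightarrow> real"
  assumes [measurable]: "U \<in> borel_measurable M" "V \<in> borel_measurable M"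
    and int: "integrable M (\<lambda>x. \<bar>U x - V x\<bar>)"
  shows "cmod (expectation (\<lambda>x. iexp (U x)) - expectation (\<lambda>x. iexp (V x))) \<le> expectation (\<lambda>x. \<bar>U x - V x\<bar>)"
proof -
  have i: "integrable M (\<lambda>x. iexp (U x))" if [measurable]: "U \<in> borel_measurable M" for U
    by (rule integrable_const_bound[where B = 1]) auto
  have "cmod (expectation (\<lambda>x. iexp (U x)) - expectation (\<lambda>x. iexp (V x))) = cmod (expectation (\<lambda>x. iexp (U x) - iexp (V x)))"
    using i[of U] i[of V] by simp
  also have "\<dots> \<le> expectation (\<lambda>x. cmod (iexp (U x) - iexp (V x)))" by (rule integral_norm_bound)
  also have "\<dots> \<le> expectation (\<lambda>x. \<bar>U x - V x\<bar>)"
  proof (rule integral_mono)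
    show "integrable M (\<lambda>x. cmod (iexp (U x) - iexp (V x)))"
      using i[of U] i[of V] by auto
    fix x
    have "iexp (U x) - iexp (V x) = iexp (V x) * (iexp (U x - V x) - 1)"
      by (simp add: exp_add[symmetric] algebra_simps)
    then show "cmod (iexp (U x) - iexp (V x)) \<le> \<bar>U x - V x\<bar>"
      using iexp_approx1[of "U x - V x" 0] by (simp add: norm_mult)
  qed (rule int)
  finally show ?thesis .
qed

lemma expectation_abs_le_sqrt:
  fixes U :: "'a \<Rightarrow> real"
  assumes [measurable]: "U \<in> borel_measurable M" and int: "integrable M (\<lambda>x. (U x)\<^sup>2)"
  shows "integrable M U" "expectation (\<lambda>x. \<bar>U x\<bar>) \<le> sqrt (expectation (\<lambda>x. (U x)\<^sup>2))"
proof -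
  show iU: "integrable M U"
    by (rule square_integrable_imp_integrable[OF _ int]) simp
  have "(expectation (\<lambda>x. \<bar>U x\<bar>))\<^sup>2 \<le> expectation (\<lambda>x. (U x)\<^sup>2)"
    using variance_positive[of "\<lambda>x. \<bar>U x\<bar>"] variance_eq[of "\<lambda>x. \<bar>U x\<bar>"] iU int by simp
  then show "expectation (\<lambda>x. \<bar>U x\<bar>) \<le> sqrt (expectation (\<lambda>x. (U x)\<^sup>2))" by (rule real_le_rsqrt)
qed

end

locale fclt_seq = mixing_seq +
  fixes \<sigma>2 :: real
  assumes \<sigma>2: "\<sigma>2 > 0"
    and cov_lim: "\<And>r s. r \<in> {0..1} \<Longrightarrow> s \<in> {0..1} \<Longrightarrow>
      (\<lambda>n. expectation (\<lambda>\<omega>. (\<Sum>i<idx n r. X i \<omega>) * (\<Sum>i<idx n s. X i \<omega>)) / real n) \<longlonglongrightarrow> min r s * \<sigma>2"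
begin

definition W :: "nat \<Rightarrow> real \<Rightarrow> real \<Rightarrow> 'a \<Rightarrow> real" where
  "W n s t \<omega> = (\<Sum>i\<in>{idx n s..<idx n t}. X i \<omega>) / sqrt (real n)"

text \<open>The increment W with its first \<open>gap n\<close> terms dropped, which makes it
  measurable with respect to a future separated from everything before \<open>idx n s\<close>. A
  block no longer than the gap gives the empty sum.\<close>

definition V :: "nat \<Rightarrow> real \<Rightarrow> real \<Rightarrow> 'a \<Rightarrow> real" where
  "V n s t \<omega> = (\<Sum>i\<in>{idx n s + gap n..<idx n t}. X i \<omega>) / sqrt (real n)"

lemma W_meas [measurable]: "W n s t \<in> borel_measurable M"
  unfolding W_def by measurable

lemma V_meas [measurable]: "V n s t \<in> borel_measurable M"
  unfolding V_def by measurable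

lemma W_past:
  assumes "t \<le> u"
  shows "W n s t \<in> borel_measurable (gen_sigma M {..<idx n u} X)"
  unfolding W_def using idx_mono[OF assms, of n]
  by (intro borel_measurable_divide borel_measurable_sum measurable_gen_sigma borel_measurable_const) auto

lemma V_past:
  assumes "t \<le> u"
  shows "V n s t \<in> borel_measurable (gen_sigma M {..<idx n u} X)"
  unfolding V_def using idx_mono[OF assms, of n]
  by (intro borel_measurable_divide borel_measurable_sum measurable_gen_sigma borel_measurable_const) auto

lemma V_future: "V n s t \<in> borel_measurable (gen_sigma M {idx n s + gap n..} X)"
  unfolding V_def
  by (intro borel_measurable_divide borel_measurable_sum measurable_gen_sigma borel_measurable_const) auto

lemma \<beta>_gap: "(\<lambda>n. \<beta> (gap n)) \<longlonglongrightarrow> 0"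
proof -
  have "(\<lambda>k. \<beta> k powr ((p - 2) / p)) \<longlonglongrightarrow> 0" using \<beta>_sum by (rule summable_LIMSEQ_zero)
  then have "(\<lambda>k. (\<beta> k powr ((p - 2) / p)) powr (p / (p - 2))) \<longlonglongrightarrow> 0 powr (p / (p - 2))"
    using p by (intro tendsto_powr') auto
  then have "\<beta> \<longlonglongrightarrow> 0" using p \<beta>_pos by (simp add: powr_powr less_imp_le)
  then show ?thesis by (rule filterlim_compose[OF _ filterlim_gap])
qed

lemma W_add:
  assumes "s \<le> t" "t \<le> u"
  shows "W n s u \<omega> = W n s t \<omega> + W n t u \<omega>"
proof -
  have "(\<Sum>i\<in>{idx n s..<idx n t}. X i \<omega>) + (\<Sum>i\<in>{idx n t..<idx n u}. X i \<omega>) = (\<Sum>i\<in>{idx n s..<idx n u}. X i \<omega>)"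
    using assms by (intro sum.atLeastLessThan_concat idx_mono)
  then show ?thesis by (simp add: W_def add_divide_distrib[symmetric])
qed

lemma W_le_block_max:
  assumes "s \<le> t"
  shows "\<bar>W n s t \<omega>\<bar> \<le> block_max (idx n s) (idx n t - idx n s) \<omega> / sqrt (real n)"
  unfolding W_def using block_sum_le_block_max[of "idx n s" "idx n t" "idx n t - idx n s" \<omega>] idx_mono[OF assms, of n]
  by (simp add: divide_right_mono)

lemma W_V_le_block_max:
  assumes "s \<le> t"
  shows "\<bar>W n s t \<omega> - V n s t \<omega>\<bar> \<le> block_max (idx n s) (gap n) \<omega> / sqrt (real n)"
proof -
  have "\<bar>(\<Sum>i\<in>{idx n s..<idx n t}. X i \<omega>) - (\<Sum>i\<in>{idx n s + gap n..<idx n t}. X i \<omega>)\<bar> \<le> block_max (idx n s) (gap n) \<omega>"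
  proof (cases "idx n s + gap n \<le> idx n t")
    case True
    have "(\<Sum>i\<in>{idx n s..<idx n s + gap n}. X i \<omega>) + (\<Sum>i\<in>{idx n s + gap n..<idx n t}. X i \<omega>)
        = (\<Sum>i\<in>{idx n s..<idx n t}. X i \<omega>)"
      using True by (intro sum.atLeastLessThan_concat) auto
    then show ?thesis using block_sum_le_block_max[of "idx n s" "idx n s + gap n" "gap n" \<omega>] by simp
  next
    case False
    then show ?thesis using block_sum_le_block_max[of "idx n s" "idx n t" "gap n" \<omega>] idx_mono[OF assms, of n] by simp
  qed
  then show ?thesis by (simp add: W_def V_def diff_divide_distrib[symmetric] divide_right_mono)
qed

lemma expectation_W: "expectation (W n s t) = 0"
  unfolding W_def using integrable_X X_0 by (simp add: Bochner_Integration.integral_sum)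

lemma W_sq_integrable:
  assumes "s \<le> t"
  shows "integrable M (\<lambda>\<omega>. (W n s t \<omega>)\<^sup>2)"
proof -
  have "(W n s t \<omega>)\<^sup>2 = (\<Sum>i\<in>{idx n s..<idx n t}. \<Sum>j\<in>{idx n s..<idx n t}. X i \<omega> * X j \<omega>) / real n" for \<omega>
    by (simp add: W_def power_divide power2_eq_square sum_product)
  then show ?thesis using integrable_XX by simp
qed

lemma W_integrable:
  assumes "s \<le> t"
  shows "integrable M (W n s t)"
  by (rule expectation_abs_le_sqrt(1)[OF W_meas W_sq_integrable[OF assms]])

text \<open>The increment is a difference of two initial sums; expanding its square uses the
  covariance limits at (t,t), (s,s) and (s,t), which combine to t + s - 2s.\<close>

lemma variance_W_lim:
  assumes "0 \<le> s" "s \<le> t" "t \<le> 1"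
  shows "(\<lambda>n. expectation (\<lambda>\<omega>. (W n s t \<omega>)\<^sup>2)) \<longlonglongrightarrow> (t - s) * \<sigma>2"
proof -
  define S where "S r n \<omega> = (\<Sum>i<idx n r. X i \<omega>)" for r n \<omega>
  have int: "integrable M (\<lambda>\<omega>. S r n \<omega> * S r' n \<omega>)" for r r' n
    unfolding S_def sum_product using integrable_XX by simp
  have lim: "(\<lambda>n. expectation (\<lambda>\<omega>. S r n \<omega> * S r' n \<omega>) / real n) \<longlonglongrightarrow> min r r' * \<sigma>2"
    if "r \<in> {0..1}" "r' \<in> {0..1}" for r r'
    unfolding S_def by (rule cov_lim[OF that])
  have W: "W n s t \<omega> = (S t n \<omega> - S s n \<omega>) / sqrt (real n)" for n \<omega>
  proof -
    have "(\<Sum>i\<in>{0..<idx n s}. X i \<omega>) + (\<Sum>i\<in>{idx n s..<idx n t}. X i \<omega>) = (\<Sum>i\<in>{0..<idx n t}. X i \<omega>)"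
      using assms by (intro sum.atLeastLessThan_concat idx_mono) auto
    then show ?thesis by (simp add: W_def S_def atLeast0LessThan field_simps)
  qed
  have "(\<lambda>n. expectation (\<lambda>\<omega>. (W n s t \<omega>)\<^sup>2)) = (\<lambda>n. expectation (\<lambda>\<omega>. S t n \<omega> * S t n \<omega>) / real n
      + expectation (\<lambda>\<omega>. S s n \<omega> * S s n \<omega>) / real n - 2 * (expectation (\<lambda>\<omega>. S s n \<omega> * S t n \<omega>) / real n))"
  proof
    fix n
    have "(W n s t \<omega>)\<^sup>2 = (S t n \<omega> * S t n \<omega> + S s n \<omega> * S s n \<omega> - 2 * (S s n \<omega> * S t n \<omega>)) / real n" for \<omega>
      by (simp add: W power_divide power2_eq_square algebra_simps)
    then show "expectation (\<lambda>\<omega>. (W n s t \<omega>)\<^sup>2) = expectation (\<lambda>\<omega>. S t n \<omega> * S t n \<omega>) / real n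
      + expectation (\<lambda>\<omega>. S s n \<omega> * S s n \<omega>) / real n - 2 * (expectation (\<lambda>\<omega>. S s n \<omega> * S t n \<omega>) / real n)"
      using int by (simp add: add_divide_distrib diff_divide_distrib)
  qed
  moreover have "\<dots> \<longlonglongrightarrow> min t t * \<sigma>2 + min s s * \<sigma>2 - 2 * (min s t * \<sigma>2)"
    using assms by (intro tendsto_add tendsto_diff tendsto_mult tendsto_const lim) auto
  ultimately show ?thesis using assms by (simp add: algebra_simps min_def)
qed

lemma W_V_lim:
  assumes "s \<le> t"
  shows "integrable M (\<lambda>\<omega>. \<bar>W n s t \<omega> - V n s t \<omega>\<bar>)"
    and "(\<lambda>n. expectation (\<lambda>\<omega>. \<bar>W n s t \<omega> - V n s t \<omega>\<bar>)) \<longlonglongrightarrow> 0"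
proof -
  obtain K where K: "K > 0" and K1: "\<And>s n. integrable M (\<lambda>\<omega>. (block_max s n \<omega>)\<^sup>2)"
    and K2: "\<And>s n. expectation (\<lambda>\<omega>. (block_max s n \<omega>)\<^sup>2) \<le> K * real n"
    using block_max_square by blast
  note bm = expectation_abs_le_sqrt[OF measurable_block_max K1]
  define b where "b n \<omega> = block_max (idx n s) (gap n) \<omega> / sqrt (real n)" for n \<omega>
  have b_int: "integrable M (b n)" for n unfolding b_def using bm(1) by simp
  show int: "integrable M (\<lambda>\<omega>. \<bar>W n s t \<omega> - V n s t \<omega>\<bar>)" for n
    by (rule Bochner_Integration.integrable_bound[OF b_int[of n]])
       (use W_V_le_block_max[OF assms] block_max_nonneg in \<open>auto simp: b_def\<close>)
  have le: "expectation (\<lambda>\<omega>. \<bar>W n s t \<omega> - V n s t \<omega>\<bar>) \<le> sqrt (K * sqrt (real n)) / sqrt (real n)" for n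
  proof -
    have "expectation (\<lambda>\<omega>. \<bar>W n s t \<omega> - V n s t \<omega>\<bar>) \<le> expectation (b n)"
      using W_V_le_block_max[OF assms] by (intro integral_mono int b_int) (auto simp: b_def)
    also have "\<dots> = expectation (\<lambda>\<omega>. \<bar>block_max (idx n s) (gap n) \<omega>\<bar>) / sqrt (real n)"
      unfolding b_def using block_max_nonneg by simp
    also have "\<dots> \<le> sqrt (K * sqrt (real n)) / sqrt (real n)"
    proof (rule divide_right_mono)
      have "expectation (\<lambda>\<omega>. (block_max (idx n s) (gap n) \<omega>)\<^sup>2) \<le> K * real (gap n)" by (rule K2)
      also have "\<dots> \<le> K * sqrt (real n)" using K gap_le by (intro mult_left_mono) auto
      finally show "expectation (\<lambda>\<omega>. \<bar>block_max (idx n s) (gap n) \<omega>\<bar>) \<le> sqrt (K * sqrt (real n))"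
        by (intro order_trans[OF bm(2)]) simp
    qed simp
    finally show ?thesis .
  qed
  have "(\<lambda>n. sqrt (K * sqrt (real n)) / sqrt (real n)) \<longlonglongrightarrow> 0"
    using K by real_asymp
  then show "(\<lambda>n. expectation (\<lambda>\<omega>. \<bar>W n s t \<omega> - V n s t \<omega>\<bar>)) \<longlonglongrightarrow> 0"
    by (rule tendsto_sandwich[OF _ _ tendsto_const, rotated 2]) (use le in auto)
qed

definition cf :: "nat \<Rightarrow> real \<Rightarrow> real \<Rightarrow> real \<Rightarrow> complex" where
  "cf n s t l = expectation (\<lambda>\<omega>. iexp (l * W n s t \<omega>))"

lemma cmod_cf_le_1: "cmod (cf n s t l) \<le> 1"
proof -
  have "cmod (cf n s t l) \<le> expectation (\<lambda>\<omega>. cmod (iexp (l * W n s t \<omega>)))"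
    unfolding cf_def by (rule integral_norm_bound)
  then show ?thesis by (simp add: prob_space)
qed

lemma cf_V_lim:
  assumes "s \<le> t"
  shows "(\<lambda>n. expectation (\<lambda>\<omega>. iexp (l * V n s t \<omega>)) - cf n s t l) \<longlonglongrightarrow> 0"
proof (rule Lim_null_comparison)
  have "(\<lambda>n. \<bar>l\<bar> * expectation (\<lambda>\<omega>. \<bar>W n s t \<omega> - V n s t \<omega>\<bar>)) \<longlonglongrightarrow> \<bar>l\<bar> * 0"
    by (intro tendsto_mult tendsto_const W_V_lim assms)
  then show "(\<lambda>n. \<bar>l\<bar> * expectation (\<lambda>\<omega>. \<bar>W n s t \<omega> - V n s t \<omega>\<bar>)) \<longlonglongrightarrow> 0" by simp
  have eq: "\<bar>l * V n s t \<omega> - l * W n s t \<omega>\<bar> = \<bar>l\<bar> * \<bar>W n s t \<omega> - V n s t \<omega>\<bar>" for n \<omega>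
    by (simp add: right_diff_distrib[symmetric] abs_mult abs_minus_commute)
  show "\<forall>\<^sub>F n in sequentially. norm (expectation (\<lambda>\<omega>. iexp (l * V n s t \<omega>)) - cf n s t l)
      \<le> \<bar>l\<bar> * expectation (\<lambda>\<omega>. \<bar>W n s t \<omega> - V n s t \<omega>\<bar>)"
  proof (rule always_eventually, rule allI)
    fix n
    have "norm (expectation (\<lambda>\<omega>. iexp (l * V n s t \<omega>)) - cf n s t l) \<le> expectation (\<lambda>\<omega>. \<bar>l * V n s t \<omega> - l * W n s t \<omega>\<bar>)"
      unfolding cf_def
    proof (rule iexp_diff_le)
      show "integrable M (\<lambda>x. \<bar>l * V n s t x - l * W n s t x\<bar>)"
        unfolding eq using W_V_lim(1)[OF assms, of n] by (rule integrable_mult_right)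
    qed measurable
    then show "norm (expectation (\<lambda>\<omega>. iexp (l * V n s t \<omega>)) - cf n s t l) \<le> \<bar>l\<bar> * expectation (\<lambda>\<omega>. \<bar>W n s t \<omega> - V n s t \<omega>\<bar>)"
      unfolding eq integral_mult_right_zero .
  qed
qed

text \<open>Three vanishing errors: a gap is cut out at the start of the second block, mixing across
  the gap factorises the characteristic function, and the gap is put back.\<close>

lemma cf_split:
  assumes "s \<le> t" "t \<le> u"
  shows "(\<lambda>n. cf n s u l - cf n s t l * cf n t u l) \<longlonglongrightarrow> 0"
proof -
  define v where "v n = expectation (\<lambda>\<omega>. iexp (l * V n t u \<omega>))" for n
  define w where "w n = expectation (\<lambda>\<omega>. iexp (l * W n s t \<omega> + l * V n t u \<omega>))" for n
  have 1: "(\<lambda>n. cf n s u l - w n) \<longlonglongrightarrow> 0"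
  proof (rule Lim_null_comparison)
    have "(\<lambda>n. \<bar>l\<bar> * expectation (\<lambda>\<omega>. \<bar>W n t u \<omega> - V n t u \<omega>\<bar>)) \<longlonglongrightarrow> \<bar>l\<bar> * 0"
      by (intro tendsto_mult tendsto_const W_V_lim assms)
    then show "(\<lambda>n. \<bar>l\<bar> * expectation (\<lambda>\<omega>. \<bar>W n t u \<omega> - V n t u \<omega>\<bar>)) \<longlonglongrightarrow> 0" by simp
    have eq: "\<bar>l * W n s u \<omega> - (l * W n s t \<omega> + l * V n t u \<omega>)\<bar> = \<bar>l\<bar> * \<bar>W n t u \<omega> - V n t u \<omega>\<bar>" for n \<omega>
      unfolding W_add[OF assms] by (simp add: abs_mult[symmetric] algebra_simps)
    show "\<forall>\<^sub>F n in sequentially. norm (cf n s u l - w n) \<le> \<bar>l\<bar> * expectation (\<lambda>\<omega>. \<bar>W n t u \<omega> - V n t u \<omega>\<bar>)"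
    proof (rule always_eventually, rule allI)
      fix n
      have "norm (cf n s u l - w n) \<le> expectation (\<lambda>\<omega>. \<bar>l * W n s u \<omega> - (l * W n s t \<omega> + l * V n t u \<omega>)\<bar>)"
        unfolding cf_def w_def
      proof (rule iexp_diff_le)
        show "integrable M (\<lambda>\<omega>. \<bar>l * W n s u \<omega> - (l * W n s t \<omega> + l * V n t u \<omega>)\<bar>)"
          unfolding eq using W_V_lim(1)[OF assms(2), of n] by (rule integrable_mult_right)
      qed measurable
      then show "norm (cf n s u l - w n) \<le> \<bar>l\<bar> * expectation (\<lambda>\<omega>. \<bar>W n t u \<omega> - V n t u \<omega>\<bar>)"
        unfolding eq integral_mult_right_zero .
    qed
  qed
  have 2: "(\<lambda>n. w n - cf n s t l * v n) \<longlonglongrightarrow> 0"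
  proof (rule Lim_null_comparison)
    have "(\<lambda>n. 16 * \<beta> (gap n)) \<longlonglongrightarrow> 16 * 0" by (intro tendsto_mult tendsto_const \<beta>_gap)
    then show "(\<lambda>n. 16 * \<beta> (gap n)) \<longlonglongrightarrow> 0" by simp
    have "norm (w n - cf n s t l * v n) \<le> 16 * \<beta> (gap n)" for n
      unfolding w_def cf_def v_def
      by (rule cov_iexp[OF mix[of "idx n t" "gap n"]]) (intro borel_measurable_times borel_measurable_const W_past V_future order_refl)+
    then show "\<forall>\<^sub>F n in sequentially. norm (w n - cf n s t l * v n) \<le> 16 * \<beta> (gap n)" by simp
  qed
  have 3: "(\<lambda>n. cf n s t l * (v n - cf n t u l)) \<longlonglongrightarrow> 0"
  proof (rule Lim_null_comparison)
    show "(\<lambda>n. norm (v n - cf n t u l)) \<longlonglongrightarrow> 0"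
      using cf_V_lim[OF assms(2), of l] unfolding v_def by (rule tendsto_norm_zero)
    show "\<forall>\<^sub>F n in sequentially. norm (cf n s t l * (v n - cf n t u l)) \<le> norm (v n - cf n t u l)"
      using cmod_cf_le_1[of _ s t l] by (simp add: norm_mult mult_left_le_one_le)
  qed
  have "(\<lambda>n. (cf n s u l - w n) + (w n - cf n s t l * v n) + cf n s t l * (v n - cf n t u l)) \<longlonglongrightarrow> 0 + 0 + 0"
    by (intro tendsto_add 1 2 3)
  then show ?thesis by (simp add: algebra_simps)
qed

text \<open>The number k of blocks stays fixed while n grows. Each split adds one vanishing error,
  and earlier errors are only multiplied by characteristic functions, of modulus at most 1.\<close>

lemma cf_split_many:
  assumes "0 \<le> d"
  shows "(\<lambda>n. cf n s (s + real k * d) l - (\<Prod>j<k. cf n (s + real j * d) (s + real (Suc j) * d) l)) \<longlonglongrightarrow> 0"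
proof (induction k)
  case 0
  then show ?case by (simp add: cf_def W_def prob_space)
next
  case (Suc k)
  let ?u = "\<lambda>j. s + real j * d"
  have 1: "(\<lambda>n. cf n s (?u (Suc k)) l - cf n s (?u k) l * cf n (?u k) (?u (Suc k)) l) \<longlonglongrightarrow> 0"
    using assms by (intro cf_split) (auto simp: distrib_right)
  have 2: "(\<lambda>n. (cf n s (?u k) l - (\<Prod>j<k. cf n (?u j) (?u (Suc j)) l)) * cf n (?u k) (?u (Suc k)) l) \<longlonglongrightarrow> 0"
  proof (rule Lim_null_comparison)
    show "(\<lambda>n. norm (cf n s (?u k) l - (\<Prod>j<k. cf n (?u j) (?u (Suc j)) l))) \<longlonglongrightarrow> 0"
      using Suc by (rule tendsto_norm_zero)
    show "\<forall>\<^sub>F n in sequentially. norm ((cf n s (?u k) l - (\<Prod>j<k. cf n (?u j) (?u (Suc j)) l)) * cf n (?u k) (?u (Suc k)) l)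
       \<le> norm (cf n s (?u k) l - (\<Prod>j<k. cf n (?u j) (?u (Suc j)) l))"
      using cmod_cf_le_1 by (intro always_eventually allI) (simp only: norm_mult mult_left_le norm_ge_zero)
  qed
  have "(\<lambda>n. (cf n s (?u (Suc k)) l - cf n s (?u k) l * cf n (?u k) (?u (Suc k)) l)
      + (cf n s (?u k) l - (\<Prod>j<k. cf n (?u j) (?u (Suc j)) l)) * cf n (?u k) (?u (Suc k)) l) \<longlonglongrightarrow> 0 + 0"
    by (intro tendsto_add 1 2)
  then show ?case by (simp add: left_diff_distrib)
qed

text \<open>
  Second-order expansion of the characteristic function of a short block: the remainder is of smaller
  order than the length of the block because the squared normalised block sums are uniformly integrable.
\<close>

lemma cf_local:
  assumes \<epsilon>: "\<epsilon> > 0"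
  shows "\<exists>\<delta>>0. \<forall>s t. 0 \<le> s \<longrightarrow> s < t \<longrightarrow> t \<le> 1 \<longrightarrow> t - s \<le> \<delta> \<longrightarrow>
    (\<forall>\<^sub>F n in sequentially. cmod (cf n s t l - (1 - l\<^sup>2 * ((t - s) * \<sigma>2) / 2)) \<le> \<epsilon> * (t - s))"
proof -
  \<comment> \<open>A bound for |l| that stays positive when l = 0, since it appears in
    denominators.\<close>
  define q where "q = \<bar>l\<bar> + 1"
  have q: "q > 0" "\<bar>l\<bar> \<le> q" by (auto simp: q_def)
  \<comment> \<open>\<open>\<kappa>\<close> and \<open>e\<close> are tuned to the Taylor remainder:
    the part with |W| <= \<kappa> will cost 1/2 and the part with |W| > \<kappa> will cost 3/2 of
    \<epsilon> (t - s) / q^2. After multiplication by q^2 / 6 this is \<epsilon> (t - s) /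
    3.\<close>
  define \<kappa> where "\<kappa> = \<epsilon> / (4 * q ^ 3 * \<sigma>2)"
  have \<kappa>: "\<kappa> > 0" using \<epsilon> q \<sigma>2 by (simp add: \<kappa>_def)
  define e where "e = \<epsilon> / (32 * q\<^sup>2)"
  have e: "e > 0" using \<epsilon> q by (simp add: e_def)
  obtain A where A: "A > 0"
    and A1: "\<And>s n. integrable M (\<lambda>\<omega>. (max 0 (block_max s n \<omega> - A * sqrt (real n)))\<^sup>2)"
    and A2: "\<And>s n. expectation (\<lambda>\<omega>. (max 0 (block_max s n \<omega> - A * sqrt (real n)))\<^sup>2) \<le> e * real n"
    using block_max_uniform_excess[OF e] by blast
  \<comment> \<open>Blocks this short satisfy 2 A sqrt len / sqrt n <= \<kappa>, so an increment
    above \<kappa> forces the block maximum to be at least twice the level A sqrt len.\<close>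
  define \<delta> where "\<delta> = \<kappa>\<^sup>2 / (8 * A\<^sup>2)"
  have \<delta>: "\<delta> > 0" using \<kappa> A by (simp add: \<delta>_def)
  show ?thesis
  proof (intro exI[of _ \<delta>] conjI \<delta> allI impI)
    fix s t :: real assume st: "0 \<le> s" "s < t" "t \<le> 1" "t - s \<le> \<delta>"
    have st': "s \<le> t" using st by simp
    define v where "v n = expectation (\<lambda>\<omega>. (W n s t \<omega>)\<^sup>2)" for n
    have v_lim: "v \<longlonglongrightarrow> (t - s) * \<sigma>2"
      unfolding v_def[abs_def] using st by (intro variance_W_lim) auto
    define d where "d = min ((t - s) * \<sigma>2) (\<epsilon> * (t - s) / (2 * q\<^sup>2))"
    have d: "d > 0" using st \<sigma>2 \<epsilon> q by (simp add: d_def)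
    have ev1: "\<forall>\<^sub>F n in sequentially. \<bar>v n - (t - s) * \<sigma>2\<bar> < d"
      using tendstoD[OF v_lim d] by (simp add: dist_real_def)
    \<comment> \<open>Then n (t - s) >= 1, which absorbs the one index that rounding may add to the
      block length.\<close>
    have ev2: "\<forall>\<^sub>F n in sequentially. 1 / (t - s) < real n"
      using filterlim_real_sequentially by (simp add: filterlim_at_top_dense)
    show "\<forall>\<^sub>F n in sequentially. cmod (cf n s t l - (1 - l\<^sup>2 * ((t - s) * \<sigma>2) / 2)) \<le> \<epsilon> * (t - s)"
      using ev1 ev2
    proof eventually_elim
      case (elim n)
      have n: "real n > 0" using elim(2) st by (meson divide_pos_pos less_trans zero_less_one diff_gt_0_iff_gt)
      define len where "len = idx n t - idx n s"
      have "1 \<le> real n * (t - s)" using elim(2) st by (simp add: field_simps)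
      then have len: "real len \<le> 2 * real n * (t - s)"
        using idx_diff_le[OF st(1) st', of n] by (simp add: len_def)
      define g where "g \<omega> = (max 0 (block_max (idx n s) len \<omega> - A * sqrt (real len)))\<^sup>2 / real n" for \<omega>
      have g_int: "integrable M g" unfolding g_def using A1 by simp
      have Eg: "expectation g \<le> e * (2 * (t - s))"
      proof -
        have "expectation g \<le> e * real len / real n"
          unfolding g_def using A2[of "idx n s" len] n by (simp add: divide_right_mono)
        also have "\<dots> \<le> e * (2 * real n * (t - s)) / real n"
          using len e n by (intro divide_right_mono mult_left_mono) auto
        finally show ?thesis using n by simp
      qed
      have large: "2 * A * sqrt (real len) / sqrt (real n) \<le> \<kappa>"
      proof -
        have "real len / real n \<le> 2 * (t - s)" using len n by (simp add: field_simps)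
        then have "4 * A\<^sup>2 * (real len / real n) \<le> 4 * A\<^sup>2 * (2 * \<delta>)"
          using st by (intro mult_left_mono) auto
        also have "\<dots> = \<kappa>\<^sup>2" using A by (simp add: \<delta>_def)
        finally have "(2 * A * sqrt (real len) / sqrt (real n))\<^sup>2 \<le> \<kappa>\<^sup>2"
          by (simp add: power_mult_distrib power_divide)
        from this less_imp_le[OF \<kappa>] show ?thesis by (rule power2_le_imp_le)
      qed
      \<comment> \<open>Up to \<kappa> the cubic term is at most q \<kappa> W^2. Beyond \<kappa> the
        block maximum is at most twice its excess over A sqrt len, so the quadratic term is at most
        24 times the squared excess divided by n.\<close>
      have Wg: "min (6 * (W n s t \<omega>)\<^sup>2) (\<bar>l\<bar> * \<bar>W n s t \<omega>\<bar> ^ 3) \<le> q * \<kappa> * (W n s t \<omega>)\<^sup>2 + 24 * g \<omega>" for \<omega>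
      proof (cases "\<bar>W n s t \<omega>\<bar> \<le> \<kappa>")
        case True
        have "\<bar>l\<bar> * \<bar>W n s t \<omega>\<bar> ^ 3 = \<bar>l\<bar> * \<bar>W n s t \<omega>\<bar> * (W n s t \<omega>)\<^sup>2"
          by (simp add: power3_eq_cube power2_eq_square abs_mult[symmetric] mult.assoc)
        also have "\<dots> \<le> q * \<kappa> * (W n s t \<omega>)\<^sup>2"
          using True q \<kappa> by (intro mult_right_mono mult_mono) auto
        finally show ?thesis using n by (simp add: g_def min_le_iff_disj add_increasing2)
      next
        case False
        define b where "b = block_max (idx n s) len \<omega>"
        have Wb: "\<bar>W n s t \<omega>\<bar> \<le> b / sqrt (real n)"
          using W_le_block_max[OF st'] by (simp add: b_def len_def)
        then have "2 * A * sqrt (real len) / sqrt (real n) \<le> b / sqrt (real n)"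
          using False large by linarith
        then have "2 * (A * sqrt (real len)) \<le> b"
          using n by (simp add: divide_le_cancel)
        moreover have "0 \<le> A * sqrt (real len)" using A by simp
        ultimately have "b \<le> 2 * max 0 (b - A * sqrt (real len))"
          by (simp add: max_def)
        moreover have "0 \<le> b" by (simp add: b_def block_max_nonneg)
        ultimately have "b\<^sup>2 \<le> (2 * max 0 (b - A * sqrt (real len)))\<^sup>2" by (intro power_mono)
        then have "b\<^sup>2 / real n \<le> 4 * g \<omega>"
          using n by (simp add: g_def b_def power_mult_distrib divide_right_mono)
        moreover have "(W n s t \<omega>)\<^sup>2 \<le> b\<^sup>2 / real n"
          using power_mono[OF Wb, of 2] by (simp add: power_divide)
        ultimately have "6 * (W n s t \<omega>)\<^sup>2 \<le> 24 * g \<omega>" by simp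
        moreover have "0 \<le> q * \<kappa> * (W n s t \<omega>)\<^sup>2" using q \<kappa> by simp
        ultimately show ?thesis by linarith
      qed
      have v2: "v n \<le> 2 * ((t - s) * \<sigma>2)" and v3: "\<bar>v n - (t - s) * \<sigma>2\<bar> \<le> \<epsilon> * (t - s) / (2 * q\<^sup>2)"
        using elim(1) unfolding d_def by auto
      have "expectation (\<lambda>\<omega>. min (6 * (W n s t \<omega>)\<^sup>2) (\<bar>l\<bar> * \<bar>W n s t \<omega>\<bar> ^ 3))
          \<le> expectation (\<lambda>\<omega>. q * \<kappa> * (W n s t \<omega>)\<^sup>2 + 24 * g \<omega>)"
      proof (rule integral_mono)
        show "integrable M (\<lambda>\<omega>. min (6 * (W n s t \<omega>)\<^sup>2) (\<bar>l\<bar> * \<bar>W n s t \<omega>\<bar> ^ 3))"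
        proof (rule Bochner_Integration.integrable_bound)
          show "integrable M (\<lambda>\<omega>. 6 * (W n s t \<omega>)\<^sup>2)" using W_sq_integrable[OF st'] by simp
        qed (auto simp: min_def)
        show "integrable M (\<lambda>\<omega>. q * \<kappa> * (W n s t \<omega>)\<^sup>2 + 24 * g \<omega>)"
          using W_sq_integrable[OF st'] g_int by simp
      qed (rule Wg)
      also have "\<dots> = q * \<kappa> * v n + 24 * expectation g"
        using W_sq_integrable[OF st', of n] g_int by (simp add: v_def)
      also have "\<dots> \<le> q * \<kappa> * (2 * ((t - s) * \<sigma>2)) + 24 * (e * (2 * (t - s)))"
        using v2 Eg q \<kappa> by (intro add_mono mult_left_mono) auto
      also have "q * \<kappa> * (2 * ((t - s) * \<sigma>2)) = 1 / 2 * (\<epsilon> * (t - s) / q\<^sup>2)"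
        using q \<sigma>2 by (simp add: \<kappa>_def power3_eq_cube power2_eq_square field_simps)
      also have "24 * (e * (2 * (t - s))) = 3 / 2 * (\<epsilon> * (t - s) / q\<^sup>2)"
        using q by (simp add: e_def field_simps)
      finally have rem: "expectation (\<lambda>\<omega>. min (6 * (W n s t \<omega>)\<^sup>2) (\<bar>l\<bar> * \<bar>W n s t \<omega>\<bar> ^ 3))
          \<le> 2 * (\<epsilon> * (t - s) / q\<^sup>2)" by simp
      have "cf n s t l = char (distr M borel (W n s t)) l"
        by (simp add: cf_def char_def integral_distr)
      moreover have "cmod (char (distr M borel (W n s t)) l - (1 - l\<^sup>2 * v n / 2))
          \<le> (l\<^sup>2 / 6) * expectation (\<lambda>\<omega>. min (6 * (W n s t \<omega>)\<^sup>2) (\<bar>l\<bar> * \<bar>W n s t \<omega>\<bar> ^ 3))"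
        using char_approx3'[OF W_meas W_integrable[OF st'] W_sq_integrable[OF st'] expectation_W _ refl, of n "v n" l]
        by (simp add: v_def expectation_W)
      moreover have "(l\<^sup>2 / 6) * expectation (\<lambda>\<omega>. min (6 * (W n s t \<omega>)\<^sup>2) (\<bar>l\<bar> * \<bar>W n s t \<omega>\<bar> ^ 3))
          \<le> (q\<^sup>2 / 6) * (2 * (\<epsilon> * (t - s) / q\<^sup>2))"
        using rem q st \<epsilon>
        by (intro mult_mono divide_right_mono) (auto simp: abs_le_square_iff[symmetric] intro!: integral_nonneg_AE)
      moreover have "(q\<^sup>2 / 6) * (2 * (\<epsilon> * (t - s) / q\<^sup>2)) = \<epsilon> * (t - s) / 3"
        using q by simp
      ultimately have 1: "cmod (cf n s t l - (1 - l\<^sup>2 * v n / 2)) \<le> \<epsilon> * (t - s) / 3" by simp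
      have "(1 - l\<^sup>2 * v n / 2) - (1 - l\<^sup>2 * ((t - s) * \<sigma>2) / 2)
          = complex_of_real (- (l\<^sup>2 / 2 * (v n - (t - s) * \<sigma>2)))"
        by (simp add: field_simps)
      then have "cmod ((1 - l\<^sup>2 * v n / 2) - (1 - l\<^sup>2 * ((t - s) * \<sigma>2) / 2))
          = l\<^sup>2 / 2 * \<bar>v n - (t - s) * \<sigma>2\<bar>"
        by (simp only: norm_of_real abs_minus abs_mult) simp
      also have "\<dots> \<le> q\<^sup>2 / 2 * (\<epsilon> * (t - s) / (2 * q\<^sup>2))"
        using v3 q by (intro mult_mono divide_right_mono) (auto simp: abs_le_square_iff[symmetric])
      also have "\<dots> = \<epsilon> * (t - s) / 4" using q by simp
      finally have 2: "cmod ((1 - l\<^sup>2 * v n / 2) - (1 - l\<^sup>2 * ((t - s) * \<sigma>2) / 2)) \<le> \<epsilon> * (t - s) / 4" .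
      have "cmod (cf n s t l - (1 - l\<^sup>2 * ((t - s) * \<sigma>2) / 2)) \<le> \<epsilon> * (t - s) / 3 + \<epsilon> * (t - s) / 4"
      proof -
        have *: "cmod (z - of_real b) \<le> cmod (z - of_real a) + cmod (of_real (a - b))" for z and a b :: real
          using norm_triangle_ineq[of "z - of_real a" "of_real (a - b)"] by simp
        show ?thesis by (rule order_trans[OF * add_mono[OF 1 2]])
      qed
      also have "\<dots> \<le> \<epsilon> * (t - s)"
      proof -
        have "0 \<le> \<epsilon> * (t - s)" using \<epsilon> st by simp
        then show ?thesis by simp
      qed
      finally show ?case .
    qed
  qed
qed

text \<open>With k equal blocks the product of the local expansions is (1 - c/k)^k, which tends to
  exp (- c). The k local errors add up to e (t - s), whatever k is, because \<open>cf_local\<close>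
  has an error proportional to the block length with an arbitrarily small factor. The number k is
  fixed before n tends to infinity.\<close>

lemma cf_lim:
  assumes "0 \<le> s" "s < t" "t \<le> 1"
  shows "(\<lambda>n. cf n s t l) \<longlonglongrightarrow> of_real (exp (- (l\<^sup>2 * ((t - s) * \<sigma>2) / 2)))"
proof (rule tendstoI)
  fix \<epsilon> :: real assume \<epsilon>: "\<epsilon> > 0"
  define c where "c = l\<^sup>2 * ((t - s) * \<sigma>2) / 2"
  have c: "c \<ge> 0" using assms \<sigma>2 by (simp add: c_def)
  define e where "e = \<epsilon> / (4 * (t - s))"
  have e: "e > 0" using \<epsilon> assms by (simp add: e_def)
  obtain \<delta> where \<delta>: "\<delta> > 0" and loc: "\<And>s t. 0 \<le> s \<Longrightarrow> s < t \<Longrightarrow> t \<le> 1 \<Longrightarrow> t - s \<le> \<delta> \<Longrightarrow>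
      (\<forall>\<^sub>F n in sequentially. cmod (cf n s t l - (1 - l\<^sup>2 * ((t - s) * \<sigma>2) / 2)) \<le> e * (t - s))"
    using cf_local[OF e, of l] by blast
  have "(\<lambda>k. (1 + (- c) / real k) ^ k) \<longlonglongrightarrow> exp (- c)" by (rule tendsto_exp_limit_sequentially)
  then have "\<forall>\<^sub>F k in sequentially. dist ((1 + (- c) / real k) ^ k) (exp (- c)) < \<epsilon> / 4"
    using \<epsilon> by (intro tendstoD) auto
  moreover have "\<forall>\<^sub>F k in sequentially. max ((t - s) / \<delta>) (max c 1) < real k"
    using filterlim_real_sequentially by (simp only: filterlim_at_top_dense)
  ultimately have "\<forall>\<^sub>F k in sequentially. dist ((1 + (- c) / real k) ^ k) (exp (- c)) < \<epsilon> / 4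
      \<and> max ((t - s) / \<delta>) (max c 1) < real k" by eventually_elim auto
  \<comment> \<open>The lower bounds on k make the blocks no longer than \<delta> and, through c <
    k, keep 1 - c/k within the unit disc, as the comparison of products requires.\<close>
  then obtain k where k1: "dist ((1 + (- c) / real k) ^ k) (exp (- c)) < \<epsilon> / 4"
    and k2: "(t - s) / \<delta> < real k" "c < real k" "1 < real k"
    by (auto simp: eventually_sequentially)
  define d where "d = (t - s) / real k"
  have d: "d > 0" "d \<le> \<delta>" "real k * d = t - s"
    using k2 assms \<delta> by (auto simp: d_def field_simps)
  define u where "u j = s + real j * d" for j
  have u: "u k = t" "u (Suc j) - u j = d" for j using d by (auto simp: u_def algebra_simps)
  have u01: "0 \<le> u j" "u j < u (Suc j)" "u (Suc j) \<le> 1" if "j < k" for j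
  proof -
    have "real (Suc j) * d \<le> real k * d" using that d by (intro mult_right_mono) auto
    then show "0 \<le> u j" "u j < u (Suc j)" "u (Suc j) \<le> 1"
      using assms d by (auto simp: u_def algebra_simps)
  qed
  have "\<forall>\<^sub>F n in sequentially. \<forall>j\<in>{..<k}. cmod (cf n (u j) (u (Suc j)) l - (1 - c / real k)) \<le> e * d"
  proof (rule eventually_ball_finite[OF finite_lessThan], rule ballI)
    fix j assume "j \<in> {..<k}"
    then have "\<forall>\<^sub>F n in sequentially. cmod (cf n (u j) (u (Suc j)) l - (1 - l\<^sup>2 * ((u (Suc j) - u j) * \<sigma>2) / 2)) \<le> e * (u (Suc j) - u j)"
      using u01[of j] d by (intro loc) (auto simp: u)
    moreover have "l\<^sup>2 * (d * \<sigma>2) / 2 = c / real k" by (simp add: c_def d_def)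
    then have "complex_of_real l ^ 2 * (d * \<sigma>2) / 2 = c / real k"
      by (metis (mono_tags) of_real_divide of_real_mult of_real_numeral of_real_of_nat_eq of_real_power)
    ultimately show "\<forall>\<^sub>F n in sequentially. cmod (cf n (u j) (u (Suc j)) l - (1 - c / real k)) \<le> e * d"
      unfolding u by simp
  qed
  moreover have "\<forall>\<^sub>F n in sequentially. dist (cf n s t l - (\<Prod>j<k. cf n (u j) (u (Suc j)) l)) 0 < \<epsilon> / 4"
    using cf_split_many[of d s k l] d \<epsilon> assms unfolding u_def
    by (intro tendstoD) auto
  ultimately show "\<forall>\<^sub>F n in sequentially. dist (cf n s t l) (of_real (exp (- (l\<^sup>2 * ((t - s) * \<sigma>2) / 2)))) < \<epsilon>"
  proof eventually_elim
    case (elim n)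
    have z: "norm (1 - complex_of_real c / of_nat k) \<le> 1"
    proof -
      have "1 - complex_of_real c / of_nat k = of_real (1 - c / real k)" by simp
      then have "norm (1 - complex_of_real c / of_nat k) = \<bar>1 - c / real k\<bar>" by (simp only: norm_of_real)
      then show ?thesis using c k2 by simp
    qed
    have "norm ((\<Prod>j<k. cf n (u j) (u (Suc j)) l) - (\<Prod>j<k. 1 - complex_of_real c / of_nat k))
      \<le> (\<Sum>j<k. norm (cf n (u j) (u (Suc j)) l - (1 - complex_of_real c / of_nat k)))"
      using cmod_cf_le_1 z by (intro norm_prod_diff) auto
    also have "\<dots> \<le> (\<Sum>j<k. e * d)" using elim(1) by (intro sum_mono) auto
    also have "\<dots> = e * (t - s)" using d by simp
    also have "\<dots> = \<epsilon> / 4"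
    proof -
      have *: "\<epsilon> / (4 * w) * w = \<epsilon> / 4" if "w \<noteq> 0" for w :: real using that by simp
      show ?thesis unfolding e_def by (rule *) (use assms in simp)
    qed
    finally have 1: "norm ((\<Prod>j<k. cf n (u j) (u (Suc j)) l) - (1 - complex_of_real c / of_nat k) ^ k) \<le> \<epsilon> / 4"
      by simp
    have "(1 - complex_of_real c / of_nat k) ^ k - of_real (exp (- c)) = of_real ((1 + (- c) / real k) ^ k - exp (- c))"
      by simp
    then have 2: "norm ((1 - complex_of_real c / of_nat k) ^ k - of_real (exp (- c))) < \<epsilon> / 4"
      using k1 by (simp only: norm_of_real dist_real_def)
    have 3: "norm (cf n s t l - (\<Prod>j<k. cf n (u j) (u (Suc j)) l)) < \<epsilon> / 4"
      using elim(2) by simp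
    have "norm (cf n s t l - of_real (exp (- c))) \<le> norm (cf n s t l - (\<Prod>j<k. cf n (u j) (u (Suc j)) l))
      + norm ((\<Prod>j<k. cf n (u j) (u (Suc j)) l) - (1 - complex_of_real c / of_nat k) ^ k)
      + norm ((1 - complex_of_real c / of_nat k) ^ k - of_real (exp (- c)))"
      by (rule order_trans[OF _ add_mono[OF norm_triangle_ineq order_refl]], rule order_trans[OF _ norm_triangle_ineq]) simp
    then have "norm (cf n s t l - of_real (exp (- c))) < \<epsilon>"
      using 1 2 3 \<epsilon> by linarith
    then show ?case by (simp add: dist_norm c_def)
  qed
qed

text \<open>Stated for V because the joint limit needs blocks separated by gaps;
  \<open>cf_V_lim\<close> transfers the limit from W. The law \<open>\<mu>\<close> is prescribed
  through the characteristic function of a centred normal law with variance (t - s)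
  \<sigma>2.\<close>

lemma V_weak_conv:
  assumes "0 \<le> s" "s < t" "t \<le> 1"
    and \<mu>: "real_distribution \<mu>" "\<And>l. char \<mu> l = of_real (exp (- (l\<^sup>2 * ((t - s) * \<sigma>2) / 2)))"
  shows "weak_conv_m (\<lambda>n. distr M borel (V n s t)) \<mu>"
proof (rule levy_continuity[OF _ \<mu>(1)])
  show "real_distribution (distr M borel (V n s t))" for n by simp
  fix l
  have "(\<lambda>n. (expectation (\<lambda>\<omega>. iexp (l * V n s t \<omega>)) - cf n s t l) + cf n s t l)
      \<longlonglongrightarrow> 0 + of_real (exp (- (l\<^sup>2 * ((t - s) * \<sigma>2) / 2)))"
    using assms by (intro tendsto_add cf_V_lim cf_lim) auto
  then have "(\<lambda>n. expectation (\<lambda>\<omega>. iexp (l * V n s t \<omega>))) \<longlonglongrightarrow> char \<mu> l"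
    by (simp only: \<mu>(2) diff_add_cancel add_0)
  moreover have "char (distr M borel (V n s t)) l = expectation (\<lambda>\<omega>. iexp (l * V n s t \<omega>))" for n
    by (simp add: char_def integral_distr)
  ultimately show "(\<lambda>n. char (distr M borel (V n s t)) l) \<longlonglongrightarrow> char \<mu> l"
    by (simp only:)
qed

end

section \<open>Joint convergence of asymptotically independent sequences\<close>

text \<open>The functional takes a whole sequence, but the bound makes it independent of all
  coordinates from k on. Finite-dimensional test functions can so be handled without restricting to
  a product space.\<close>

definition lip_coords :: "nat \<Rightarrow> real \<Rightarrow> ((nat \<Rightarrow> real) \<Rightarrow> real) \<Rightarrow> bool" where
  "lip_coords k c \<Phi> \<longleftrightarrow> (\<forall>x y. \<bar>\<Phi> x - \<Phi> y\<bar> \<le> c * (\<Sum>i<k. \<bar>x i - y i\<bar>))"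

lemma lip_coordsD: "lip_coords k c \<Phi> \<Longrightarrow> \<bar>\<Phi> x - \<Phi> y\<bar> \<le> c * (\<Sum>i<k. \<bar>x i - y i\<bar>)"
  by (auto simp: lip_coords_def)

lemma lip_coords_cong:
  assumes "lip_coords k c \<Phi>" "\<And>i. i < k \<Longrightarrow> x i = y i"
  shows "\<Phi> x = \<Phi> y"
  using lip_coordsD[OF assms(1), of x y] assms(2) by simp

lemma continuous_lip_coords:
  assumes "lip_coords k c \<Phi>"
  shows "continuous_on UNIV \<Phi>"
  unfolding continuous_on_def
proof
  fix x :: "nat \<Rightarrow> real"
  have "((\<lambda>y. c * (\<Sum>i<k. \<bar>y i - x i\<bar>)) \<longlongrightarrow> c * (\<Sum>i<k. \<bar>x i - x i\<bar>)) (at x)"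
  proof -
    have "((\<lambda>y. y i) \<longlongrightarrow> x i) (at x)" for i
      using continuous_on_product_coordinates[of i] unfolding continuous_on_def by auto
    then show ?thesis by (intro tendsto_intros)
  qed
  then have "((\<lambda>y. c * (\<Sum>i<k. \<bar>y i - x i\<bar>)) \<longlongrightarrow> 0) (at x)" by simp
  moreover have "\<forall>\<^sub>F y in at x. norm (\<Phi> y - \<Phi> x) \<le> c * (\<Sum>i<k. \<bar>y i - x i\<bar>)"
    using lip_coordsD[OF assms] by simp
  ultimately have "((\<lambda>y. \<Phi> y - \<Phi> x) \<longlongrightarrow> 0) (at x)" by (rule Lim_null_comparison[rotated])
  then show "(\<Phi> \<longlongrightarrow> \<Phi> x) (at x)" by (rule LIM_zero_cancel)
qed

lemma measurable_lip_coords: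
  assumes lip: "lip_coords k c \<Phi>" and X: "\<And>i. i < k \<Longrightarrow> X i \<in> borel_measurable F"
  shows "(\<lambda>\<omega>. \<Phi> (\<lambda>i. X i \<omega>)) \<in> borel_measurable F"
proof -
  \<comment> \<open>Only the first k coordinates are assumed measurable; the others are set to 0,
    which does not change the value of \<Phi>.\<close>
  have "(\<lambda>\<omega> i. if i < k then X i \<omega> else 0) \<in> borel_measurable F"
  proof (rule measurable_coordinatewise_then_product)
    show "(\<lambda>x. if i < k then X i x else 0) \<in> borel_measurable F" for i
      using X[of i] by (cases "i < k") auto
  qed
  moreover have "\<Phi> \<in> borel_measurable borel"
    using continuous_lip_coords[OF lip] by (rule borel_measurable_continuous_onI)
  ultimately have "(\<lambda>\<omega>. \<Phi> (\<lambda>i. if i < k then X i \<omega> else 0)) \<in> borel_measurable F"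
    by (rule measurable_compose)
  moreover have "\<Phi> (\<lambda>i. if i < k then X i \<omega> else 0) = \<Phi> (\<lambda>i. X i \<omega>)" for \<omega>
    by (rule lip_coords_cong[OF lip]) simp
  ultimately show ?thesis by simp
qed

lemma lip_coords_fun_upd:
  assumes "lip_coords (Suc k) c \<Phi>"
  shows "lip_coords k c (\<lambda>x. \<Phi> (x(k := a)))"
  unfolding lip_coords_def
proof (intro allI)
  fix x y :: "nat \<Rightarrow> real"
  have "\<bar>\<Phi> (x(k := a)) - \<Phi> (y(k := a))\<bar> \<le> c * (\<Sum>i<Suc k. \<bar>(x(k := a)) i - (y(k := a)) i\<bar>)"
    by (rule lip_coordsD[OF assms])
  also have "(\<Sum>i<Suc k. \<bar>(x(k := a)) i - (y(k := a)) i\<bar>) = (\<Sum>i<k. \<bar>x i - y i\<bar>)"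
    by simp
  finally show "\<bar>\<Phi> (x(k := a)) - \<Phi> (y(k := a))\<bar> \<le> c * (\<Sum>i<k. \<bar>x i - y i\<bar>)" .
qed

section \<open>Discretisation of the last coordinate\<close>

definition cell :: "real \<Rightarrow> int \<Rightarrow> real set" where
  "cell h j = {h * (of_int j - 1)<..h * of_int j}"

lemma cell_measurable [measurable]: "cell h j \<in> sets borel"
  by (simp add: cell_def)

text \<open>The union of the cells with index from -L to L. Cells are open on the left and closed on
  the right, so the ceiling of x / h is the index of the cell of x.\<close>

definition window :: "real \<Rightarrow> int \<Rightarrow> real set" where
  "window h L = {h * (- of_int L - 1)<..h * of_int L}"

lemma window_measurable [measurable]: "window h L \<in> sets borel"
  by (simp add: window_def)

lemma mem_cell_iff:
  assumes "h > 0"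
  shows "x \<in> cell h j \<longleftrightarrow> \<lceil>x / h\<rceil> = j"
  using assms by (auto simp: cell_def ceiling_eq_iff field_simps)

lemma mem_window_iff:
  assumes "h > 0"
  shows "x \<in> window h L \<longleftrightarrow> \<lceil>x / h\<rceil> \<in> {-L..L}"
proof -
  have "\<lceil>x / h\<rceil> \<in> {-L..L} \<longleftrightarrow> - of_int L - 1 < x / h \<and> x / h \<le> of_int L"
    by (auto simp: ceiling_le_iff le_ceiling_iff)
  also have "\<dots> \<longleftrightarrow> x \<in> window h L"
    using assms by (auto simp: window_def field_simps)
  finally show ?thesis by simp
qed

text \<open>Inside the window the last coordinate is moved to the right end of its cell, a distance
  of at most h; outside, the sum is 0 and the bound b on \<Phi> pays.\<close>

lemma discretize_last_coord:
  assumes lip: "lip_coords (Suc k) c \<Phi>" and b: "\<And>x. \<bar>\<Phi> x\<bar> \<le> b" and h: "h > 0" and c: "c \<ge> 0"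
  shows "\<bar>\<Phi> x - (\<Sum>j\<in>{-L..L}. \<Phi> (x(k := h * of_int j)) * indicator (cell h j) (x k))\<bar>
    \<le> c * h + b * indicator (- window h L) (x k)"
proof -
  define j where "j = \<lceil>x k / h\<rceil>"
  have b0: "b \<ge> 0" using b[of x] by linarith
  have ind: "indicator (cell h i) (x k) = (if i = j then 1 else 0 :: real)" for i
    using mem_cell_iff[OF h, of "x k" i] by (auto simp: j_def indicator_def)
  show ?thesis
  proof (cases "j \<in> {-L..L}")
    case True
    then have win: "x k \<in> window h L" using mem_window_iff[OF h, of "x k" L] by (simp add: j_def)
    have "(\<Sum>i\<in>{-L..L}. \<Phi> (x(k := h * of_int i)) * indicator (cell h i) (x k)) = \<Phi> (x(k := h * of_int j))"
      using True by (simp add: ind if_distrib[of "\<lambda>z. _ * z"] cong: if_cong)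
    moreover have "\<bar>\<Phi> x - \<Phi> (x(k := h * of_int j))\<bar> \<le> c * (\<Sum>i<Suc k. \<bar>x i - (x(k := h * of_int j)) i\<bar>)"
      by (rule lip_coordsD[OF lip])
    moreover have "(\<Sum>i<Suc k. \<bar>x i - (x(k := h * of_int j)) i\<bar>) = \<bar>x k - h * of_int j\<bar>" by simp
    moreover have "\<bar>x k - h * of_int j\<bar> \<le> h"
    proof -
      have "x k \<in> cell h j" using mem_cell_iff[OF h, of "x k" j] by (simp add: j_def)
      then show ?thesis by (simp add: cell_def algebra_simps abs_if)
    qed
    then have "c * \<bar>x k - h * of_int j\<bar> \<le> c * h" using c by (rule mult_left_mono)
    ultimately show ?thesis using win by simp
  next
    case False
    then have win: "x k \<notin> window h L" using mem_window_iff[OF h, of "x k" L] by (simp add: j_def)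
    have "(\<Sum>i\<in>{-L..L}. \<Phi> (x(k := h * of_int i)) * indicator (cell h i) (x k)) = 0"
      using False by (intro sum.neutral) (auto simp: ind)
    moreover have "0 \<le> c * h" using c h by simp
    ultimately show ?thesis using win b[of x] by simp
  qed
qed

context prob_space
begin

lemma expectation_discretize_last:
  fixes X :: "nat \<Rightarrow> 'a \<Rightarrow> real"
  assumes lip: "lip_coords (Suc k) c \<Phi>" and b: "\<And>x. \<bar>\<Phi> x\<bar> \<le> b" and h: "h > 0" and c: "c \<ge> 0"
    and X: "\<And>i. i \<le> k \<Longrightarrow> X i \<in> borel_measurable M"
  shows "\<bar>expectation (\<lambda>\<omega>. \<Phi> (\<lambda>i. X i \<omega>))
    - (\<Sum>j\<in>{-L..L}. expectation (\<lambda>\<omega>. \<Phi> ((\<lambda>i. X i \<omega>)(k := h * of_int j)) * indicator (cell h j) (X k \<omega>)))\<bar>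
    \<le> c * h + b * (1 - measure (distr M borel (X k)) (window h L))"
proof -
  have [measurable]: "X k \<in> borel_measurable M" using X by simp
  have P: "(\<lambda>\<omega>. \<Phi> (\<lambda>i. X i \<omega>)) \<in> borel_measurable M"
    by (rule measurable_lip_coords[OF lip]) (use X in auto)
  have Pj [measurable]: "(\<lambda>\<omega>. \<Phi> ((\<lambda>i. X i \<omega>)(k := a))) \<in> borel_measurable M" for a
    by (rule measurable_lip_coords[OF lip_coords_fun_upd[OF lip]]) (use X in auto)
  have iP: "integrable M (\<lambda>\<omega>. \<Phi> (\<lambda>i. X i \<omega>))"
    by (rule integrable_const_bound[where B = b]) (use P b in auto)
  have iPj: "integrable M (\<lambda>\<omega>. \<Phi> ((\<lambda>i. X i \<omega>)(k := h * of_int j)) * indicator (cell h j) (X k \<omega>))" for j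
  proof (rule integrable_const_bound[where B = b])
    show "AE x in M. norm (\<Phi> ((\<lambda>i. X i x)(k := h * real_of_int j)) * indicator (cell h j) (X k x)) \<le> b"
      using b order_trans[OF abs_ge_zero b] by (intro AE_I2) (auto simp: abs_mult indicator_def)
  qed measurable
  define S where "S \<omega> = (\<Sum>j\<in>{-L..L}. \<Phi> ((\<lambda>i. X i \<omega>)(k := h * of_int j)) * indicator (cell h j) (X k \<omega>))" for \<omega>
  have iS: "integrable M S" unfolding S_def using iPj by (rule Bochner_Integration.integrable_sum)
  have ES: "expectation S = (\<Sum>j\<in>{-L..L}. expectation (\<lambda>\<omega>. \<Phi> ((\<lambda>i. X i \<omega>)(k := h * of_int j)) * indicator (cell h j) (X k \<omega>)))"
    unfolding S_def using iPj by (rule Bochner_Integration.integral_sum)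
  have iI: "integrable M (\<lambda>\<omega>. indicator (- window h L) (X k \<omega>) :: real)"
    by (rule integrable_const_bound[where B = 1]) auto
  have "expectation (\<lambda>\<omega>. indicator (- window h L) (X k \<omega>) :: real)
      = measure (distr M borel (X k)) (- window h L)"
    by (subst integral_distr[symmetric, where N = borel and f = "indicator (- window h L)"]) auto
  also have "\<dots> = 1 - measure (distr M borel (X k)) (window h L)"
    using prob_space.prob_compl[OF prob_space_distr, of "X k" borel "window h L"]
    by (simp add: Compl_eq_Diff_UNIV)
  finally have EI: "expectation (\<lambda>\<omega>. indicator (- window h L) (X k \<omega>) :: real)
      = 1 - measure (distr M borel (X k)) (window h L)" .
  have "\<bar>expectation (\<lambda>\<omega>. \<Phi> (\<lambda>i. X i \<omega>)) - expectation S\<bar> = \<bar>expectation (\<lambda>\<omega>. \<Phi> (\<lambda>i. X i \<omega>) - S \<omega>)\<bar>"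
    using iP iS by simp
  also have "\<dots> \<le> expectation (\<lambda>\<omega>. \<bar>\<Phi> (\<lambda>i. X i \<omega>) - S \<omega>\<bar>)" by (rule integral_abs_bound)
  also have "\<dots> \<le> expectation (\<lambda>\<omega>. c * h + b * indicator (- window h L) (X k \<omega>))"
  proof (rule integral_mono)
    show "integrable M (\<lambda>\<omega>. \<bar>\<Phi> (\<lambda>i. X i \<omega>) - S \<omega>\<bar>)" using iP iS by simp
    show "integrable M (\<lambda>\<omega>. c * h + b * indicator (- window h L) (X k \<omega>))" using iI by simp
    show "\<bar>\<Phi> (\<lambda>i. X i \<omega>) - S \<omega>\<bar> \<le> c * h + b * indicator (- window h L) (X k \<omega>)" for \<omega>
      unfolding S_def by (rule discretize_last_coord[OF lip b h c])
  qed
  also have "\<dots> = c * h + b * (1 - measure (distr M borel (X k)) (window h L))"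
    using iI by (simp add: EI prob_space)
  finally show ?thesis unfolding ES .
qed

text \<open>The counterpart, on the limit side, of the mixing bound: independence makes the
  factorisation exact. \<Psi> factors through the restriction to \<open>{..<k}\<close> because it
  ignores the later coordinates.\<close>

lemma expectation_indep_last:
  fixes G :: "nat \<Rightarrow> 'a \<Rightarrow> real"
  assumes ind: "indep_vars (\<lambda>_. borel) G {..<Suc k}" and lip: "lip_coords k c \<Psi>" and b: "\<And>x. \<bar>\<Psi> x\<bar> \<le> b"
    and B [measurable]: "B \<in> sets borel"
  shows "expectation (\<lambda>\<omega>. \<Psi> (\<lambda>i. G i \<omega>) * indicator B (G k \<omega>))
    = expectation (\<lambda>\<omega>. \<Psi> (\<lambda>i. G i \<omega>)) * measure (distr M borel (G k)) B"
proof -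
  have G [measurable]: "G i \<in> borel_measurable M" if "i \<le> k" for i
    using ind that unfolding indep_vars_def2 by auto
  have Gk [measurable]: "G k \<in> borel_measurable M" by simp
  have "indep_var (PiM {..<k} (\<lambda>_. borel)) (\<lambda>\<omega>. restrict (\<lambda>i. G i \<omega>) {..<k})
      (PiM {k} (\<lambda>_. borel)) (\<lambda>\<omega>. restrict (\<lambda>i. G i \<omega>) {k})"
    by (rule indep_var_restrict[OF ind]) auto
  then have "indep_var borel (\<Psi> \<circ> (\<lambda>\<omega>. restrict (\<lambda>i. G i \<omega>) {..<k}))
      borel ((\<lambda>f. indicator B (f k) :: real) \<circ> (\<lambda>\<omega>. restrict (\<lambda>i. G i \<omega>) {k}))"
  proof (rule indep_var_compose)
    show "\<Psi> \<in> borel_measurable (PiM {..<k} (\<lambda>_. borel))"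
      using measurable_lip_coords[OF lip, of "\<lambda>i f. f i" "PiM {..<k} (\<lambda>_. borel)"] by simp
    show "(\<lambda>f. indicator B (f k) :: real) \<in> borel_measurable (PiM {k} (\<lambda>_. borel))"
      by measurable
  qed
  moreover have "\<Psi> \<circ> (\<lambda>\<omega>. restrict (\<lambda>i. G i \<omega>) {..<k}) = (\<lambda>\<omega>. \<Psi> (\<lambda>i. G i \<omega>))"
    unfolding comp_def by (intro ext lip_coords_cong[OF lip]) simp
  moreover have "(\<lambda>f. indicator B (f k) :: real) \<circ> (\<lambda>\<omega>. restrict (\<lambda>i. G i \<omega>) {k}) = (\<lambda>\<omega>. indicator B (G k \<omega>))"
    by (simp add: comp_def)
  ultimately have iv: "indep_var borel (\<lambda>\<omega>. \<Psi> (\<lambda>i. G i \<omega>)) borel (\<lambda>\<omega>. indicator B (G k \<omega>) :: real)"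
    by (simp only:)
  have "(\<lambda>\<omega>. \<Psi> (\<lambda>i. G i \<omega>)) \<in> borel_measurable M"
    by (rule measurable_lip_coords[OF lip]) simp
  then have i1: "integrable M (\<lambda>\<omega>. \<Psi> (\<lambda>i. G i \<omega>))"
    by (rule integrable_const_bound[where B = b, rotated]) (use b in auto)
  have i2: "integrable M (\<lambda>\<omega>. indicator B (G k \<omega>) :: real)"
    by (rule integrable_const_bound[where B = 1]) auto
  have "expectation (\<lambda>\<omega>. indicator B (G k \<omega>) :: real) = measure (distr M borel (G k)) B"
    by (subst integral_distr[symmetric, where N = borel and f = "indicator B"]) auto
  then show ?thesis using indep_var_lebesgue_integral[OF iv i1 i2] by simp
qed

text \<open>
  Discretising one coordinate at a time reduces the claim to products, to which the mixing bound applies.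
\<close>

lemma joint_convergence:
  fixes D :: "nat \<Rightarrow> nat \<Rightarrow> 'a \<Rightarrow> real" and G :: "nat \<Rightarrow> 'b \<Rightarrow> real"
  assumes N: "prob_space N"
    and conv: "\<And>i. i < k \<Longrightarrow> weak_conv_m (\<lambda>n. distr M borel (D n i)) (distr N borel (G i))"
    and atom: "\<And>i x. i < k \<Longrightarrow> measure (distr N borel (G i)) {x} = 0"
    and ind: "prob_space.indep_vars N (\<lambda>_. borel) G {..<k}"
    and mixb: "\<And>i n. i < k \<Longrightarrow> mixing_bound (F n i) (H n i) (\<alpha> n)" and \<alpha>: "\<alpha> \<longlonglongrightarrow> 0"
    and past: "\<And>n i j. i < k \<Longrightarrow> j < i \<Longrightarrow> D n j \<in> borel_measurable (F n i)"
    and fut: "\<And>n i. i < k \<Longrightarrow> D n i \<in> borel_measurable (H n i)"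
    and lip: "lip_coords k c \<Phi>" and b: "\<And>x. \<bar>\<Phi> x\<bar> \<le> b" and c: "c \<ge> 0"
  shows "(\<lambda>n. expectation (\<lambda>\<omega>. \<Phi> (\<lambda>i. D n i \<omega>))) \<longlonglongrightarrow> integral\<^sup>L N (\<lambda>\<omega>. \<Phi> (\<lambda>i. G i \<omega>))"
  using conv atom ind mixb past fut lip b
proof (induction k arbitrary: \<Phi>)
  case 0
  have "\<Phi> x = \<Phi> (\<lambda>_. 0)" for x by (rule lip_coords_cong[OF "0.prems"(7)]) simp
  then obtain a where a: "\<And>x. \<Phi> x = a" by blast
  show ?case by (simp add: a prob_space prob_space.prob_space[OF N])
next
  case (Suc k)
  interpret N: prob_space N by fact
  note conv = Suc.prems(1) and atom = Suc.prems(2) and ind = Suc.prems(3) and mixb = Suc.prems(4)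
    and past = Suc.prems(5) and fut = Suc.prems(6) and lip = Suc.prems(7) and b = Suc.prems(8)
  have b0: "b \<ge> 0" using order_trans[OF abs_ge_zero b] .
  have D [measurable]: "D n i \<in> borel_measurable M" if "i \<le> k" for n i
    using mixb[of i n] fut[of i n] that by (auto simp: mixing_bound_def intro: measurable_from_subalg)
  have G [measurable]: "G i \<in> borel_measurable N" if "i \<le> k" for i
    using ind that unfolding N.indep_vars_def2 by auto
  have rd: "real_distribution (distr M borel (D n k))" "real_distribution (distr N borel (G k))" for n
    using D[of k n] G[of k] by (auto intro: N.real_distribution_distr)
  \<comment> \<open>Freezing the last coordinate preserves both constants c and b, so the induction
    hypothesis applies to every section of \<Phi>.\<close>
  have IH: "(\<lambda>n. expectation (\<lambda>\<omega>. \<Psi> (\<lambda>i. D n i \<omega>))) \<longlonglongrightarrow> N.expectation (\<lambda>\<omega>. \<Psi> (\<lambda>i. G i \<omega>))"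
    if "lip_coords k c \<Psi>" "\<And>x. \<bar>\<Psi> x\<bar> \<le> b" for \<Psi>
    by (rule Suc.IH)
       (use that in \<open>auto intro!: conv atom mixb past fut intro: N.indep_vars_subset[OF ind]\<close>)
  \<comment> \<open>The limit law has no mass at the endpoints, so half-open intervals are
    continuity sets.\<close>
  have frontier: "(\<lambda>n. measure (distr M borel (D n k)) {x<..y}) \<longlonglongrightarrow> measure (distr N borel (G k)) {x<..y}"
    if "x < y" for x y
  proof (rule weak_conv_imp_continuity_set_conv[OF rd conv])
    have "frontier {x<..y} \<subseteq> {x} \<union> {y}" using that by (auto simp: frontier_def)
    then have "measure (distr N borel (G k)) (frontier {x<..y}) \<le> measure (distr N borel (G k)) ({x} \<union> {y})"
      using real_distribution.axioms[OF rd(2)]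
      by (intro finite_measure.finite_measure_mono) (auto simp: prob_space_def)
    also have "\<dots> \<le> measure (distr N borel (G k)) {x} + measure (distr N borel (G k)) {y}"
      by (rule measure_Un_le) auto
    also have "\<dots> = 0" using atom by simp
    finally have "measure (distr N borel (G k)) (frontier {x<..y}) = 0"
      by (simp add: measure_le_0_iff)
    moreover have "finite_measure (distr N borel (G k))"
      using real_distribution.axioms[OF rd(2)] by (simp add: prob_space_def)
    ultimately show "emeasure (distr N borel (G k)) (frontier {x<..y}) = 0"
      by (simp add: finite_measure.emeasure_eq_measure)
  qed auto
  show ?case
  proof (rule tendstoI)
    fix \<epsilon> :: real assume \<epsilon>: "\<epsilon> > 0"
    \<comment> \<open>Cell width h and tail mass e keep the discretisation error c h + b e below
      \<epsilon> / 4, once for the prelimit and once for the limit; the discretised expectations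
      eventually differ by less than \<epsilon> / 4. The added 1 protects the denominators when c or
      b is 0.\<close>
    define h where "h = \<epsilon> / (8 * (c + 1))"
    have h: "h > 0" using \<epsilon> c by (simp add: h_def)
    have ch: "c * h \<le> \<epsilon> / 8" using \<epsilon> c by (simp add: h_def field_simps)
    define e where "e = \<epsilon> / (8 * (b + 1))"
    have e: "e > 0" using \<epsilon> b0 by (simp add: e_def)
    have be: "b * e \<le> \<epsilon> / 8" using \<epsilon> b0 by (simp add: e_def field_simps)
    obtain L where L: "1 - measure (distr N borel (G k)) (window h L) < e" "0 \<le> L"
    proof -
      have "(\<lambda>L. measure (distr N borel (G k)) (window h (int L))) \<longlonglongrightarrow> measure (distr N borel (G k)) (\<Union>L. window h (int L))"
      proof (rule finite_measure.finite_Lim_measure_incseq)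
        show "finite_measure (distr N borel (G k))"
          using real_distribution.axioms[OF rd(2)] by (simp add: prob_space_def)
        show "range (\<lambda>L. window h (int L)) \<subseteq> sets (distr N borel (G k))" by auto
        show "incseq (\<lambda>L. window h (int L))"
          by (auto simp: incseq_def mem_window_iff[OF h])
      qed
      moreover have "(\<Union>L. window h (int L)) = UNIV"
      proof -
        have "x \<in> window h (int (nat \<bar>\<lceil>x / h\<rceil>\<bar>))" for x
          unfolding mem_window_iff[OF h] by auto
        then show ?thesis by blast
      qed
      moreover have "measure (distr N borel (G k)) UNIV = 1"
        using rd(2) prob_space.prob_space[of "distr N borel (G k)"] by (simp add: real_distribution_def)
      ultimately have "(\<lambda>L. measure (distr N borel (G k)) (window h (int L))) \<longlonglongrightarrow> 1" by simp
      then have "\<forall>\<^sub>F L in sequentially. 1 - e < measure (distr N borel (G k)) (window h (int L))"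
        using e by (intro order_tendstoD(1)) auto
      then obtain L where "1 - e < measure (distr N borel (G k)) (window h (int L))"
        by (auto simp: eventually_sequentially)
      then show ?thesis using that[of "int L"] by simp
    qed
    define J where "J n = (\<Sum>j\<in>{-L..L}. expectation (\<lambda>\<omega>. \<Phi> ((\<lambda>i. D n i \<omega>)(k := h * of_int j)) * indicator (cell h j) (D n k \<omega>)))" for n
    define J' where "J' = (\<Sum>j\<in>{-L..L}. N.expectation (\<lambda>\<omega>. \<Phi> ((\<lambda>i. G i \<omega>)(k := h * of_int j)) * indicator (cell h j) (G k \<omega>)))"
    have "J \<longlonglongrightarrow> J'"
      unfolding J_def[abs_def] J'_def
    proof (rule tendsto_sum)
      fix j
      define \<Psi> where "\<Psi> x = \<Phi> (x(k := h * of_int j))" for x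
      have lip': "lip_coords k c \<Psi>" unfolding \<Psi>_def by (rule lip_coords_fun_upd[OF lip])
      have b': "\<bar>\<Psi> x\<bar> \<le> b" for x unfolding \<Psi>_def by (rule b)
      have b'': "\<bar>\<Psi> x\<bar> \<le> b + 1" for x using b'[of x] by simp
      define P where "P n = measure (distr M borel (D n k)) (cell h j)" for n
      have P: "expectation (\<lambda>\<omega>. indicator (cell h j) (D n k \<omega>)) = P n" for n
        unfolding P_def by (subst integral_distr[symmetric, where N = borel and f = "indicator (cell h j)"]) auto
      have "P \<longlonglongrightarrow> measure (distr N borel (G k)) (cell h j)"
        unfolding P_def[abs_def] cell_def using h by (intro frontier) (simp add: algebra_simps)
      then have 1: "(\<lambda>n. expectation (\<lambda>\<omega>. \<Psi> (\<lambda>i. D n i \<omega>)) * P n) \<longlonglongrightarrow>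
          N.expectation (\<lambda>\<omega>. \<Psi> (\<lambda>i. G i \<omega>)) * measure (distr N borel (G k)) (cell h j)"
        by (intro tendsto_mult IH lip' b')
      have 2: "(\<lambda>n. expectation (\<lambda>\<omega>. \<Psi> (\<lambda>i. D n i \<omega>) * indicator (cell h j) (D n k \<omega>))
          - expectation (\<lambda>\<omega>. \<Psi> (\<lambda>i. D n i \<omega>)) * P n) \<longlonglongrightarrow> 0"
      proof (rule Lim_null_comparison)
        have "(\<lambda>n. 4 * \<alpha> n * (b + 1) * 1) \<longlonglongrightarrow> 4 * 0 * (b + 1) * 1"
          by (intro tendsto_intros \<alpha>)
        then show "(\<lambda>n. 4 * \<alpha> n * (b + 1) * 1) \<longlonglongrightarrow> 0" by simp
        \<comment> \<open>\<Psi> reads coordinates below k, which belong to the past, and the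
          indicator reads coordinate k, which belongs to the future. The bound is b + 1 because
          \<open>cov_bounded\<close> asks for positive bounds.\<close>
        have "\<bar>expectation (\<lambda>\<omega>. \<Psi> (\<lambda>i. D n i \<omega>) * indicator (cell h j) (D n k \<omega>))
          - expectation (\<lambda>\<omega>. \<Psi> (\<lambda>i. D n i \<omega>)) * expectation (\<lambda>\<omega>. indicator (cell h j) (D n k \<omega>))\<bar> \<le> 4 * \<alpha> n * (b + 1) * 1" for n
        proof (rule cov_bounded[OF mixb[OF lessI]])
          show "(\<lambda>\<omega>. \<Psi> (\<lambda>i. D n i \<omega>)) \<in> borel_measurable (F n k)"
            by (rule measurable_lip_coords[OF lip']) (rule past; simp)
          have [measurable]: "D n k \<in> borel_measurable (H n k)" by (rule fut) simp
          show "(\<lambda>\<omega>. indicator (cell h j) (D n k \<omega>) :: real) \<in> borel_measurable (H n k)" by measurable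
        qed (use b0 b'' in \<open>auto simp: indicator_def\<close>)
        then show "\<forall>\<^sub>F n in sequentially. norm (expectation (\<lambda>\<omega>. \<Psi> (\<lambda>i. D n i \<omega>) * indicator (cell h j) (D n k \<omega>))
          - expectation (\<lambda>\<omega>. \<Psi> (\<lambda>i. D n i \<omega>)) * P n) \<le> 4 * \<alpha> n * (b + 1) * 1"
          unfolding P by simp
      qed
      have "(\<lambda>n. expectation (\<lambda>\<omega>. \<Psi> (\<lambda>i. D n i \<omega>) * indicator (cell h j) (D n k \<omega>)))
         \<longlonglongrightarrow> N.expectation (\<lambda>\<omega>. \<Psi> (\<lambda>i. G i \<omega>)) * measure (distr N borel (G k)) (cell h j)"
        using tendsto_add[OF 2 1] by simp
      then show "(\<lambda>n. expectation (\<lambda>\<omega>. \<Phi> ((\<lambda>i. D n i \<omega>)(k := h * of_int j)) * indicator (cell h j) (D n k \<omega>)))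
         \<longlonglongrightarrow> N.expectation (\<lambda>\<omega>. \<Phi> ((\<lambda>i. G i \<omega>)(k := h * of_int j)) * indicator (cell h j) (G k \<omega>))"
        using N.expectation_indep_last[OF ind lip' b' cell_measurable[of h j]] by (simp add: \<Psi>_def)
    qed
    then have ev1: "\<forall>\<^sub>F n in sequentially. dist (J n) J' < \<epsilon> / 4" using \<epsilon> by (intro tendstoD) auto
    have "(\<lambda>n. 1 - measure (distr M borel (D n k)) (window h L)) \<longlonglongrightarrow> 1 - measure (distr N borel (G k)) (window h L)"
    proof -
      have "h * (- of_int L - 1) < h * of_int L" using h L(2) by (intro mult_strict_left_mono) auto
      then show ?thesis unfolding window_def by (intro tendsto_intros frontier)
    qed
    then have ev2: "\<forall>\<^sub>F n in sequentially. 1 - measure (distr M borel (D n k)) (window h L) < e"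
      using L(1) by (rule order_tendstoD(2))
    have lim: "\<bar>N.expectation (\<lambda>\<omega>. \<Phi> (\<lambda>i. G i \<omega>)) - J'\<bar> \<le> c * h + b * e"
    proof -
      have "\<bar>N.expectation (\<lambda>\<omega>. \<Phi> (\<lambda>i. G i \<omega>)) - J'\<bar> \<le> c * h + b * (1 - measure (distr N borel (G k)) (window h L))"
        unfolding J'_def by (rule N.expectation_discretize_last[OF lip b h c G])
      also have "\<dots> \<le> c * h + b * e" using L b0 by (intro add_left_mono mult_left_mono) auto
      finally show ?thesis .
    qed
    show "\<forall>\<^sub>F n in sequentially. dist (expectation (\<lambda>\<omega>. \<Phi> (\<lambda>i. D n i \<omega>))) (N.expectation (\<lambda>\<omega>. \<Phi> (\<lambda>i. G i \<omega>))) < \<epsilon>"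
      using ev1 ev2
    proof eventually_elim
      case (elim n)
      have "\<bar>expectation (\<lambda>\<omega>. \<Phi> (\<lambda>i. D n i \<omega>)) - J n\<bar> \<le> c * h + b * (1 - measure (distr M borel (D n k)) (window h L))"
        unfolding J_def by (rule expectation_discretize_last[OF lip b h c D])
      also have "\<dots> \<le> c * h + b * e" using elim(2) b0 by (intro add_left_mono mult_left_mono) auto
      finally have "\<bar>expectation (\<lambda>\<omega>. \<Phi> (\<lambda>i. D n i \<omega>)) - J n\<bar> \<le> c * h + b * e" .
      then show ?case using elim(1) lim ch be \<epsilon> unfolding dist_real_def by linarith
    qed
  qed
qed

end

section \<open>Path functionals and their grid approximations\<close>

definition osc :: "('i \<Rightarrow> real) \<Rightarrow> 'i set \<Rightarrow> real" where
  "osc f A = (SUP r\<in>A. f r) - (INF r\<in>A. f r)"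

lemma osc_approx_aux:
  assumes A: "A \<noteq> {}" and J: "bdd_above (g ` J)" "bdd_below (g ` J)"
    and ap: "\<And>r. r \<in> A \<Longrightarrow> \<exists>j\<in>J. \<bar>f r - g j\<bar> \<le> d"
  shows "osc f A \<le> osc g J + 2 * d"
proof -
  have "(SUP r\<in>A. f r) \<le> (SUP j\<in>J. g j) + d"
  proof (rule cSUP_least[OF A])
    fix r assume "r \<in> A"
    then obtain j where j: "j \<in> J" "\<bar>f r - g j\<bar> \<le> d" using ap by blast
    then have "g j \<le> (SUP j\<in>J. g j)" using J(1) by (intro cSUP_upper)
    then show "f r \<le> (SUP j\<in>J. g j) + d" using j by linarith
  qed
  moreover have "(INF j\<in>J. g j) - d \<le> (INF r\<in>A. f r)"
  proof (rule cINF_greatest[OF A])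
    fix r assume "r \<in> A"
    then obtain j where j: "j \<in> J" "\<bar>f r - g j\<bar> \<le> d" using ap by blast
    then have "(INF j\<in>J. g j) \<le> g j" using J(2) by (intro cINF_lower)
    then show "(INF j\<in>J. g j) - d \<le> f r" using j by linarith
  qed
  ultimately show ?thesis unfolding osc_def by linarith
qed

text \<open>Only the sets of values matter: if each value of one function lies within d of a value
  of the other, and conversely, supremum and infimum move by at most d each. The index sets may
  differ, so that a coarse grid can be compared with \<open>{..n}\<close> and with the interval
  [0,1].\<close>

lemma osc_approx:
  assumes "A \<noteq> {}" "bdd_above (f ` A)" "bdd_below (f ` A)"
    and "J \<noteq> {}" "bdd_above (g ` J)" "bdd_below (g ` J)"
    and ap: "\<And>r. r \<in> A \<Longrightarrow> \<exists>j\<in>J. \<bar>f r - g j\<bar> \<le> d" "\<And>j. j \<in> J \<Longrightarrow> \<exists>r\<in>A. \<bar>f r - g j\<bar> \<le> d"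
  shows "\<bar>osc f A - osc g J\<bar> \<le> 2 * d"
proof -
  have "osc f A \<le> osc g J + 2 * d" using assms by (intro osc_approx_aux) auto
  moreover have "osc g J \<le> osc f A + 2 * d"
    using assms by (intro osc_approx_aux) (auto simp: abs_minus_commute)
  ultimately show ?thesis by linarith
qed

lemma osc_image: "osc f (\<phi> ` A) = osc (\<lambda>x. f (\<phi> x)) A"
  by (simp add: osc_def image_image)

lemma osc_cong: "(\<And>r. r \<in> A \<Longrightarrow> f r = g r) \<Longrightarrow> osc f A = osc g A"
  by (simp add: osc_def cong: SUP_cong INF_cong)

lemma osc_scale:
  assumes c: "c > 0" and A: "A \<noteq> {}" and bdd: "bdd_above (f ` A)" "bdd_below (f ` A)"
  shows "osc (\<lambda>r. c * f r) A = c * osc f A"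
proof -
  obtain u l where u: "\<And>r. r \<in> A \<Longrightarrow> f r \<le> u" and l: "\<And>r. r \<in> A \<Longrightarrow> l \<le> f r"
    using bdd by (auto simp: bdd_above_def bdd_below_def)
  have ba: "bdd_above ((\<lambda>r. c * f r) ` A)" using u c by (intro bdd_aboveI2[where M = "c * u"]) auto
  have bb: "bdd_below ((\<lambda>r. c * f r) ` A)" using l c by (intro bdd_belowI2[where m = "c * l"]) auto
  have "(SUP r\<in>A. c * f r) = c * (SUP r\<in>A. f r)"
  proof (rule antisym)
    show "(SUP r\<in>A. c * f r) \<le> c * (SUP r\<in>A. f r)"
      using c bdd by (intro cSUP_least[OF A] mult_left_mono cSUP_upper) auto
    have "(SUP r\<in>A. f r) \<le> (SUP r\<in>A. c * f r) / c"
    proof (rule cSUP_least[OF A])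
      fix r assume "r \<in> A"
      then have "c * f r \<le> (SUP r\<in>A. c * f r)" using ba by (intro cSUP_upper)
      then show "f r \<le> (SUP r\<in>A. c * f r) / c" using c by (simp add: field_simps)
    qed
    then show "c * (SUP r\<in>A. f r) \<le> (SUP r\<in>A. c * f r)" using c by (simp add: field_simps)
  qed
  moreover have "(INF r\<in>A. c * f r) = c * (INF r\<in>A. f r)"
  proof (rule antisym)
    show "c * (INF r\<in>A. f r) \<le> (INF r\<in>A. c * f r)"
      using c bdd by (intro cINF_greatest[OF A] mult_left_mono cINF_lower) auto
    have "(INF r\<in>A. c * f r) / c \<le> (INF r\<in>A. f r)"
    proof (rule cINF_greatest[OF A])
      fix r assume "r \<in> A"
      then have "(INF r\<in>A. c * f r) \<le> c * f r" using bb by (intro cINF_lower)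
      then show "(INF r\<in>A. c * f r) / c \<le> f r" using c by (simp add: field_simps)
    qed
    then show "(INF r\<in>A. c * f r) \<le> c * (INF r\<in>A. f r)" using c by (simp add: field_simps)
  qed
  ultimately show ?thesis by (simp add: osc_def right_diff_distrib)
qed

lemma measurable_osc_finite:
  assumes A: "finite A" "A \<noteq> {}" and f: "\<And>k. k \<in> A \<Longrightarrow> f k \<in> borel_measurable F"
  shows "(\<lambda>\<omega>. osc (\<lambda>k. f k \<omega>) A) \<in> borel_measurable F"
  unfolding osc_def
  by (intro borel_measurable_diff borel_measurable_cSUP borel_measurable_cINF f)
     (use A in \<open>auto simp: countable_finite\<close>)

text \<open>For increments x over K equal steps, the path of their partial sums tied down to 0 at
  both ends: the discrete counterpart of a bridge at time j / K.\<close>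

definition grid_path :: "nat \<Rightarrow> (nat \<Rightarrow> real) \<Rightarrow> nat \<Rightarrow> real" where
  "grid_path K x j = (\<Sum>i<j. x i) - real j / real K * (\<Sum>i<K. x i)"

definition grid_fun :: "nat \<Rightarrow> real \<Rightarrow> real \<Rightarrow> (nat \<Rightarrow> real) \<Rightarrow> real" where
  "grid_fun K a b x = a * \<bar>\<Sum>i<K. x i\<bar> + b * osc (grid_path K x) {..K}"

text \<open>A total change d of the increments moves the tied-down path by at most 2d, one d from
  the partial sum and one from the drift; the oscillation then moves by at most 4d.\<close>

lemma lip_coords_grid_fun: "lip_coords K (\<bar>a\<bar> + 4 * \<bar>b\<bar>) (grid_fun K a b)"
  unfolding lip_coords_def
proof (intro allI)
  fix x y :: "nat \<Rightarrow> real"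
  define d where "d = (\<Sum>i<K. \<bar>x i - y i\<bar>)"
  have d: "0 \<le> d" by (simp add: d_def sum_nonneg)
  have s: "\<bar>(\<Sum>i<j. x i) - (\<Sum>i<j. y i)\<bar> \<le> d" if "j \<le> K" for j
  proof -
    have "\<bar>(\<Sum>i<j. x i) - (\<Sum>i<j. y i)\<bar> \<le> (\<Sum>i<j. \<bar>x i - y i\<bar>)"
      by (simp add: sum_subtractf[symmetric] sum_abs)
    also have "\<dots> \<le> d" unfolding d_def using that by (intro sum_mono2) auto
    finally show ?thesis .
  qed
  have g: "\<bar>grid_path K x j - grid_path K y j\<bar> \<le> 2 * d" if "j \<le> K" for j
  proof -
    have "real j / real K \<le> 1" using that by (cases "K = 0") auto
    then have "\<bar>real j / real K * ((\<Sum>i<K. x i) - (\<Sum>i<K. y i))\<bar> \<le> 1 * d"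
      unfolding abs_mult using s[of K] by (intro mult_mono) auto
    moreover have "grid_path K x j - grid_path K y j
      = ((\<Sum>i<j. x i) - (\<Sum>i<j. y i)) - real j / real K * ((\<Sum>i<K. x i) - (\<Sum>i<K. y i))"
      by (simp add: grid_path_def right_diff_distrib)
    moreover have "\<bar>p - q\<bar> \<le> 2 * d" if "\<bar>p\<bar> \<le> d" "\<bar>q\<bar> \<le> 1 * d" for p q :: real
      using that by linarith
    ultimately show ?thesis using s[OF that] by simp
  qed
  have "\<bar>osc (grid_path K x) {..K} - osc (grid_path K y) {..K}\<bar> \<le> 2 * (2 * d)"
    by (rule osc_approx) (use g in \<open>auto intro: bexI[rotated]\<close>)
  then have "\<bar>b * (osc (grid_path K x) {..K} - osc (grid_path K y) {..K})\<bar> \<le> \<bar>b\<bar> * (4 * d)"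
    unfolding abs_mult by (intro mult_left_mono) auto
  moreover have "\<bar>\<bar>\<Sum>i<K. x i\<bar> - \<bar>\<Sum>i<K. y i\<bar>\<bar> \<le> d" using s[of K] by linarith
  then have "\<bar>a * (\<bar>\<Sum>i<K. x i\<bar> - \<bar>\<Sum>i<K. y i\<bar>)\<bar> \<le> \<bar>a\<bar> * d"
    unfolding abs_mult by (intro mult_left_mono) auto
  moreover have "grid_fun K a b x - grid_fun K a b y
    = a * (\<bar>\<Sum>i<K. x i\<bar> - \<bar>\<Sum>i<K. y i\<bar>) + b * (osc (grid_path K x) {..K} - osc (grid_path K y) {..K})"
    by (simp add: grid_fun_def right_diff_distrib)
  ultimately have "\<bar>grid_fun K a b x - grid_fun K a b y\<bar> \<le> \<bar>a\<bar> * d + \<bar>b\<bar> * (4 * d)" by linarith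
  then show "\<bar>grid_fun K a b x - grid_fun K a b y\<bar> \<le> (\<bar>a\<bar> + 4 * \<bar>b\<bar>) * (\<Sum>i<K. \<bar>x i - y i\<bar>)"
    by (simp add: d_def algebra_simps)
qed

text \<open>\<open>cts_step\<close> is an affine function clamped to [0,1]. Its Lipschitz constant
  converts errors in mean into errors of expectations of test functions.\<close>

lemma cts_step_lipschitz:
  assumes "u < v"
  shows "\<bar>cts_step u v x - cts_step u v y\<bar> \<le> 1 / (v - u) * \<bar>x - y\<bar>"
proof -
  have eq: "cts_step u v z = max 0 (min 1 ((v - z) / (v - u)))" for z
    using assms by (auto simp: cts_step_def field_simps max_def min_def)
  have "\<bar>max 0 (min 1 s) - max 0 (min 1 t)\<bar> \<le> \<bar>s - t\<bar>" for s t :: real by linarith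
  then have "\<bar>cts_step u v x - cts_step u v y\<bar> \<le> \<bar>(v - x) / (v - u) - (v - y) / (v - u)\<bar>"
    unfolding eq .
  also have "(v - x) / (v - u) - (v - y) / (v - u) = 1 / (v - u) * (y - x)"
    by (simp add: diff_divide_distrib)
  also have "\<bar>\<dots>\<bar> = 1 / (v - u) * \<bar>x - y\<bar>" using assms by (simp add: abs_mult abs_minus_commute)
  finally show ?thesis .
qed

lemma cts_step_bound:
  assumes "u < v"
  shows "\<bar>cts_step u v x\<bar> \<le> 1"
  using assms by (auto simp: cts_step_def)

lemma lip_coords_cts_step:
  assumes "u < v" "lip_coords K c \<Phi>"
  shows "lip_coords K (1 / (v - u) * c) (\<lambda>x. cts_step u v (\<Phi> x))"
  unfolding lip_coords_def
proof (intro allI)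
  fix x y :: "nat \<Rightarrow> real"
  have "\<bar>cts_step u v (\<Phi> x) - cts_step u v (\<Phi> y)\<bar> \<le> 1 / (v - u) * \<bar>\<Phi> x - \<Phi> y\<bar>"
    by (rule cts_step_lipschitz[OF assms(1)])
  also have "\<dots> \<le> 1 / (v - u) * (c * (\<Sum>i<K. \<bar>x i - y i\<bar>))"
    using assms(1) lip_coordsD[OF assms(2)] by (intro mult_left_mono) auto
  finally show "\<bar>cts_step u v (\<Phi> x) - cts_step u v (\<Phi> y)\<bar> \<le> 1 / (v - u) * c * (\<Sum>i<K. \<bar>x i - y i\<bar>)"
    by (simp only: mult.assoc)
qed

lemma measurable_cts_step [measurable]:
  assumes "u < v"
  shows "cts_step u v \<in> borel_measurable borel"
  using cts_step_uniformly_continuous[OF assms]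
  by (intro borel_measurable_continuous_onI uniformly_continuous_imp_continuous)

section \<open>Approximation of the range on a fixed grid\<close>

context fclt_seq
begin

lemma idx_0 [simp]: "idx n 0 = 0"
  by (simp add: idx_def)

lemma idx_1 [simp]: "idx n 1 = n"
  by (simp add: idx_def)

definition range_stat :: "nat \<Rightarrow> 'a \<Rightarrow> real" where
  "range_stat n \<omega> = osc (\<lambda>k. ((\<Sum>i<k. X i \<omega>) - real k / real n * (\<Sum>i<n. X i \<omega>)) / sqrt (real n)) {..n}"

lemma measurable_range_stat [measurable]: "range_stat n \<in> borel_measurable M"
  unfolding range_stat_def by (rule measurable_osc_finite) auto

definition Wgrid :: "nat \<Rightarrow> nat \<Rightarrow> 'a \<Rightarrow> nat \<Rightarrow> real" where
  "Wgrid K n \<omega> i = W n (real i / real K) (real (Suc i) / real K) \<omega>"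

lemma sum_Wgrid: "(\<Sum>i<j. Wgrid K n \<omega> i) = W n 0 (real j / real K) \<omega>"
proof (induction j)
  case 0
  then show ?case by (simp add: W_def)
next
  case (Suc j)
  have "W n 0 (real (Suc j) / real K) \<omega> = W n 0 (real j / real K) \<omega> + W n (real j / real K) (real (Suc j) / real K) \<omega>"
    by (rule W_add) (auto simp: divide_right_mono)
  then show ?case using Suc by (simp add: Wgrid_def)
qed

lemma W_0: "W n 0 r \<omega> = (\<Sum>i<idx n r. X i \<omega>) / sqrt (real n)"
  by (simp add: W_def atLeast0LessThan)

definition grid_block :: "nat \<Rightarrow> nat \<Rightarrow> nat \<Rightarrow> nat" where
  "grid_block K n i = idx n (real (Suc i) / real K) - idx n (real i / real K)"

definition excess :: "real \<Rightarrow> nat \<Rightarrow> nat \<Rightarrow> 'a \<Rightarrow> nat \<Rightarrow> real" where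
  "excess A K n \<omega> i = (max 0 (block_max (idx n (real i / real K)) (grid_block K n i) \<omega>
      - A * sqrt (real (grid_block K n i))))\<^sup>2"

text \<open>Rounding adds at most one index to a block, and K <= n makes one index at most n /
  K.\<close>

lemma grid_block_le:
  assumes "0 < K" "K \<le> n"
  shows "real (grid_block K n i) / real n \<le> 2 / real K"
proof -
  have "real (grid_block K n i) \<le> real n * (real (Suc i) / real K - real i / real K) + 1"
    unfolding grid_block_def by (rule idx_diff_le) (auto simp: divide_right_mono)
  also have "real (Suc i) / real K - real i / real K = 1 / real K"
    by (simp add: diff_divide_distrib[symmetric])
  also have "real n * (1 / real K) + 1 \<le> real n * (2 / real K)"
    using assms by (simp add: field_simps)
  finally show ?thesis using assms by (simp add: field_simps)
qed

text \<open>Within a block the partial sum departs from its value at the left end by at most the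
  block maximum, and the drift changes by at most 2 / K times |W n 0 1|. The largest block maximum
  is bounded by \<delta> plus a sum of squared excesses over all blocks, so that expectations can be
  taken term by term.\<close>

lemma range_stat_grid_le:
  assumes K: "0 < K" "K \<le> n" and \<delta>: "\<delta> > 0" and A: "A > 0" "8 * A\<^sup>2 \<le> \<delta>\<^sup>2 * real K"
  shows "\<bar>range_stat n \<omega> - osc (grid_path K (Wgrid K n \<omega>)) {..K}\<bar>
    \<le> 2 * (\<delta> + (\<Sum>i<K. 2 / \<delta> * (excess A K n \<omega> i / real n)) + 2 / real K * \<bar>W n 0 1 \<omega>\<bar>)"
proof -
  have n: "real n > 0" using K by simp
  define w where "w = W n 0 1 \<omega>"
  have w: "w = (\<Sum>i<n. X i \<omega>) / sqrt (real n)" by (simp add: w_def W_0)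
  define f where "f k = ((\<Sum>i<k. X i \<omega>) - real k / real n * (\<Sum>i<n. X i \<omega>)) / sqrt (real n)" for k
  have f: "f k = (\<Sum>i<k. X i \<omega>) / sqrt (real n) - real k / real n * w" for k
    by (simp add: f_def w diff_divide_distrib)
  have g: "grid_path K (Wgrid K n \<omega>) j = (\<Sum>i<idx n (real j / real K). X i \<omega>) / sqrt (real n) - real j / real K * w" for j
    using K by (simp add: grid_path_def sum_Wgrid W_0 w)
  define E where "E = \<delta> + (\<Sum>i<K. 2 / \<delta> * (excess A K n \<omega> i / real n))"
  have ex0: "0 \<le> 2 / \<delta> * (excess A K n \<omega> i / real n)" for i using \<delta> by (simp add: excess_def)
  have E0: "0 \<le> E" unfolding E_def using \<delta> ex0 by (intro add_nonneg_nonneg sum_nonneg) auto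
  have block: "block_max (idx n (real j / real K)) (grid_block K n j) \<omega> / sqrt (real n) \<le> E" if j: "j < K" for j
  proof -
    define y where "y = block_max (idx n (real j / real K)) (grid_block K n j) \<omega> / sqrt (real n)"
    define c where "c = A * sqrt (real (grid_block K n j)) / sqrt (real n)"
    have c0: "0 \<le> c" using A by (simp add: c_def)
    have "c\<^sup>2 = A\<^sup>2 * (real (grid_block K n j) / real n)"
      by (simp add: c_def power_mult_distrib power_divide)
    also have "\<dots> \<le> A\<^sup>2 * (2 / real K)" using grid_block_le[OF K, of j] by (intro mult_left_mono) auto
    also have "\<dots> \<le> (\<delta> / 2)\<^sup>2" using A K by (simp add: field_simps power_divide)
    finally have c: "c \<le> \<delta> / 2" by (rule power2_le_imp_le) (use \<delta> in simp)
    define z where "z = max 0 (y - c)"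
    have z: "z\<^sup>2 = excess A K n \<omega> j / real n"
    proof -
      have "z = max 0 (block_max (idx n (real j / real K)) (grid_block K n j) \<omega> - A * sqrt (real (grid_block K n j))) / sqrt (real n)"
        using n by (simp add: z_def y_def c_def diff_divide_distrib max_divide_distrib_right)
      then show ?thesis by (simp add: excess_def power_divide)
    qed
    \<comment> \<open>The level c is at most \<delta> / 2, so y > \<delta> forces z >= \<delta> / 2,
      and then z is at most (2 / \<delta>) z^2.\<close>
    have "y \<le> \<delta> + 2 / \<delta> * z\<^sup>2"
    proof (cases "y \<le> \<delta>")
      case True
      have "0 \<le> 2 / \<delta> * z\<^sup>2" using \<delta> by simp
      then show ?thesis using True by linarith
    next
      case False
      then have "\<delta> / 2 \<le> y - c" "0 \<le> y - c" using c \<delta> by linarith+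
      then have z1: "z = y - c" "\<delta> / 2 \<le> z" by (simp_all add: z_def)
      then have "\<delta> / 2 * z \<le> z * z" using \<delta> by (intro mult_right_mono) auto
      then have "z \<le> 2 / \<delta> * z\<^sup>2" using \<delta> by (simp add: field_simps power2_eq_square)
      then show ?thesis using z1 c \<delta> by linarith
    qed
    also have "2 / \<delta> * z\<^sup>2 \<le> (\<Sum>i<K. 2 / \<delta> * (excess A K n \<omega> i / real n))"
      unfolding z using j ex0 by (intro member_le_sum) auto
    finally show ?thesis by (simp add: y_def E_def)
  qed
  have nK: "1 / real n \<le> 2 / real K" "1 / real K \<le> 2 / real K" using K by (auto simp: field_simps)
  have lo: "real (idx n (real j / real K)) \<le> real n * (real j / real K)"
    "real n * (real j / real K) < real (idx n (real j / real K)) + 1" for j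
    unfolding idx_def by (simp_all add: of_nat_nat floor_correct)
  have "\<bar>osc f {..n} - osc (grid_path K (Wgrid K n \<omega>)) {..K}\<bar> \<le> 2 * (E + 2 / real K * \<bar>w\<bar>)"
  proof (rule osc_approx)
    fix k assume "k \<in> {..n}"
    then have kn: "k \<le> n" by simp
    show "\<exists>j\<in>{..K}. \<bar>f k - grid_path K (Wgrid K n \<omega>) j\<bar> \<le> E + 2 / real K * \<bar>w\<bar>"
    proof (cases "k = n")
      case True
      have "f k - grid_path K (Wgrid K n \<omega>) K = 0" using True n K by (simp add: f g)
      then show ?thesis using E0 by (intro bexI[of _ K]) auto
    next
      case False
      \<comment> \<open>The block that contains k: j / K <= k / n < (j + 1) / K. Since k < n in this
        case, j < K, so j is the left end of an actual block.\<close>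
      define j where "j = k * K div n"
      have "j * n \<le> k * K" unfolding j_def by (metis div_times_less_eq_dividend)
      moreover have "k * K < Suc j * n" unfolding j_def using n by (metis dividend_less_div_times of_nat_0_less_iff mult_Suc)
      ultimately have jn: "real j * real n \<le> real k * real K" "real k * real K < real (Suc j) * real n"
        unfolding of_nat_mult[symmetric] by (simp_all only: of_nat_le_iff of_nat_less_iff)
      have j: "j < K"
      proof (rule ccontr)
        assume "\<not> j < K"
        then have "real K * real n \<le> real j * real n" by (intro mult_right_mono) auto
        also have "\<dots> \<le> real k * real K" by (rule jn)
        also have "\<dots> < real n * real K" using kn False K by (intro mult_strict_right_mono) auto
        finally show False by (simp add: mult.commute)
      qed
      have jk: "idx n (real j / real K) \<le> k"
      proof -
        have "real n * (real j / real K) \<le> real k" using jn(1) K by (simp add: field_simps)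
        then have "real (idx n (real j / real K)) \<le> real k" using lo(1)[of j] by linarith
        then show ?thesis by simp
      qed
      have kj: "k \<le> idx n (real (Suc j) / real K)"
      proof -
        have "real k < real n * (real (Suc j) / real K)" using jn(2) K by (simp add: field_simps)
        then have "real k < real (idx n (real (Suc j) / real K)) + 1" using lo(2)[of "Suc j"] by linarith
        then show ?thesis by simp
      qed
      have "(\<Sum>i\<in>{0..<idx n (real j / real K)}. X i \<omega>) + (\<Sum>i\<in>{idx n (real j / real K)..<k}. X i \<omega>) = (\<Sum>i\<in>{0..<k}. X i \<omega>)"
        using jk by (intro sum.atLeastLessThan_concat) auto
      then have "f k - grid_path K (Wgrid K n \<omega>) j
        = (\<Sum>i\<in>{idx n (real j / real K)..<k}. X i \<omega>) / sqrt (real n) - (real k / real n - real j / real K) * w"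
        by (simp add: f g atLeast0LessThan diff_divide_distrib[symmetric] left_diff_distrib algebra_simps
              add_divide_distrib[symmetric])
      moreover have "\<bar>(\<Sum>i\<in>{idx n (real j / real K)..<k}. X i \<omega>) / sqrt (real n)\<bar> \<le> E"
      proof -
        have "\<bar>\<Sum>i\<in>{idx n (real j / real K)..<k}. X i \<omega>\<bar> \<le> block_max (idx n (real j / real K)) (grid_block K n j) \<omega>"
          using jk kj by (intro block_sum_le_block_max) (auto simp: grid_block_def)
        then have "\<bar>(\<Sum>i\<in>{idx n (real j / real K)..<k}. X i \<omega>) / sqrt (real n)\<bar>
            \<le> block_max (idx n (real j / real K)) (grid_block K n j) \<omega> / sqrt (real n)"
          by (simp add: divide_right_mono)
        also have "\<dots> \<le> E" by (rule block[OF j])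
        finally show ?thesis .
      qed
      moreover have "\<bar>real k / real n - real j / real K\<bar> \<le> 1 / real K"
      proof -
        have "real j / real K \<le> real k / real n" using jn(1) n K by (simp add: field_simps)
        moreover have "real k / real n \<le> real (Suc j) / real K" using jn(2) n K by (simp add: field_simps)
        ultimately show ?thesis by (simp add: add_divide_distrib)
      qed
      then have "\<bar>(real k / real n - real j / real K) * w\<bar> \<le> 2 / real K * \<bar>w\<bar>"
        unfolding abs_mult using nK by (intro mult_right_mono) auto
      ultimately have "\<bar>f k - grid_path K (Wgrid K n \<omega>) j\<bar> \<le> E + 2 / real K * \<bar>w\<bar>" by linarith
      then show ?thesis using j by (intro bexI[of _ j]) auto
    qed
  next
    fix j assume j: "j \<in> {..K}"
    define k where "k = idx n (real j / real K)"
    have "real j / real K \<le> 1" using j K by simp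
    then have kn: "k \<le> n" unfolding k_def using idx_mono[of "real j / real K" 1 n] by simp
    have "f k - grid_path K (Wgrid K n \<omega>) j = - ((real k / real n - real j / real K) * w)"
      by (simp add: f g k_def left_diff_distrib)
    moreover have "\<bar>real k / real n - real j / real K\<bar> \<le> 1 / real n"
    proof -
      have "real k / real n \<le> real j / real K" "real j / real K \<le> (real k + 1) / real n"
        using lo[of j] n by (simp_all add: k_def field_simps)
      then show ?thesis by (simp add: add_divide_distrib)
    qed
    then have "\<bar>(real k / real n - real j / real K) * w\<bar> \<le> 2 / real K * \<bar>w\<bar>"
      unfolding abs_mult using nK by (intro mult_right_mono) auto
    ultimately have "\<bar>f k - grid_path K (Wgrid K n \<omega>) j\<bar> \<le> E + 2 / real K * \<bar>w\<bar>" using E0 by linarith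
    then show "\<exists>r\<in>{..n}. \<bar>f r - grid_path K (Wgrid K n \<omega>) j\<bar> \<le> E + 2 / real K * \<bar>w\<bar>"
      using kn by (intro bexI[of _ k]) auto
  qed auto
  then show ?thesis unfolding range_stat_def E_def w_def f_def[abs_def] .
qed

lemma measurable_Wgrid [measurable]: "(\<lambda>\<omega>. Wgrid K n \<omega> i) \<in> borel_measurable M"
  unfolding Wgrid_def by simp

lemma measurable_osc_Wgrid [measurable]: "(\<lambda>\<omega>. osc (grid_path K (Wgrid K n \<omega>)) {..K}) \<in> borel_measurable M"
  unfolding grid_path_def by (rule measurable_osc_finite) auto

text \<open>The squared excess of a block has mean at most \<delta>^2 times its length, and lengths
  are at most 2n / K. With the factor 2 / (\<delta> n) the K blocks contribute at most 4 \<delta> in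
  total, whatever K is. The estimate is thus uniform over n >= K, which is the form of tightness
  that the double limit needs.\<close>

lemma range_stat_grid_L1:
  assumes \<epsilon>: "\<epsilon> > 0"
  shows "\<exists>K0>0. \<forall>K\<ge>K0. \<forall>n\<ge>K.
    integrable M (\<lambda>\<omega>. \<bar>range_stat n \<omega> - osc (grid_path K (Wgrid K n \<omega>)) {..K}\<bar>) \<and>
    expectation (\<lambda>\<omega>. \<bar>range_stat n \<omega> - osc (grid_path K (Wgrid K n \<omega>)) {..K}\<bar>) \<le> \<epsilon>"
proof -
  \<comment> \<open>2 (\<delta> + 4 \<delta>) = 10 \<delta> is half of \<epsilon>; the drift term
    gets the other half.\<close>
  define \<delta> where "\<delta> = \<epsilon> / 20"
  have \<delta>: "\<delta> > 0" using \<epsilon> by (simp add: \<delta>_def)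
  obtain A where A: "A > 0"
    and A1: "\<And>s n. integrable M (\<lambda>\<omega>. (max 0 (block_max s n \<omega> - A * sqrt (real n)))\<^sup>2)"
    and A2: "\<And>s n. expectation (\<lambda>\<omega>. (max 0 (block_max s n \<omega> - A * sqrt (real n)))\<^sup>2) \<le> \<delta>\<^sup>2 * real n"
    using block_max_uniform_excess[of "\<delta>\<^sup>2"] \<delta> by auto
  obtain L where L: "L > 0" and L1: "\<And>s n. integrable M (\<lambda>\<omega>. (block_max s n \<omega>)\<^sup>2)"
    and L2: "\<And>s n. expectation (\<lambda>\<omega>. (block_max s n \<omega>)\<^sup>2) \<le> L * real n"
    using block_max_square by blast
  have W1: "expectation (\<lambda>\<omega>. \<bar>W n 0 1 \<omega>\<bar>) \<le> sqrt L" if n: "n > 0" for n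
  proof -
    have "expectation (\<lambda>\<omega>. (W n 0 1 \<omega>)\<^sup>2) \<le> expectation (\<lambda>\<omega>. (block_max 0 n \<omega>)\<^sup>2 / real n)"
    proof (rule integral_mono)
      show "integrable M (\<lambda>\<omega>. (W n 0 1 \<omega>)\<^sup>2)" by (rule W_sq_integrable) simp
      show "integrable M (\<lambda>\<omega>. (block_max 0 n \<omega>)\<^sup>2 / real n)" using L1 by simp
      fix \<omega>
      have "\<bar>W n 0 1 \<omega>\<bar> \<le> block_max 0 n \<omega> / sqrt (real n)"
        using W_le_block_max[of 0 1 n \<omega>] by simp
      then have "\<bar>W n 0 1 \<omega>\<bar>\<^sup>2 \<le> (block_max 0 n \<omega> / sqrt (real n))\<^sup>2" by (intro power_mono) auto
      then show "(W n 0 1 \<omega>)\<^sup>2 \<le> (block_max 0 n \<omega>)\<^sup>2 / real n" by (simp add: power_divide)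
    qed
    also have "\<dots> \<le> L" using L2[of 0 n] n by (simp add: field_simps)
    finally show ?thesis
      by (intro order_trans[OF expectation_abs_le_sqrt(2)[OF W_meas W_sq_integrable]]) auto
  qed
  \<comment> \<open>Beyond K0 the condition 8 A^2 <= \<delta>^2 K of
    \<open>range_stat_grid_le\<close> holds, and the drift contribution 4 sqrt L / K is below
    \<epsilon> / 2.\<close>
  obtain K0 :: nat where K0: "max (8 * A\<^sup>2 / \<delta>\<^sup>2) (4 * sqrt L / (\<epsilon> / 2)) < real K0"
    using reals_Archimedean2 by blast
  have K0': "8 * A\<^sup>2 / \<delta>\<^sup>2 < real K0" "4 * sqrt L / (\<epsilon> / 2) < real K0" using K0 by auto
  have K0_pos: "K0 > 0"
  proof -
    have "0 \<le> 8 * A\<^sup>2 / \<delta>\<^sup>2" by simp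
    then have "0 < real K0" using K0'(1) by linarith
    then show ?thesis by simp
  qed
  show ?thesis
  proof (intro exI[of _ K0] conjI K0_pos allI impI)
    fix K n assume K: "K0 \<le> K" and n: "K \<le> n"
    have Kpos: "0 < K" "0 < n" using K K0_pos n by auto
    have "real K0 \<le> real K" using K by simp
    then have K1: "8 * A\<^sup>2 / \<delta>\<^sup>2 < real K" "4 * sqrt L / (\<epsilon> / 2) < real K" using K0' by linarith+
    have K2: "8 * A\<^sup>2 \<le> \<delta>\<^sup>2 * real K" using K1(1) \<delta> by (simp add: field_simps)
    define h where "h \<omega> = 2 * (\<delta> + (\<Sum>i<K. 2 / \<delta> * (excess A K n \<omega> i / real n)) + 2 / real K * \<bar>W n 0 1 \<omega>\<bar>)" for \<omega>
    have le: "\<bar>range_stat n \<omega> - osc (grid_path K (Wgrid K n \<omega>)) {..K}\<bar> \<le> h \<omega>" for \<omega>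
      unfolding h_def by (rule range_stat_grid_le[OF Kpos(1) n \<delta> A K2])
    have ie: "integrable M (\<lambda>\<omega>. 2 / \<delta> * (excess A K n \<omega> i / real n))" for i
      unfolding excess_def using A1 by simp
    have iS: "integrable M (\<lambda>\<omega>. \<Sum>i<K. 2 / \<delta> * (excess A K n \<omega> i / real n))"
      using ie by (rule Bochner_Integration.integrable_sum)
    have iW: "integrable M (\<lambda>\<omega>. 2 / real K * \<bar>W n 0 1 \<omega>\<bar>)" using W_integrable[of 0 1 n] by simp
    have ih: "integrable M h" unfolding h_def
      by (intro integrable_mult_right Bochner_Integration.integrable_add iS iW integrable_const)
    show int: "integrable M (\<lambda>\<omega>. \<bar>range_stat n \<omega> - osc (grid_path K (Wgrid K n \<omega>)) {..K}\<bar>)"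
      by (rule Bochner_Integration.integrable_bound[OF ih])
         (use le in \<open>auto intro!: AE_I2 order_trans[OF _ abs_ge_self]\<close>)
    have Ee: "expectation (\<lambda>\<omega>. 2 / \<delta> * (excess A K n \<omega> i / real n)) \<le> 4 * \<delta> / real K" for i
    proof -
      have "expectation (\<lambda>\<omega>. 2 / \<delta> * (excess A K n \<omega> i / real n))
          = 2 / \<delta> * (expectation (\<lambda>\<omega>. excess A K n \<omega> i) / real n)"
        by (simp only: integral_mult_right_zero integral_divide_zero)
      also have "\<dots> \<le> 2 / \<delta> * (\<delta>\<^sup>2 * real (grid_block K n i) / real n)"
        using A2[of "idx n (real i / real K)" "grid_block K n i"] \<delta>
        by (intro mult_left_mono divide_right_mono) (auto simp: excess_def)
      also have "\<dots> = 2 * \<delta> * (real (grid_block K n i) / real n)"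
        using \<delta> by (simp add: power2_eq_square)
      also have "\<dots> \<le> 2 * \<delta> * (2 / real K)"
        using grid_block_le[OF Kpos(1) n, of i] \<delta> by (intro mult_left_mono) auto
      finally show ?thesis by simp
    qed
    have "expectation (\<lambda>\<omega>. \<bar>range_stat n \<omega> - osc (grid_path K (Wgrid K n \<omega>)) {..K}\<bar>) \<le> expectation h"
      by (rule integral_mono[OF int ih le])
    also have "\<dots> = 2 * (\<delta> + (\<Sum>i<K. expectation (\<lambda>\<omega>. 2 / \<delta> * (excess A K n \<omega> i / real n)))
        + 2 / real K * expectation (\<lambda>\<omega>. \<bar>W n 0 1 \<omega>\<bar>))"
    proof -
      have "expectation h = 2 * expectation (\<lambda>\<omega>. \<delta> + (\<Sum>i<K. 2 / \<delta> * (excess A K n \<omega> i / real n)) + 2 / real K * \<bar>W n 0 1 \<omega>\<bar>)"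
        unfolding h_def by (rule integral_mult_right_zero)
      also have "expectation (\<lambda>\<omega>. \<delta> + (\<Sum>i<K. 2 / \<delta> * (excess A K n \<omega> i / real n)) + 2 / real K * \<bar>W n 0 1 \<omega>\<bar>)
        = \<delta> + expectation (\<lambda>\<omega>. \<Sum>i<K. 2 / \<delta> * (excess A K n \<omega> i / real n)) + expectation (\<lambda>\<omega>. 2 / real K * \<bar>W n 0 1 \<omega>\<bar>)"
        using iS iW by (subst Bochner_Integration.integral_add; (subst Bochner_Integration.integral_add)?) (simp_all add: prob_space)
      also have "expectation (\<lambda>\<omega>. \<Sum>i<K. 2 / \<delta> * (excess A K n \<omega> i / real n))
        = (\<Sum>i<K. expectation (\<lambda>\<omega>. 2 / \<delta> * (excess A K n \<omega> i / real n)))"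
        using ie by (rule Bochner_Integration.integral_sum)
      also have "expectation (\<lambda>\<omega>. 2 / real K * \<bar>W n 0 1 \<omega>\<bar>) = 2 / real K * expectation (\<lambda>\<omega>. \<bar>W n 0 1 \<omega>\<bar>)"
        by (rule integral_mult_right_zero)
      finally show ?thesis .
    qed
    also have "\<dots> \<le> 2 * (\<delta> + (\<Sum>i<K. 4 * \<delta> / real K) + 2 / real K * sqrt L)"
      using Ee W1[OF Kpos(2)] by (intro mult_left_mono add_mono sum_mono) auto
    also have "\<dots> = 10 * \<delta> + 4 * sqrt L / real K" using Kpos by simp
    also have "\<dots> \<le> \<epsilon>" using K1(2) Kpos \<epsilon> by (simp add: \<delta>_def field_simps)
    finally show "expectation (\<lambda>\<omega>. \<bar>range_stat n \<omega> - osc (grid_path K (Wgrid K n \<omega>)) {..K}\<bar>) \<le> \<epsilon>" .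
  qed
qed

end

section \<open>The Brownian limit\<close>

context prob_space
begin

lemma char_scaled_normal:
  assumes X: "distributed M lborel X (normal_density 0 s)" and s: "s > 0"
  shows "char (distr M borel (\<lambda>\<omega>. c * X \<omega>)) l = of_real (exp (- ((l * c * s)\<^sup>2 / 2)))"
proof -
  have [measurable]: "X \<in> borel_measurable M" using distributed_measurable[OF X] by simp
  have D: "distributed M lborel (\<lambda>x. X x / s) std_normal_density"
    using X normal_standard_normal_convert[OF s, of X 0] by simp
  have 1: "char (distr M borel (\<lambda>\<omega>. c * X \<omega>)) l = expectation (\<lambda>x. iexp (l * (c * X x)))"
    by (simp add: char_def integral_distr)
  have "(\<lambda>x. l * (c * X x)) = (\<lambda>x. (l * c * s) * (X x / s))" using s by auto
  then have "expectation (\<lambda>x. iexp (l * (c * X x))) = expectation (\<lambda>x. iexp ((l * c * s) * (X x / s)))"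
    by (simp only: fun_eq_iff)
  also have "\<dots> = char (distr M lborel (\<lambda>x. X x / s)) (l * c * s)"
    unfolding char_def by (rule integral_distr[symmetric]) auto
  also have "distr M lborel (\<lambda>x. X x / s) = std_normal_distribution"
    using distributed_distr_eq_density[OF D] by simp
  finally show ?thesis unfolding 1 by (simp add: char_std_normal_distribution)
qed

lemma scaled_normal_no_atom:
  assumes X: "distributed M lborel X (normal_density 0 s)" and c: "c \<noteq> 0"
  shows "measure (distr M borel (\<lambda>\<omega>. c * X \<omega>)) {x} = 0"
proof -
  have [measurable]: "X \<in> borel_measurable M" using distributed_measurable[OF X] by simp
  have "emeasure M (X -` {x / c} \<inter> space M) = (\<integral>\<^sup>+y. ennreal (normal_density 0 s y) * indicator {x / c} y \<partial>lborel)"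
    by (rule distributed_emeasure[OF X]) simp
  also have "\<dots> = (\<integral>\<^sup>+(y::real). 0 \<partial>lborel)"
  proof (rule nn_integral_cong_AE)
    show "AE y in lborel. ennreal (normal_density 0 s y) * indicator {x / c} y = 0"
      using AE_lborel_singleton[of "x / c"] by eventually_elim (auto simp: indicator_def)
  qed
  finally have "prob (X -` {x / c} \<inter> space M) = 0" by (simp add: measure_def)
  moreover have "X -` {x / c} = (\<lambda>\<omega>. c * X \<omega>) -` {x}" using c by (auto simp: field_simps)
  ultimately show ?thesis by (simp add: measure_distr)
qed

end

lemma abs_diff_le_osc:
  assumes "r \<in> A" "s \<in> A" "bdd_above (f ` A)" "bdd_below (f ` A)"
  shows "\<bar>f r - f s\<bar> \<le> osc f A"
  using cSUP_upper[OF assms(1,3)] cSUP_upper[OF assms(2,3)] cINF_lower[OF assms(4,1)] cINF_lower[OF assms(4,2)]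
  unfolding osc_def by linarith

locale brownian =
  fixes N :: "'b measure" and B :: "real \<Rightarrow> 'b \<Rightarrow> real"
  assumes bm: "brownian_motion N B"
begin

sublocale N: prob_space N
  using bm by (simp add: brownian_motion_def)

lemma B_meas: "t \<ge> 0 \<Longrightarrow> B t \<in> borel_measurable N"
  using bm by (simp add: brownian_motion_def)

lemma B_0: "\<omega> \<in> space N \<Longrightarrow> B 0 \<omega> = 0"
  using bm by (simp add: brownian_motion_def)

lemma B_cont: "\<omega> \<in> space N \<Longrightarrow> continuous_on {0..} (\<lambda>t. B t \<omega>)"
  using bm by (simp add: brownian_motion_def)

lemma B_normal: "0 \<le> s \<Longrightarrow> s < t \<Longrightarrow> distributed N lborel (\<lambda>\<omega>. B t \<omega> - B s \<omega>) (normal_density 0 (sqrt (t - s)))"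
  using bm by (simp add: brownian_motion_def)

lemma B_indep: "0 \<le> u 0 \<Longrightarrow> (\<And>i. i < k \<Longrightarrow> u i \<le> u (Suc i)) \<Longrightarrow>
    N.indep_vars (\<lambda>_. borel) (\<lambda>i \<omega>. B (u (Suc i)) \<omega> - B (u i) \<omega>) {..<k}"
  using bm by (simp add: brownian_motion_def)

lemma bridge_cont: "\<omega> \<in> space N \<Longrightarrow> continuous_on {0..1} (\<lambda>r. bridge B r \<omega>)"
  unfolding bridge_def using B_cont[of \<omega>]
  by (intro continuous_intros) (auto elim: continuous_on_subset)

lemma bridge_bdd:
  assumes "\<omega> \<in> space N"
  shows "bdd_above ((\<lambda>r. bridge B r \<omega>) ` {0..1})" "bdd_below ((\<lambda>r. bridge B r \<omega>) ` {0..1})"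
proof -
  have "compact ((\<lambda>r. bridge B r \<omega>) ` {0..1})"
    using bridge_cont[OF assms] by (rule compact_continuous_image) simp
  then have "bounded ((\<lambda>r. bridge B r \<omega>) ` {0..1})" by (rule compact_imp_bounded)
  then show "bdd_above ((\<lambda>r. bridge B r \<omega>) ` {0..1})" "bdd_below ((\<lambda>r. bridge B r \<omega>) ` {0..1})"
    by (rule bounded_imp_bdd_above, rule bounded_imp_bdd_below)
qed

definition bridge_range :: "'b \<Rightarrow> real" where
  "bridge_range \<omega> = osc (\<lambda>r. bridge B r \<omega>) {0..1}"

lemma bridge_grid_lim:
  assumes \<omega>: "\<omega> \<in> space N"
  shows "(\<lambda>K. osc (\<lambda>j. bridge B (real j / real K) \<omega>) {..K}) \<longlonglongrightarrow> bridge_range \<omega>"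
proof (rule tendstoI)
  fix e :: real assume e: "e > 0"
  have uc: "uniformly_continuous_on {0..1} (\<lambda>r. bridge B r \<omega>)"
    using bridge_cont[OF \<omega>] by (rule compact_uniformly_continuous) simp
  have "e / 3 > 0" using e by simp
  from uniformly_continuous_onE[OF uc this] obtain d where d: "d > 0"
    and uc: "\<And>r s. r \<in> {0..1} \<Longrightarrow> s \<in> {0..1} \<Longrightarrow> dist s r < d \<Longrightarrow> dist (bridge B s \<omega>) (bridge B r \<omega>) < e / 3"
    by metis
  have "\<forall>\<^sub>F K in sequentially. 1 / d < real K"
    using filterlim_real_sequentially by (simp only: filterlim_at_top_dense)
  then show "\<forall>\<^sub>F K in sequentially. dist (osc (\<lambda>j. bridge B (real j / real K) \<omega>) {..K}) (bridge_range \<omega>) < e"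
  proof eventually_elim
    case (elim K)
    have K: "0 < real K" using elim d by (meson divide_pos_pos less_trans zero_less_one)
    have Kd: "1 / real K < d" using elim d K by (simp add: field_simps)
    have "\<bar>osc (\<lambda>j. bridge B (real j / real K) \<omega>) {..K} - osc (\<lambda>r. bridge B r \<omega>) {0..1}\<bar> \<le> 2 * (e / 3)"
    proof (rule osc_approx)
      fix j assume "j \<in> {..K}"
      then have "real j / real K \<in> {0..1}" using K by auto
      then show "\<exists>r\<in>{0..1}. \<bar>bridge B (real j / real K) \<omega> - bridge B r \<omega>\<bar> \<le> e / 3"
        using e by (intro bexI[of _ "real j / real K"]) auto
    next
      fix r :: real assume r: "r \<in> {0..1}"
      define j where "j = nat \<lfloor>real K * r\<rfloor>"
      have 0: "0 \<le> real K * r" using r by simp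
      have j: "real j \<le> real K * r" "real K * r < real j + 1"
        using 0 by (simp_all add: j_def of_nat_nat floor_correct)
      have "real K * r \<le> real K" using r K by (simp add: mult_left_le)
      then have "real j \<le> real K" using j by linarith
      then have jK: "j \<le> K" by simp
      have "real j / real K \<le> r" "r < (real j + 1) / real K" using j K by (simp_all add: field_simps)
      then have "dist (real j / real K) r < d" using Kd by (simp add: dist_real_def add_divide_distrib)
      then have "\<bar>bridge B (real j / real K) \<omega> - bridge B r \<omega>\<bar> \<le> e / 3"
        using uc[of r "real j / real K"] r jK K by (simp add: dist_real_def less_imp_le)
      then show "\<exists>j\<in>{..K}. \<bar>bridge B (real j / real K) \<omega> - bridge B r \<omega>\<bar> \<le> e / 3"
        using jK by blast
    qed (use bridge_bdd[OF \<omega>] in auto)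
    then show ?case using e by (simp add: dist_real_def bridge_range_def)
  qed
qed

lemma bridge_meas: "r \<ge> 0 \<Longrightarrow> bridge B r \<in> borel_measurable N"
  unfolding bridge_def using B_meas[of r] B_meas[of 1] by (auto simp: bridge_def[abs_def])

text \<open>The supremum and infimum run over an uncountable set; continuity of the paths makes the
  range a pointwise limit of ranges over finite grids.\<close>

lemma bridge_range_meas [measurable]: "bridge_range \<in> borel_measurable N"
proof (rule borel_measurable_LIMSEQ_real)
  show "(\<lambda>K. osc (\<lambda>j. bridge B (real j / real K) \<omega>) {..K}) \<longlonglongrightarrow> bridge_range \<omega>" if "\<omega> \<in> space N" for \<omega>
    by (rule bridge_grid_lim[OF that])
  show "(\<lambda>\<omega>. osc (\<lambda>j. bridge B (real j / real K) \<omega>) {..K}) \<in> borel_measurable N" for K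
    by (rule measurable_osc_finite) (auto intro: bridge_meas)
qed

text \<open>
  A bridge of range 0 vanishes at 1/2, so that the increments over the two halves of the unit interval
  agree; their difference is a nondegenerate Gaussian variable.
\<close>

lemma bridge_range_pos: "AE \<omega> in N. bridge_range \<omega> > 0"
proof -
  define u :: "nat \<Rightarrow> real" where "u i = real i / 2" for i
  have ind: "N.indep_vars (\<lambda>_. borel) (\<lambda>i \<omega>. B (u (Suc i)) \<omega> - B (u i) \<omega>) {..<2}"
    by (rule B_indep) (auto simp: u_def)
  define D0 where "D0 \<omega> = B (1 / 2) \<omega> - B 0 \<omega>" for \<omega>
  define D1 where "D1 \<omega> = B 1 \<omega> - B (1 / 2) \<omega>" for \<omega>
  have "N.indep_var (PiM {0} (\<lambda>_. borel)) (\<lambda>\<omega>. restrict (\<lambda>i. B (u (Suc i)) \<omega> - B (u i) \<omega>) {0})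
      (PiM {1} (\<lambda>_. borel)) (\<lambda>\<omega>. restrict (\<lambda>i. B (u (Suc i)) \<omega> - B (u i) \<omega>) {1})"
    by (rule N.indep_var_restrict[OF ind]) auto
  then have "N.indep_var borel ((\<lambda>f. f 0) \<circ> (\<lambda>\<omega>. restrict (\<lambda>i. B (u (Suc i)) \<omega> - B (u i) \<omega>) {0}))
      borel ((\<lambda>f. f 1) \<circ> (\<lambda>\<omega>. restrict (\<lambda>i. B (u (Suc i)) \<omega> - B (u i) \<omega>) {1}))"
    by (rule N.indep_var_compose) (auto intro!: measurable_component_singleton)
  then have "N.indep_var borel D0 borel D1"
    by (simp add: comp_def u_def D0_def[abs_def] D1_def[abs_def])
  moreover have "distributed N lborel D0 (normal_density 0 (sqrt (1 / 2)))"
    "distributed N lborel D1 (normal_density 0 (sqrt (1 / 2)))"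
    using B_normal[of 0 "1 / 2"] B_normal[of "1 / 2" 1] by (simp_all add: D0_def[abs_def] D1_def[abs_def])
  ultimately have "distributed N lborel (\<lambda>\<omega>. D0 \<omega> - D1 \<omega>) (normal_density (0 - 0) (sqrt ((sqrt (1 / 2))\<^sup>2 + (sqrt (1 / 2))\<^sup>2)))"
    by (intro N.diff_indep_normal) auto
  then have D: "distributed N lborel (\<lambda>\<omega>. D0 \<omega> - D1 \<omega>) (normal_density 0 1)" by simp
  have [measurable]: "(\<lambda>\<omega>. D0 \<omega> - D1 \<omega>) \<in> borel_measurable N" using distributed_measurable[OF D] by simp
  have ev: "{\<omega> \<in> space N. D0 \<omega> - D1 \<omega> = 0} \<in> N.events" by measurable
  have "measure (distr N borel (\<lambda>\<omega>. 1 * (D0 \<omega> - D1 \<omega>))) {0} = 0"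
    by (rule N.scaled_normal_no_atom[OF D]) simp
  then have "N.prob {\<omega> \<in> space N. D0 \<omega> - D1 \<omega> = 0} = 0"
    by (simp add: measure_distr vimage_def Int_def conj_commute)
  then have "AE \<omega> in N. \<not> (D0 \<omega> - D1 \<omega> = 0)"
    using N.prob_eq_0[of "{\<omega> \<in> space N. D0 \<omega> - D1 \<omega> = 0}"] ev by (auto elim: eventually_mono)
  then show ?thesis using AE_space
  proof eventually_elim
    case (elim \<omega>)
    have "\<bar>bridge B (1 / 2) \<omega> - bridge B 0 \<omega>\<bar> \<le> bridge_range \<omega>"
      unfolding bridge_range_def using bridge_bdd[OF elim(2)] by (intro abs_diff_le_osc) auto
    moreover have "bridge B (1 / 2) \<omega> - bridge B 0 \<omega> = (D0 \<omega> - D1 \<omega>) / 2"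
      using B_0[OF elim(2)] by (simp add: bridge_def D0_def D1_def)
    ultimately show ?case using elim(1) by simp
  qed
qed

end

section \<open>Passage from the grid to the Brownian functionals\<close>

locale fclt_brownian = fclt_seq M X p C \<beta> \<sigma>2 + brownian N B
  for M :: "'a measure" and X p C \<beta> \<sigma>2 and N :: "'b measure" and B
begin

definition Bgrid :: "nat \<Rightarrow> 'b \<Rightarrow> nat \<Rightarrow> real" where
  "Bgrid K \<omega> i = sqrt \<sigma>2 * (B (real (Suc i) / real K) \<omega> - B (real i / real K) \<omega>)"

lemma Bgrid_meas [measurable]: "(\<lambda>\<omega>. Bgrid K \<omega> i) \<in> borel_measurable N"
  unfolding Bgrid_def using B_meas[of "real (Suc i) / real K"] B_meas[of "real i / real K"] by simp

text \<open>\<open>joint_convergence\<close> is applied to the increments V with gaps. The full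
  increments W have the same limit, since a Lipschitz functional moves by at most c times the sum of
  the mean distances of W from V, and these vanish.\<close>

lemma grid_joint_conv:
  assumes K: "K > 0" and lip: "lip_coords K c \<Phi>" and b: "\<And>x. \<bar>\<Phi> x\<bar> \<le> b" and c: "c \<ge> 0"
  shows "(\<lambda>n. integral\<^sup>L M (\<lambda>\<omega>. \<Phi> (Wgrid K n \<omega>))) \<longlonglongrightarrow> integral\<^sup>L N (\<lambda>\<omega>. \<Phi> (Bgrid K \<omega>))"
proof -
  define u where "u i = real i / real K" for i
  have u: "0 \<le> u i" "u i < u (Suc i)" for i using K by (auto simp: u_def divide_strict_right_mono)
  have u1: "u (Suc i) \<le> 1" if "i < K" for i using that K by (simp add: u_def)
  have umono: "u i \<le> u j" if "i \<le> j" for i j using that by (simp add: u_def divide_right_mono)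
  define D where "D n i = V n (u i) (u (Suc i))" for n i
  define G where "G i \<omega> = sqrt \<sigma>2 * (B (u (Suc i)) \<omega> - B (u i) \<omega>)" for i \<omega>
  have G_meas [measurable]: "G i \<in> borel_measurable N" for i
    unfolding G_def using B_meas[OF u(1)[of i]] B_meas[OF u(1)[of "Suc i"]] by simp
  have normal: "distributed N lborel (\<lambda>\<omega>. B (u (Suc i)) \<omega> - B (u i) \<omega>) (normal_density 0 (sqrt (u (Suc i) - u i)))" for i
    using u by (intro B_normal)
  have "(\<lambda>n. expectation (\<lambda>\<omega>. \<Phi> (\<lambda>i. D n i \<omega>))) \<longlonglongrightarrow> integral\<^sup>L N (\<lambda>\<omega>. \<Phi> (\<lambda>i. G i \<omega>))"
  proof (rule joint_convergence[OF N.prob_space_axioms, where D = D and G = G and \<Phi> = \<Phi> and k = K and c = c and b = b and \<alpha> = "\<lambda>n. \<beta> (gap n)"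
        and F = "\<lambda>n i. gen_sigma M {..<idx n (u i)} X" and H = "\<lambda>n i. gen_sigma M {idx n (u i) + gap n..} X"])
    fix i assume i: "i < K"
    show "weak_conv_m (\<lambda>n. distr M borel (D n i)) (distr N borel (G i))"
      unfolding D_def
    proof (rule V_weak_conv)
      show "real_distribution (distr N borel (G i))" by simp
      fix l
      have "char (distr N borel (G i)) l = of_real (exp (- ((l * sqrt \<sigma>2 * sqrt (u (Suc i) - u i))\<^sup>2 / 2)))"
        unfolding G_def[abs_def] using u[of i] by (intro N.char_scaled_normal normal) auto
      then show "char (distr N borel (G i)) l = complex_of_real (exp (- (l\<^sup>2 * ((u (Suc i) - u i) * \<sigma>2) / 2)))"
        using \<sigma>2 u(2)[of i] by (simp add: power_mult_distrib mult.assoc mult.commute[of \<sigma>2])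
    qed (use u u1[OF i] in auto)
    show "measure (distr N borel (G i)) {x} = 0" for x
      unfolding G_def[abs_def] using \<sigma>2 by (intro N.scaled_normal_no_atom[OF normal]) auto
  next
    have "N.indep_vars (\<lambda>_. borel) (\<lambda>i \<omega>. B (u (Suc i)) \<omega> - B (u i) \<omega>) {..<K}"
      using u by (intro B_indep) (auto intro: less_imp_le)
    then have "N.indep_vars (\<lambda>_. borel) (\<lambda>i. (\<lambda>x. sqrt \<sigma>2 * x) \<circ> (\<lambda>\<omega>. B (u (Suc i)) \<omega> - B (u i) \<omega>)) {..<K}"
      by (rule N.indep_vars_compose) simp
    then show "N.indep_vars (\<lambda>_. borel) G {..<K}" by (simp add: comp_def G_def[abs_def])
  next
    fix n i j :: nat assume "j < i"
    then have "u (Suc j) \<le> u i" by (intro umono) simp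
    then show "D n j \<in> borel_measurable (gen_sigma M {..<idx n (u i)} X)" unfolding D_def by (rule V_past)
  next
    fix n i :: nat
    show "D n i \<in> borel_measurable (gen_sigma M {idx n (u i) + gap n..} X)" unfolding D_def by (rule V_future)
  qed (use mix \<beta>_gap lip b c in auto)
  moreover have "(\<lambda>n. expectation (\<lambda>\<omega>. \<Phi> (Wgrid K n \<omega>)) - expectation (\<lambda>\<omega>. \<Phi> (\<lambda>i. D n i \<omega>))) \<longlonglongrightarrow> 0"
  proof (rule Lim_null_comparison)
    have uu: "u i \<le> u (Suc i)" for i using u(2)[of i] by simp
    have "(\<lambda>n. c * (\<Sum>i<K. expectation (\<lambda>\<omega>. \<bar>W n (u i) (u (Suc i)) \<omega> - V n (u i) (u (Suc i)) \<omega>\<bar>))) \<longlonglongrightarrow> c * (\<Sum>i<K. 0)"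
      by (intro tendsto_mult tendsto_const tendsto_sum W_V_lim uu)
    then show "(\<lambda>n. c * (\<Sum>i<K. expectation (\<lambda>\<omega>. \<bar>W n (u i) (u (Suc i)) \<omega> - V n (u i) (u (Suc i)) \<omega>\<bar>))) \<longlonglongrightarrow> 0"
      by simp
    show "\<forall>\<^sub>F n in sequentially. norm (expectation (\<lambda>\<omega>. \<Phi> (Wgrid K n \<omega>)) - expectation (\<lambda>\<omega>. \<Phi> (\<lambda>i. D n i \<omega>)))
      \<le> c * (\<Sum>i<K. expectation (\<lambda>\<omega>. \<bar>W n (u i) (u (Suc i)) \<omega> - V n (u i) (u (Suc i)) \<omega>\<bar>))"
    proof (rule always_eventually, rule allI)
      fix n
      have m1: "(\<lambda>\<omega>. \<Phi> (Wgrid K n \<omega>)) \<in> borel_measurable M"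
        using measurable_lip_coords[OF lip, of "\<lambda>i \<omega>. Wgrid K n \<omega> i" M] by simp
      have m2: "(\<lambda>\<omega>. \<Phi> (\<lambda>i. D n i \<omega>)) \<in> borel_measurable M"
        by (rule measurable_lip_coords[OF lip]) (simp add: D_def)
      have i1: "integrable M (\<lambda>\<omega>. \<Phi> (Wgrid K n \<omega>))"
        by (rule integrable_const_bound[where B = b]) (use m1 b in auto)
      have i2: "integrable M (\<lambda>\<omega>. \<Phi> (\<lambda>i. D n i \<omega>))"
        by (rule integrable_const_bound[where B = b]) (use m2 b in auto)
      have i3: "integrable M (\<lambda>\<omega>. \<bar>W n (u i) (u (Suc i)) \<omega> - V n (u i) (u (Suc i)) \<omega>\<bar>)" for i
        by (rule W_V_lim(1)[OF uu])
      have "\<bar>expectation (\<lambda>\<omega>. \<Phi> (Wgrid K n \<omega>)) - expectation (\<lambda>\<omega>. \<Phi> (\<lambda>i. D n i \<omega>))\<bar>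
        = \<bar>expectation (\<lambda>\<omega>. \<Phi> (Wgrid K n \<omega>) - \<Phi> (\<lambda>i. D n i \<omega>))\<bar>" using i1 i2 by simp
      also have "\<dots> \<le> expectation (\<lambda>\<omega>. \<bar>\<Phi> (Wgrid K n \<omega>) - \<Phi> (\<lambda>i. D n i \<omega>)\<bar>)" by (rule integral_abs_bound)
      also have "\<dots> \<le> expectation (\<lambda>\<omega>. c * (\<Sum>i<K. \<bar>W n (u i) (u (Suc i)) \<omega> - V n (u i) (u (Suc i)) \<omega>\<bar>))"
      proof (rule integral_mono)
        show "integrable M (\<lambda>\<omega>. \<bar>\<Phi> (Wgrid K n \<omega>) - \<Phi> (\<lambda>i. D n i \<omega>)\<bar>)" using i1 i2 by simp
        show "integrable M (\<lambda>\<omega>. c * (\<Sum>i<K. \<bar>W n (u i) (u (Suc i)) \<omega> - V n (u i) (u (Suc i)) \<omega>\<bar>))"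
          using i3 by simp
        show "\<bar>\<Phi> (Wgrid K n \<omega>) - \<Phi> (\<lambda>i. D n i \<omega>)\<bar> \<le> c * (\<Sum>i<K. \<bar>W n (u i) (u (Suc i)) \<omega> - V n (u i) (u (Suc i)) \<omega>\<bar>)" for \<omega>
          using lip_coordsD[OF lip, of "Wgrid K n \<omega>" "\<lambda>i. D n i \<omega>"] by (simp add: Wgrid_def D_def u_def)
      qed
      also have "\<dots> = c * (\<Sum>i<K. expectation (\<lambda>\<omega>. \<bar>W n (u i) (u (Suc i)) \<omega> - V n (u i) (u (Suc i)) \<omega>\<bar>))"
        using i3 by (simp only: integral_mult_right_zero) (subst Bochner_Integration.integral_sum; simp)
      finally show "norm (expectation (\<lambda>\<omega>. \<Phi> (Wgrid K n \<omega>)) - expectation (\<lambda>\<omega>. \<Phi> (\<lambda>i. D n i \<omega>)))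
        \<le> c * (\<Sum>i<K. expectation (\<lambda>\<omega>. \<bar>W n (u i) (u (Suc i)) \<omega> - V n (u i) (u (Suc i)) \<omega>\<bar>))" by simp
    qed
  qed
  ultimately have "(\<lambda>n. expectation (\<lambda>\<omega>. \<Phi> (\<lambda>i. D n i \<omega>))
      + (expectation (\<lambda>\<omega>. \<Phi> (Wgrid K n \<omega>)) - expectation (\<lambda>\<omega>. \<Phi> (\<lambda>i. D n i \<omega>))))
      \<longlonglongrightarrow> integral\<^sup>L N (\<lambda>\<omega>. \<Phi> (\<lambda>i. G i \<omega>)) + 0" by (rule tendsto_add)
  moreover have "(\<lambda>i. G i \<omega>) = Bgrid K \<omega>" for \<omega> by (simp add: fun_eq_iff G_def Bgrid_def u_def)
  ultimately show ?thesis by simp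
qed

lemma Bgrid_path:
  assumes K: "K > 0" and \<omega>: "\<omega> \<in> space N"
  shows "grid_path K (Bgrid K \<omega>) j = sqrt \<sigma>2 * bridge B (real j / real K) \<omega>"
    and "(\<Sum>i<K. Bgrid K \<omega> i) = sqrt \<sigma>2 * B 1 \<omega>"
proof -
  have sum: "(\<Sum>i<j. Bgrid K \<omega> i) = sqrt \<sigma>2 * B (real j / real K) \<omega>" for j
    using B_0[OF \<omega>] by (induction j) (simp_all add: Bgrid_def algebra_simps)
  then show "(\<Sum>i<K. Bgrid K \<omega> i) = sqrt \<sigma>2 * B 1 \<omega>" using K by simp
  then show "grid_path K (Bgrid K \<omega>) j = sqrt \<sigma>2 * bridge B (real j / real K) \<omega>"
    by (simp add: grid_path_def sum bridge_def algebra_simps)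
qed

lemma grid_fun_Wgrid:
  assumes "K > 0"
  shows "grid_fun K a b (Wgrid K n \<omega>) = a * \<bar>W n 0 1 \<omega>\<bar> + b * osc (grid_path K (Wgrid K n \<omega>)) {..K}"
  using assms by (simp add: grid_fun_def sum_Wgrid)

lemma grid_fun_Bgrid_lim:
  assumes \<omega>: "\<omega> \<in> space N"
  shows "(\<lambda>K. grid_fun K a b (Bgrid K \<omega>)) \<longlonglongrightarrow> sqrt \<sigma>2 * (a * \<bar>B 1 \<omega>\<bar> + b * bridge_range \<omega>)"
proof (rule Lim_transform_eventually)
  show "(\<lambda>K. sqrt \<sigma>2 * (a * \<bar>B 1 \<omega>\<bar> + b * osc (\<lambda>j. bridge B (real j / real K) \<omega>) {..K}))
      \<longlonglongrightarrow> sqrt \<sigma>2 * (a * \<bar>B 1 \<omega>\<bar> + b * bridge_range \<omega>)"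
    by (intro tendsto_intros bridge_grid_lim[OF \<omega>])
  show "\<forall>\<^sub>F K in sequentially. sqrt \<sigma>2 * (a * \<bar>B 1 \<omega>\<bar> + b * osc (\<lambda>j. bridge B (real j / real K) \<omega>) {..K})
      = grid_fun K a b (Bgrid K \<omega>)"
    using eventually_gt_at_top[of 0]
  proof eventually_elim
    case (elim K)
    have "osc (grid_path K (Bgrid K \<omega>)) {..K} = osc (\<lambda>j. sqrt \<sigma>2 * bridge B (real j / real K) \<omega>) {..K}"
      by (rule osc_cong) (rule Bgrid_path(1)[OF elim \<omega>])
    also have "\<dots> = sqrt \<sigma>2 * osc (\<lambda>j. bridge B (real j / real K) \<omega>) {..K}"
      using \<sigma>2 by (intro osc_scale) auto
    finally show ?case using \<sigma>2 by (simp add: grid_fun_def Bgrid_path[OF elim \<omega>] abs_mult algebra_simps)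
  qed
qed

text \<open>Continuous step functions suffice for weak convergence, and their expectations are
  compared through a grid. The mesh K is fixed first, fine enough both for the bound in mean, valid
  for all n >= K, and for the limit in K on the Brownian side; only then does n tend to infinity.
  Each of the three comparisons costs at most e / 3.\<close>

lemma functional_weak_conv:
  "weak_conv_m (\<lambda>n. distr M borel (\<lambda>\<omega>. a * \<bar>W n 0 1 \<omega>\<bar> + b * range_stat n \<omega>))
     (distr N borel (\<lambda>\<omega>. sqrt \<sigma>2 * (a * \<bar>B 1 \<omega>\<bar> + b * bridge_range \<omega>)))"
proof (rule integral_cts_step_conv_imp_weak_conv)
  define Ln where "Ln n \<omega> = a * \<bar>W n 0 1 \<omega>\<bar> + b * range_stat n \<omega>" for n \<omega>
  define LB where "LB \<omega> = sqrt \<sigma>2 * (a * \<bar>B 1 \<omega>\<bar> + b * bridge_range \<omega>)" for \<omega>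
  have [measurable]: "B 1 \<in> borel_measurable N" by (rule B_meas) simp
  have Ln_meas [measurable]: "Ln n \<in> borel_measurable M" for n unfolding Ln_def by measurable
  have LB_meas [measurable]: "LB \<in> borel_measurable N" unfolding LB_def by measurable
  show "real_distribution (distr M borel (\<lambda>\<omega>. a * \<bar>W n 0 1 \<omega>\<bar> + b * range_stat n \<omega>))" for n
    using real_distribution_distr[OF Ln_meas[of n]] unfolding Ln_def[abs_def] .
  show "real_distribution (distr N borel (\<lambda>\<omega>. sqrt \<sigma>2 * (a * \<bar>B 1 \<omega>\<bar> + b * bridge_range \<omega>)))"
    using N.real_distribution_distr[OF LB_meas] unfolding LB_def[abs_def] .
  fix u v :: real assume uv: "u < v"
  note [measurable] = measurable_cts_step[OF uv]
  define \<Phi> where "\<Phi> K x = cts_step u v (grid_fun K a b x)" for K x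
  define c where "c = 1 / (v - u) * (\<bar>a\<bar> + 4 * \<bar>b\<bar>)"
  have lip: "lip_coords K c (\<Phi> K)" for K
    unfolding \<Phi>_def[abs_def] c_def by (rule lip_coords_cts_step[OF uv lip_coords_grid_fun])
  have c: "c \<ge> 0" using uv by (simp add: c_def)
  have b1: "\<bar>\<Phi> K x\<bar> \<le> 1" for K x unfolding \<Phi>_def by (rule cts_step_bound[OF uv])
  have grid: "(\<lambda>n. expectation (\<lambda>\<omega>. \<Phi> K (Wgrid K n \<omega>))) \<longlonglongrightarrow> integral\<^sup>L N (\<lambda>\<omega>. \<Phi> K (Bgrid K \<omega>))" if "K > 0" for K
    by (rule grid_joint_conv[OF that lip b1 c])
  have mB: "(\<lambda>\<omega>. \<Phi> K (Bgrid K \<omega>)) \<in> borel_measurable N" for K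
    using measurable_lip_coords[OF lip, of K "\<lambda>i \<omega>. Bgrid K \<omega> i" N] by simp
  have mW: "(\<lambda>\<omega>. \<Phi> K (Wgrid K n \<omega>)) \<in> borel_measurable M" for K n
    using measurable_lip_coords[OF lip, of K "\<lambda>i \<omega>. Wgrid K n \<omega> i" M] by simp
  have limB: "(\<lambda>K. integral\<^sup>L N (\<lambda>\<omega>. \<Phi> K (Bgrid K \<omega>))) \<longlonglongrightarrow> integral\<^sup>L N (\<lambda>\<omega>. cts_step u v (LB \<omega>))"
  proof (rule integral_dominated_convergence[where w = "\<lambda>_. 1"])
    show "AE \<omega> in N. (\<lambda>K. \<Phi> K (Bgrid K \<omega>)) \<longlonglongrightarrow> cts_step u v (LB \<omega>)"
    proof (rule AE_I2)
      fix \<omega> assume \<omega>: "\<omega> \<in> space N"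
      have "isCont (cts_step u v) (LB \<omega>)"
        using uniformly_continuous_imp_continuous[OF cts_step_uniformly_continuous[OF uv]]
        by (simp add: continuous_on_eq_continuous_at)
      then show "(\<lambda>K. \<Phi> K (Bgrid K \<omega>)) \<longlonglongrightarrow> cts_step u v (LB \<omega>)"
        unfolding \<Phi>_def LB_def by (rule isCont_tendsto_compose[OF _ grid_fun_Bgrid_lim[OF \<omega>]])
    qed
  qed (use mB b1 in auto)
  have "(\<lambda>n. expectation (\<lambda>\<omega>. cts_step u v (Ln n \<omega>))) \<longlonglongrightarrow> integral\<^sup>L N (\<lambda>\<omega>. cts_step u v (LB \<omega>))"
  proof (rule tendstoI)
    fix e :: real assume e: "e > 0"
    \<comment> \<open>Makes the mean error of the range, multiplied by the Lipschitz constant 1 / (v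
      - u) and by |b|, at most e / 3; the added 1 covers b = 0.\<close>
    define e' where "e' = e * (v - u) / (3 * (\<bar>b\<bar> + 1))"
    have e': "e' > 0" using e uv by (simp add: e'_def add_nonneg_pos)
    have "1 / (v - u) * (\<bar>b\<bar> * e') = e / 3 * (\<bar>b\<bar> / (\<bar>b\<bar> + 1))"
      using uv by (simp add: e'_def)
    also have "\<dots> \<le> e / 3 * 1" using e by (intro mult_left_mono) auto
    finally have be: "1 / (v - u) * (\<bar>b\<bar> * e') \<le> e / 3" by simp
    obtain K0 where K0: "K0 > 0"
      and L1: "\<And>K n. K0 \<le> K \<Longrightarrow> K \<le> n \<Longrightarrow> integrable M (\<lambda>\<omega>. \<bar>range_stat n \<omega> - osc (grid_path K (Wgrid K n \<omega>)) {..K}\<bar>)"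
      and L2: "\<And>K n. K0 \<le> K \<Longrightarrow> K \<le> n \<Longrightarrow> expectation (\<lambda>\<omega>. \<bar>range_stat n \<omega> - osc (grid_path K (Wgrid K n \<omega>)) {..K}\<bar>) \<le> e'"
      using range_stat_grid_L1[OF e'] by blast
    have "\<forall>\<^sub>F K in sequentially. dist (integral\<^sup>L N (\<lambda>\<omega>. \<Phi> K (Bgrid K \<omega>))) (integral\<^sup>L N (\<lambda>\<omega>. cts_step u v (LB \<omega>))) < e / 3"
      using e by (intro tendstoD[OF limB]) simp
    then have "\<forall>\<^sub>F K in sequentially. dist (integral\<^sup>L N (\<lambda>\<omega>. \<Phi> K (Bgrid K \<omega>))) (integral\<^sup>L N (\<lambda>\<omega>. cts_step u v (LB \<omega>))) < e / 3 \<and> K0 \<le> K"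
      using eventually_ge_at_top[of K0] by (rule eventually_conj)
    then obtain K where K: "dist (integral\<^sup>L N (\<lambda>\<omega>. \<Phi> K (Bgrid K \<omega>))) (integral\<^sup>L N (\<lambda>\<omega>. cts_step u v (LB \<omega>))) < e / 3" "K0 \<le> K"
      by (auto simp: eventually_sequentially)
    have Kpos: "K > 0" using K K0 by simp
    have "\<forall>\<^sub>F n in sequentially. dist (expectation (\<lambda>\<omega>. \<Phi> K (Wgrid K n \<omega>))) (integral\<^sup>L N (\<lambda>\<omega>. \<Phi> K (Bgrid K \<omega>))) < e / 3"
      using e by (intro tendstoD[OF grid[OF Kpos]]) simp
    then show "\<forall>\<^sub>F n in sequentially. dist (expectation (\<lambda>\<omega>. cts_step u v (Ln n \<omega>))) (integral\<^sup>L N (\<lambda>\<omega>. cts_step u v (LB \<omega>))) < e"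
      using eventually_ge_at_top[of K]
    proof eventually_elim
      case (elim n)
      define r where "r \<omega> = \<bar>range_stat n \<omega> - osc (grid_path K (Wgrid K n \<omega>)) {..K}\<bar>" for \<omega>
      have ir: "integrable M r" and Er: "expectation r \<le> e'"
        using L1[OF K(2) elim(2)] L2[OF K(2) elim(2)] by (simp_all add: r_def[abs_def])
      have i1: "integrable M (\<lambda>\<omega>. cts_step u v (Ln n \<omega>))"
        by (rule integrable_const_bound[where B = 1]) (use cts_step_bound[OF uv] in auto)
      have i2: "integrable M (\<lambda>\<omega>. \<Phi> K (Wgrid K n \<omega>))"
        by (rule integrable_const_bound[where B = 1]) (use mW b1 in auto)
      have "\<bar>expectation (\<lambda>\<omega>. cts_step u v (Ln n \<omega>)) - expectation (\<lambda>\<omega>. \<Phi> K (Wgrid K n \<omega>))\<bar>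
        = \<bar>expectation (\<lambda>\<omega>. cts_step u v (Ln n \<omega>) - \<Phi> K (Wgrid K n \<omega>))\<bar>" using i1 i2 by simp
      also have "\<dots> \<le> expectation (\<lambda>\<omega>. \<bar>cts_step u v (Ln n \<omega>) - \<Phi> K (Wgrid K n \<omega>)\<bar>)" by (rule integral_abs_bound)
      also have "\<dots> \<le> expectation (\<lambda>\<omega>. 1 / (v - u) * (\<bar>b\<bar> * r \<omega>))"
      proof (rule integral_mono)
        show "integrable M (\<lambda>\<omega>. \<bar>cts_step u v (Ln n \<omega>) - \<Phi> K (Wgrid K n \<omega>)\<bar>)" using i1 i2 by simp
        show "integrable M (\<lambda>\<omega>. 1 / (v - u) * (\<bar>b\<bar> * r \<omega>))" using ir by (intro integrable_mult_right)
        fix \<omega>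
        have "\<bar>cts_step u v (Ln n \<omega>) - \<Phi> K (Wgrid K n \<omega>)\<bar> \<le> 1 / (v - u) * \<bar>Ln n \<omega> - grid_fun K a b (Wgrid K n \<omega>)\<bar>"
          unfolding \<Phi>_def by (rule cts_step_lipschitz[OF uv])
        also have "Ln n \<omega> - grid_fun K a b (Wgrid K n \<omega>) = b * (range_stat n \<omega> - osc (grid_path K (Wgrid K n \<omega>)) {..K})"
          by (simp add: Ln_def grid_fun_Wgrid[OF Kpos] right_diff_distrib)
        finally show "\<bar>cts_step u v (Ln n \<omega>) - \<Phi> K (Wgrid K n \<omega>)\<bar> \<le> 1 / (v - u) * (\<bar>b\<bar> * r \<omega>)"
          by (simp only: abs_mult r_def)
      qed
      also have "\<dots> = 1 / (v - u) * (\<bar>b\<bar> * expectation r)"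
        by (simp only: integral_mult_right_zero)
      also have "\<dots> \<le> 1 / (v - u) * (\<bar>b\<bar> * e')"
        using Er uv by (intro mult_left_mono) auto
      also note be
      finally show ?case using elim(1) K(1) unfolding dist_real_def by linarith
    qed
  qed
  then show "(\<lambda>n. integral\<^sup>L (distr M borel (\<lambda>\<omega>. a * \<bar>W n 0 1 \<omega>\<bar> + b * range_stat n \<omega>)) (cts_step u v))
     \<longlonglongrightarrow> integral\<^sup>L (distr N borel (\<lambda>\<omega>. sqrt \<sigma>2 * (a * \<bar>B 1 \<omega>\<bar> + b * bridge_range \<omega>))) (cts_step u v)"
    using integral_distr[OF Ln_meas, of "cts_step u v"] integral_distr[OF LB_meas, of "cts_step u v"] measurable_cts_step[OF uv]
    unfolding Ln_def[abs_def] LB_def[abs_def] by simp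
qed

text \<open>The limit variable carries the factor sqrt \<sigma>2 > 0, which does not affect its
  sign: here the long-run variance cancels without having been estimated. The point 0 must not be an
  atom of the limit, because distribution functions converge at continuity points.\<close>

lemma prob_functional_le_0:
  assumes "N.prob {\<omega> \<in> space N. a * \<bar>B 1 \<omega>\<bar> + b * bridge_range \<omega> = 0} = 0"
  shows "(\<lambda>n. prob {\<omega> \<in> space M. a * \<bar>W n 0 1 \<omega>\<bar> + b * range_stat n \<omega> \<le> 0})
    \<longlonglongrightarrow> N.prob {\<omega> \<in> space N. a * \<bar>B 1 \<omega>\<bar> + b * bridge_range \<omega> \<le> 0}"
proof -
  define LB where "LB \<omega> = sqrt \<sigma>2 * (a * \<bar>B 1 \<omega>\<bar> + b * bridge_range \<omega>)" for \<omega>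
  have [measurable]: "B 1 \<in> borel_measurable N" by (rule B_meas) simp
  have [measurable]: "LB \<in> borel_measurable N" unfolding LB_def by measurable
  interpret D: real_distribution "distr N borel LB" by simp
  have iff: "LB \<omega> = 0 \<longleftrightarrow> a * \<bar>B 1 \<omega>\<bar> + b * bridge_range \<omega> = 0"
    "LB \<omega> \<le> 0 \<longleftrightarrow> a * \<bar>B 1 \<omega>\<bar> + b * bridge_range \<omega> \<le> 0" for \<omega>
    using \<sigma>2 by (simp_all add: LB_def mult_le_0_iff)
  have "measure (distr N borel LB) {0} = N.prob {\<omega> \<in> space N. LB \<omega> = 0}"
    by (subst measure_distr) (auto intro!: arg_cong[where f = N.prob])
  also have "\<dots> = 0" unfolding iff by (rule assms)
  finally have "isCont (cdf (distr N borel LB)) 0" by (simp add: D.isCont_cdf)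
  then have "(\<lambda>n. cdf (distr M borel (\<lambda>\<omega>. a * \<bar>W n 0 1 \<omega>\<bar> + b * range_stat n \<omega>)) 0) \<longlonglongrightarrow> cdf (distr N borel LB) 0"
    using functional_weak_conv[of a b] unfolding weak_conv_m_def weak_conv_def LB_def[abs_def] by blast
  moreover have "cdf (distr M borel (\<lambda>\<omega>. a * \<bar>W n 0 1 \<omega>\<bar> + b * range_stat n \<omega>)) 0
      = prob {\<omega> \<in> space M. a * \<bar>W n 0 1 \<omega>\<bar> + b * range_stat n \<omega> \<le> 0}" for n
    unfolding cdf_def2 by (subst measure_distr) (auto intro!: arg_cong[where f = prob])
  moreover have "cdf (distr N borel LB) 0 = N.prob {\<omega> \<in> space N. LB \<omega> \<le> 0}"
    unfolding cdf_def2 by (subst measure_distr) (auto intro!: arg_cong[where f = N.prob])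
  ultimately show ?thesis by (simp add: iff)
qed

definition Qn :: "real \<Rightarrow> nat \<Rightarrow> 'a \<Rightarrow> real" where
  "Qn c n \<omega> = (if range_stat n \<omega> > 0 then (W n 0 1 \<omega>)\<^sup>2 / (range_stat n \<omega>)\<^sup>2 else c)"

lemma Qlimit_eq: "Qlimit B \<omega> = (B 1 \<omega>)\<^sup>2 / (bridge_range \<omega>)\<^sup>2"
  by (simp add: Qlimit_def bridge_range_def osc_def)

lemma Qn_meas [measurable]: "Qn c n \<in> borel_measurable M"
  unfolding Qn_def by measurable

lemma Qlimit_meas [measurable]: "Qlimit B \<in> borel_measurable N"
proof -
  have [measurable]: "B 1 \<in> borel_measurable N" by (rule B_meas) simp
  show ?thesis unfolding Qlimit_eq[abs_def] by measurable
qed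

text \<open>
  For \<open>x \<ge> 0\<close> the event \<open>Q \<le> x\<close> is the event that the Lipschitz functional
  \<open>|S(1)| - sqrt x * R\<close> is nonpositive, up to the event of a vanishing range.
\<close>

lemma Qn_weak_conv: "weak_conv_m (\<lambda>n. distr M borel (Qn c n)) (distr N borel (Qlimit B))"
  unfolding weak_conv_m_def weak_conv_def
proof (intro allI impI)
  fix x assume cont: "isCont (cdf (distr N borel (Qlimit B))) x"
  have [measurable]: "B 1 \<in> borel_measurable N" by (rule B_meas) simp
  interpret D: real_distribution "distr N borel (Qlimit B)" by simp
  have "measure (distr N borel (Qlimit B)) {x} = 0" using cont by (simp add: D.isCont_cdf)
  then have Qx: "N.prob {\<omega> \<in> space N. Qlimit B \<omega> = x} = 0"
    by (subst (asm) measure_distr) (auto simp: vimage_def Int_def conj_commute)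
  have cdfn: "cdf (distr M borel (Qn c n)) x = prob {\<omega> \<in> space M. Qn c n \<omega> \<le> x}" for n
    unfolding cdf_def2 by (subst measure_distr) (auto intro!: arg_cong[where f = prob])
  have cdfB: "cdf (distr N borel (Qlimit B)) x = N.prob {\<omega> \<in> space N. Qlimit B \<omega> \<le> x}"
    unfolding cdf_def2 by (subst measure_distr) (auto intro!: arg_cong[where f = N.prob])
  have R0: "N.prob {\<omega> \<in> space N. bridge_range \<omega> \<le> 0} = 0"
  proof -
    have "AE \<omega> in N. \<omega> \<notin> {\<omega> \<in> space N. bridge_range \<omega> \<le> 0}"
      using bridge_range_pos by eventually_elim auto
    then show ?thesis by (subst N.prob_eq_0) auto
  qed
  have R0': "N.prob {\<omega> \<in> space N. bridge_range \<omega> = 0} = 0"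
  proof -
    have "N.prob {\<omega> \<in> space N. bridge_range \<omega> = 0} \<le> N.prob {\<omega> \<in> space N. bridge_range \<omega> \<le> 0}"
      by (rule N.finite_measure_mono) auto
    then show ?thesis using R0 by (simp add: measure_le_0_iff)
  qed
  define pr where "pr n = prob {\<omega> \<in> space M. range_stat n \<omega> \<le> 0}" for n
  \<comment> \<open>The case a = 0, b = 1: the bridge range is almost surely positive, so the
    probability of a vanishing range, where Q takes the value c, tends to 0.\<close>
  have pr: "pr \<longlonglongrightarrow> 0"
    using prob_functional_le_0[of 0 1] R0 R0' by (simp add: pr_def[abs_def])
  show "(\<lambda>n. cdf (distr M borel (Qn c n)) x) \<longlonglongrightarrow> cdf (distr N borel (Qlimit B)) x"
  proof (cases "x < 0")
    case True
    have "Qlimit B \<omega> \<ge> 0" for \<omega> by (simp add: Qlimit_eq)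
    then have "{\<omega> \<in> space N. Qlimit B \<omega> \<le> x} = {}" using True by (auto simp: not_le intro: less_le_trans)
    then have 0: "cdf (distr N borel (Qlimit B)) x = 0" by (simp only: cdfB measure_empty)
    \<comment> \<open>A negative value of Q can only be the assigned value c, which requires the
      range to vanish.\<close>
    have le: "prob {\<omega> \<in> space M. Qn c n \<omega> \<le> x} \<le> pr n" for n
      unfolding pr_def
    proof (rule finite_measure_mono)
      show "{\<omega> \<in> space M. Qn c n \<omega> \<le> x} \<subseteq> {\<omega> \<in> space M. range_stat n \<omega> \<le> 0}"
      proof clarsimp
        fix \<omega> assume "Qn c n \<omega> \<le> x"
        then have "Qn c n \<omega> < 0" using True by linarith
        then show "range_stat n \<omega> \<le> 0"
          by (auto simp: Qn_def not_less[symmetric] divide_less_0_iff split: if_splits)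
      qed
    qed measurable
    show ?thesis unfolding cdfn 0
      by (rule tendsto_sandwich[OF _ _ tendsto_const pr]) (use le in auto)
  next
    case False
    define y where "y = sqrt x"
    have y: "y \<ge> 0" "y\<^sup>2 = x" using False by (simp_all add: y_def)
    have key: "s\<^sup>2 / R\<^sup>2 \<le> x \<longleftrightarrow> \<bar>s\<bar> - y * R \<le> 0" "s\<^sup>2 / R\<^sup>2 = x \<longleftrightarrow> \<bar>s\<bar> - y * R = 0" if R: "R > 0" for s R :: real
    proof -
      have "s\<^sup>2 / R\<^sup>2 \<le> x \<longleftrightarrow> \<bar>s\<bar>\<^sup>2 \<le> (y * R)\<^sup>2" using R by (simp add: power_mult_distrib y field_simps)
      also have "\<dots> \<longleftrightarrow> \<bar>s\<bar> \<le> y * R" using abs_le_square_iff[of s "y * R"] y R by simp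
      finally show "s\<^sup>2 / R\<^sup>2 \<le> x \<longleftrightarrow> \<bar>s\<bar> - y * R \<le> 0" by simp
      have "s\<^sup>2 / R\<^sup>2 = x \<longleftrightarrow> \<bar>s\<bar>\<^sup>2 = (y * R)\<^sup>2" using R by (simp add: power_mult_distrib y field_simps)
      also have "\<dots> \<longleftrightarrow> \<bar>s\<bar> = y * R" using power2_eq_iff_nonneg[of "\<bar>s\<bar>" "y * R"] y R by simp
      finally show "s\<^sup>2 / R\<^sup>2 = x \<longleftrightarrow> \<bar>s\<bar> - y * R = 0" by simp
    qed
    \<comment> \<open>The absence of an atom at 0 is inherited from the choice of x: almost surely
      the combination vanishes exactly where the limit of Q equals x, and this event is null because
      the limiting distribution function is continuous at x.\<close>
    have "N.prob {\<omega> \<in> space N. 1 * \<bar>B 1 \<omega>\<bar> + - y * bridge_range \<omega> = 0} = N.prob {\<omega> \<in> space N. Qlimit B \<omega> = x}"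
    proof (rule N.finite_measure_eq_AE)
      show "AE \<omega> in N. \<omega> \<in> {\<omega> \<in> space N. 1 * \<bar>B 1 \<omega>\<bar> + - y * bridge_range \<omega> = 0} \<longleftrightarrow> \<omega> \<in> {\<omega> \<in> space N. Qlimit B \<omega> = x}"
        using bridge_range_pos by eventually_elim (simp add: Qlimit_eq key)
    qed measurable
    then have lim: "(\<lambda>n. prob {\<omega> \<in> space M. 1 * \<bar>W n 0 1 \<omega>\<bar> + - y * range_stat n \<omega> \<le> 0})
      \<longlonglongrightarrow> N.prob {\<omega> \<in> space N. 1 * \<bar>B 1 \<omega>\<bar> + - y * bridge_range \<omega> \<le> 0}"
      using Qx by (intro prob_functional_le_0) simp
    have limB: "N.prob {\<omega> \<in> space N. 1 * \<bar>B 1 \<omega>\<bar> + - y * bridge_range \<omega> \<le> 0} = N.prob {\<omega> \<in> space N. Qlimit B \<omega> \<le> x}"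
    proof (rule N.finite_measure_eq_AE)
      show "AE \<omega> in N. \<omega> \<in> {\<omega> \<in> space N. 1 * \<bar>B 1 \<omega>\<bar> + - y * bridge_range \<omega> \<le> 0} \<longleftrightarrow> \<omega> \<in> {\<omega> \<in> space N. Qlimit B \<omega> \<le> x}"
        using bridge_range_pos by eventually_elim (simp add: Qlimit_eq key)
    qed measurable
    define pn where "pn n = prob {\<omega> \<in> space M. 1 * \<bar>W n 0 1 \<omega>\<bar> + - y * range_stat n \<omega> \<le> 0}" for n
    have Qle: "Qn c n \<omega> \<le> x \<longleftrightarrow> 1 * \<bar>W n 0 1 \<omega>\<bar> + - y * range_stat n \<omega> \<le> 0" if "\<not> range_stat n \<omega> \<le> 0" for n \<omega>
      using that key[of "range_stat n \<omega>" "W n 0 1 \<omega>"] by (simp add: Qn_def)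
    \<comment> \<open>The events Q <= x and |W| - y R <= 0 differ only where the range vanishes, so
      their probabilities differ by at most \<open>pr n\<close>.\<close>
    have up: "prob {\<omega> \<in> space M. Qn c n \<omega> \<le> x} \<le> pn n + pr n" for n
      unfolding pn_def pr_def
      by (rule order_trans[OF finite_measure_mono measure_Un_le]) (use Qle in auto)
    have lo: "pn n - pr n \<le> prob {\<omega> \<in> space M. Qn c n \<omega> \<le> x}" for n
    proof -
      have "pn n \<le> prob {\<omega> \<in> space M. Qn c n \<omega> \<le> x} + pr n"
        unfolding pn_def pr_def
        by (rule order_trans[OF finite_measure_mono measure_Un_le]) (use Qle in auto)
      then show ?thesis by simp
    qed
    have "(\<lambda>n. pn n - pr n) \<longlonglongrightarrow> N.prob {\<omega> \<in> space N. Qlimit B \<omega> \<le> x} - 0"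
      using lim unfolding limB pn_def[symmetric] by (intro tendsto_diff pr)
    moreover have "(\<lambda>n. pn n + pr n) \<longlonglongrightarrow> N.prob {\<omega> \<in> space N. Qlimit B \<omega> \<le> x} + 0"
      using lim unfolding limB pn_def[symmetric] by (intro tendsto_add pr)
    ultimately show ?thesis unfolding cdfn cdfB add_0_right diff_0_right
      by (rule tendsto_sandwich[OF always_eventually always_eventually, rotated 2]) (use up lo in blast)+
  qed
qed

end

section \<open>The transformed loss differential\<close>

text \<open>
  The second factor need not be integrable: on the event where \<open>h\<close> does not vanish, integrability of the
  product forces both one-sided conditional expectations to be finite, so that a vanishing conditional
  expectation means that they agree.
\<close>

lemma (in prob_space) expectation_mult_cond_exp_0:
  assumes sub: "subalgebra M F" and h: "h \<in> borel_measurable F" and D [measurable]: "D \<in> borel_measurable M"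
    and int: "integrable M (\<lambda>\<omega>. h \<omega> * D \<omega>)" and ce: "AE \<omega> in M. real_cond_exp M F D \<omega> = 0"
  shows "expectation (\<lambda>\<omega>. h \<omega> * D \<omega>) = 0"
proof -
  interpret S: finite_measure_subalgebra M F
    using sub by unfold_locales
  have [measurable]: "h \<in> borel_measurable M" using sub h by (rule measurable_from_subalg)
  \<comment> \<open>\<open>ennreal\<close> sends negative numbers to 0, so P and Q are the
    extended-valued conditional expectations of the positive and the negative part of D.\<close>
  define P where "P = nn_cond_exp M F (\<lambda>x. ennreal (D x))"
  define Q where "Q = nn_cond_exp M F (\<lambda>x. ennreal (- D x))"
  have PQm [measurable]: "P \<in> borel_measurable M" "Q \<in> borel_measurable M"
    by (simp_all add: P_def Q_def)
  have hF: "(\<lambda>x. ennreal (h x)) \<in> borel_measurable F" "(\<lambda>x. ennreal (- h x)) \<in> borel_measurable F"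
    using h by measurable
  have PI: "(\<integral>\<^sup>+x. f x * P x \<partial>M) = (\<integral>\<^sup>+x. f x * ennreal (D x) \<partial>M)"
    and QI: "(\<integral>\<^sup>+x. f x * Q x \<partial>M) = (\<integral>\<^sup>+x. f x * ennreal (- D x) \<partial>M)" if "f \<in> borel_measurable F" for f
    unfolding P_def Q_def by (rule S.nn_cond_exp_intg[OF that]; measurable)+
  \<comment> \<open>The positive part of a product: both factors positive or both negative.\<close>
  have pos: "ennreal (a * b) = ennreal a * ennreal b + ennreal (- a) * ennreal (- b)" for a b :: real
  proof (cases "a \<ge> 0")
    case True
    then show ?thesis by (simp add: ennreal_mult' ennreal_neg)
  next
    case False
    then have "ennreal (a * b) = ennreal ((- a) * (- b))" by simp
    also have "\<dots> = ennreal (- a) * ennreal (- b)" using False by (intro ennreal_mult') auto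
    finally show ?thesis using False by (simp add: ennreal_neg)
  qed
  have I1: "(\<integral>\<^sup>+x. ennreal (h x * D x) \<partial>M) = (\<integral>\<^sup>+x. ennreal (h x) * P x + ennreal (- h x) * Q x \<partial>M)"
  proof -
    have "(\<integral>\<^sup>+x. ennreal (h x * D x) \<partial>M)
        = (\<integral>\<^sup>+x. ennreal (h x) * ennreal (D x) \<partial>M) + (\<integral>\<^sup>+x. ennreal (- h x) * ennreal (- D x) \<partial>M)"
      unfolding pos by (rule nn_integral_add; measurable)
    also have "\<dots> = (\<integral>\<^sup>+x. ennreal (h x) * P x \<partial>M) + (\<integral>\<^sup>+x. ennreal (- h x) * Q x \<partial>M)"
      using PI[OF hF(1)] QI[OF hF(2)] by simp
    also have "\<dots> = (\<integral>\<^sup>+x. ennreal (h x) * P x + ennreal (- h x) * Q x \<partial>M)"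
      by (rule nn_integral_add[symmetric]; measurable)
    finally show ?thesis .
  qed
  have I2: "(\<integral>\<^sup>+x. ennreal (- (h x * D x)) \<partial>M) = (\<integral>\<^sup>+x. ennreal (h x) * Q x + ennreal (- h x) * P x \<partial>M)"
  proof -
    have neg: "ennreal (- (h x * D x)) = ennreal (h x) * ennreal (- D x) + ennreal (- h x) * ennreal (D x)" for x
      using pos[of "h x" "- D x"] by simp
    have "(\<integral>\<^sup>+x. ennreal (- (h x * D x)) \<partial>M)
        = (\<integral>\<^sup>+x. ennreal (h x) * ennreal (- D x) \<partial>M) + (\<integral>\<^sup>+x. ennreal (- h x) * ennreal (D x) \<partial>M)"
      unfolding neg by (rule nn_integral_add; measurable)
    also have "\<dots> = (\<integral>\<^sup>+x. ennreal (h x) * Q x \<partial>M) + (\<integral>\<^sup>+x. ennreal (- h x) * P x \<partial>M)"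
      using QI[OF hF(1)] PI[OF hF(2)] by simp
    also have "\<dots> = (\<integral>\<^sup>+x. ennreal (h x) * Q x + ennreal (- h x) * P x \<partial>M)"
      by (rule nn_integral_add[symmetric]; measurable)
    finally show ?thesis .
  qed
  have fin: "(\<integral>\<^sup>+x. ennreal (h x * D x) \<partial>M) \<noteq> \<infinity>" "(\<integral>\<^sup>+x. ennreal (- (h x * D x)) \<partial>M) \<noteq> \<infinity>"
    using int unfolding real_integrable_def by auto
  have "AE x in M. ennreal (h x) * P x + ennreal (- h x) * Q x \<noteq> \<infinity>"
    using fin(1) unfolding I1 by (intro nn_integral_PInf_AE) measurable
  moreover have "AE x in M. ennreal (h x) * Q x + ennreal (- h x) * P x \<noteq> \<infinity>"
    using fin(2) unfolding I2 by (intro nn_integral_PInf_AE) measurable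
  \<comment> \<open>\<open>enn2real\<close> sends infinity to 0, so this equality alone would allow
    P infinite and Q zero. The two finiteness statements exclude that wherever h is nonzero.\<close>
  moreover have "AE x in M. enn2real (P x) = enn2real (Q x)"
    using ce by eventually_elim (simp add: real_cond_exp_def P_def Q_def)
  ultimately have "AE x in M. ennreal (h x) * P x + ennreal (- h x) * Q x = ennreal (h x) * Q x + ennreal (- h x) * P x"
  proof eventually_elim
    case (elim x)
    show ?case
    proof (cases "h x = 0")
      case False
      then have "P x \<noteq> \<top>" "Q x \<noteq> \<top>"
        using elim(1,2) by (cases "h x > 0"; auto simp: ennreal_mult_eq_top_iff ennreal_neg ennreal_eq_0_iff not_less)+
      then have "P x = Q x" using elim(3) by (metis ennreal_enn2real less_top)
      then show ?thesis by simp
    qed simp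
  qed
  then have "(\<integral>\<^sup>+x. ennreal (h x * D x) \<partial>M) = (\<integral>\<^sup>+x. ennreal (- (h x * D x)) \<partial>M)"
    unfolding I1 I2 by (rule nn_integral_cong_AE)
  then show ?thesis by (simp add: real_lebesgue_integral_def[OF int])
qed

context prob_space
begin

lemma mixing_coeff_upper:
  assumes Z: "\<And>t. t \<ge> m \<Longrightarrow> Z t \<in> borel_measurable M" and t: "m \<le> t"
    and A: "A \<in> sets (gen_sigma M {m..t} Z)" and B: "B \<in> sets (gen_sigma M {t + k..} Z)"
  shows "\<bar>prob (A \<inter> B) - prob A * prob B\<bar> \<le> mixing_coeff M m Z k"
proof -
  have bd: "\<bar>prob (A \<inter> B) - prob A * prob B\<bar> \<le> 1" for A B
  proof -
    have "prob A * prob B \<le> 1" "0 \<le> prob A * prob B" "prob (A \<inter> B) \<le> 1" "0 \<le> prob (A \<inter> B)"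
      by (auto intro: mult_le_one)
    then show ?thesis by linarith
  qed
  show ?thesis unfolding mixing_coeff_def
  proof (rule cSup_upper)
    show "\<bar>prob (A \<inter> B) - prob A * prob B\<bar> \<in> {\<bar>prob (A \<inter> B) - prob A * prob B\<bar> |t A B.
       m \<le> t \<and> A \<in> sets (gen_sigma M {m..t} Z) \<and> B \<in> sets (gen_sigma M {t + k..} Z)}"
      using t A B by blast
    show "bdd_above {\<bar>prob (A \<inter> B) - prob A * prob B\<bar> |t A B.
       m \<le> t \<and> A \<in> sets (gen_sigma M {m..t} Z) \<and> B \<in> sets (gen_sigma M {t + k..} Z)}"
      using bd by (intro bdd_aboveI[where M = 1]) auto
  qed
qed

text \<open>The past ends at index m + t - 1 of Z and the future starts at m + t + k, a distance of
  k + 1; this is why \<open>Suc k\<close> appears.\<close>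

lemma mixing_bound_shift:
  assumes Z: "\<And>t. t \<ge> m \<Longrightarrow> Z t \<in> borel_measurable M"
    and b: "mixing_coeff M m Z (Suc k) \<le> b" "0 \<le> b"
  shows "mixing_bound (gen_sigma M {..<t} (\<lambda>i. Z (m + i))) (gen_sigma M {t + k..} (\<lambda>i. Z (m + i))) b"
  unfolding mixing_bound_def
proof (intro conjI ballI)
  show "subalgebra M (gen_sigma M {..<t} (\<lambda>i. Z (m + i)))" "subalgebra M (gen_sigma M {t + k..} (\<lambda>i. Z (m + i)))"
    using Z by (auto intro!: subalgebra_gen_sigma)
  fix A B assume A: "A \<in> sets (gen_sigma M {..<t} (\<lambda>i. Z (m + i)))" and B: "B \<in> sets (gen_sigma M {t + k..} (\<lambda>i. Z (m + i)))"
  have shift: "gen_sigma M I (\<lambda>i. Z (m + i)) = gen_sigma M ((+) m ` I) Z" for I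
    by (simp add: gen_sigma_def)
  have "subalgebra M (gen_sigma M {t + k..} (\<lambda>i. Z (m + i)))"
    using Z by (intro subalgebra_gen_sigma) simp
  then have BM: "B \<in> events" using B by (auto simp: subalgebra_def)
  show "\<bar>prob (A \<inter> B) - prob A * prob B\<bar> \<le> b"
  proof (cases t)
    case 0
    \<comment> \<open>For t = 0 the past is trivial and the covariance is 0. This case lies outside
      \<open>mixing_coeff\<close>, where the past always contains index m.\<close>
    then have "A = {} \<or> A = space M" using A by (auto simp: sets_gen_sigma sigma_sets_empty_eq)
    then show ?thesis
    proof
      assume "A = space M"
      then have "A \<inter> B = B" using sets.sets_into_space[OF BM] by auto
      then show ?thesis using b \<open>A = space M\<close> by (simp add: prob_space)
    qed (use b in simp)
  next
    case (Suc s)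
    have "A \<in> sets (gen_sigma M {m..m + s} Z)"
    proof -
      have "(+) m ` {..<t} \<subseteq> {m..m + s}" using Suc by auto
      from gen_sigma_mono[OF this, of M Z] show ?thesis using A unfolding shift by blast
    qed
    moreover have "B \<in> sets (gen_sigma M {m + s + Suc k..} Z)"
    proof -
      have "(+) m ` {t + k..} \<subseteq> {m + s + Suc k..}" using Suc by auto
      from gen_sigma_mono[OF this, of M Z] show ?thesis using B unfolding shift by blast
    qed
    ultimately have "\<bar>prob (A \<inter> B) - prob A * prob B\<bar> \<le> mixing_coeff M m Z (Suc k)"
      by (intro mixing_coeff_upper[OF Z]) auto
    then show ?thesis using b by simp
  qed
qed

end

text \<open>A mixing coefficient may be 0, whereas Davydov's bound takes a negative power of it. A
  geometric floor restores positivity, and its powers form a geometric series again.\<close>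

lemma summable_max_powr:
  fixes a :: "nat \<Rightarrow> real"
  assumes "summable (\<lambda>k. a k powr \<theta>)" "\<theta> > 0"
  shows "summable (\<lambda>k. max (a k) ((1 / 2) ^ k) powr \<theta>)"
proof (rule summable_comparison_test)
  have "summable (\<lambda>k. ((1 / 2 :: real) powr \<theta>) ^ k)"
    using powr_less_mono2[of \<theta> "1 / 2" 1] assms(2) by (intro summable_geometric) simp
  moreover have "((1 / 2 :: real) powr \<theta>) ^ k = ((1 / 2) ^ k) powr \<theta>" for k
    by (simp add: powr_powr mult.commute flip: powr_realpow)
  ultimately show "summable (\<lambda>k. a k powr \<theta> + ((1 / 2) ^ k) powr \<theta>)"
    using assms(1) by (intro summable_add) simp_all
  show "\<exists>N. \<forall>k\<ge>N. norm (max (a k) ((1 / 2) ^ k) powr \<theta>) \<le> a k powr \<theta> + ((1 / 2) ^ k) powr \<theta>"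
    by (auto simp: max_def)
qed

section \<open>The test statistic in terms of partial sums\<close>

lemma image_idx: "idx n ` {0..1} = {..n}"
proof
  show "idx n ` {0..1} \<subseteq> {..n}"
    using idx_mono[of _ 1 n] by (auto simp: idx_def)
  show "{..n} \<subseteq> idx n ` {0..1}"
  proof
    fix k assume k: "k \<in> {..n}"
    show "k \<in> idx n ` {0..1}"
    proof (cases "n = 0")
      case True
      then show ?thesis using k by (intro image_eqI[of _ _ 0]) (auto simp: idx_def)
    next
      case False
      then show ?thesis using k by (intro image_eqI[of _ _ "real k / real n"]) (auto simp: idx_def)
    qed
  qed
qed

lemma sum_shift:
  fixes Z :: "nat \<Rightarrow> real"
  shows "(\<Sum>t\<in>{m..<m + k}. Z t) = (\<Sum>i<k. Z (m + i))"
  using sum.shift_bounds_nat_ivl[of Z 0 m k] by (simp add: atLeast0LessThan add.commute)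

lemma psum_eq: "psum m Z n r \<omega> = (\<Sum>i<idx n r. Z (m + i) \<omega>)"
  unfolding psum_def idx_def by (rule sum_shift)

lemma sample_mean_eq: "sample_mean m Z n \<omega> = (\<Sum>i<n. Z (m + i) \<omega>) / real n"
  unfolding sample_mean_def by (simp only: sum_shift)

text \<open>As r runs through [0,1], the number of summands takes exactly the values 0, ..., n, so
  supremum and infimum are over finitely many values. Centring k terms subtracts the fraction k / n
  of the total sum.\<close>

lemma Rstat_eq:
  "Rstat m Z n \<omega> = osc (\<lambda>k. ((\<Sum>i<k. Z (m + i) \<omega>) - real k / real n * (\<Sum>i<n. Z (m + i) \<omega>)) / sqrt (real n)) {..n}"
proof -
  let ?f = "\<lambda>k. ((\<Sum>i<k. Z (m + i) \<omega>) - real k / real n * (\<Sum>i<n. Z (m + i) \<omega>)) / sqrt (real n)"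
  have "Tproc m Z n r \<omega> = ?f (idx n r)" for r
  proof -
    have "(\<Sum>t\<in>{m..<m + nat \<lfloor>real n * r\<rfloor>}. Z t \<omega> - sample_mean m Z n \<omega>)
        = (\<Sum>i<idx n r. Z (m + i) \<omega> - sample_mean m Z n \<omega>)"
      unfolding idx_def by (rule sum_shift)
    then show ?thesis by (simp add: Tproc_def sum_subtractf sample_mean_eq)
  qed
  then have "Rstat m Z n \<omega> = osc (\<lambda>r. ?f (idx n r)) {0..1}"
    by (simp add: Rstat_def osc_def)
  also have "\<dots> = osc ?f (idx n ` {0..1})" by (rule osc_image[symmetric])
  finally show ?thesis unfolding image_idx .
qed

theorem theorem3p1:
  fixes M :: "'a measure"
    and Y :: "nat \<Rightarrow> 'a \<Rightarrow> real"
    and X :: "nat \<Rightarrow> 'a \<Rightarrow> real ^ 'p"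
    and f g h :: "nat \<Rightarrow> 'a \<Rightarrow> real"
    and L :: "real \<Rightarrow> real \<Rightarrow> real"
    and m \<tau> :: nat
    and \<eta> \<sigma>2 c :: real
    and Z :: "nat \<Rightarrow> 'a \<Rightarrow> real"
    and N :: "'b measure"
    and B :: "real \<Rightarrow> 'b \<Rightarrow> real"
  assumes "prob_space M"
    and "\<And>t. t \<ge> 1 \<Longrightarrow> Y t \<in> borel_measurable M"
    and "\<And>t. t \<ge> 1 \<Longrightarrow> X t \<in> borel_measurable M"
    and "m \<ge> 1" and "\<tau> > 1"
    and "\<And>t. t \<ge> m \<Longrightarrow> f t \<in> borel_measurable (info M Y X t)"
    and "\<And>t. t \<ge> m \<Longrightarrow> g t \<in> borel_measurable (info M Y X t)"
    and "rolling_window_forecast M Y X m f"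
    and "rolling_window_forecast M Y X m g"
    and "(\<lambda>(y, x). L y x) \<in> borel_measurable (borel \<Otimes>\<^sub>M borel)"
    and "\<And>t. t \<ge> m \<Longrightarrow> h t \<in> borel_measurable (info M Y X t)"
    and "Z = transformed_loss h L \<tau> Y f g"
    and "\<eta> > 0"
    and "strongly_mixing M m Z"
    and "summable (\<lambda>k. mixing_coeff M m Z (Suc k) powr (\<eta> / (2 + \<eta>)))"
    and "(SUP t\<in>{m..}. \<integral>\<^sup>+ \<omega>. ennreal (\<bar>Z t \<omega>\<bar> powr (2 + \<eta>)) \<partial>M) < \<infinity>"
    and "\<sigma>2 > 0"
    and "\<And>r s. r \<in> {0..1} \<Longrightarrow> s \<in> {0..1} \<Longrightarrow>
           (\<lambda>n. covar M (psum m Z n r) (psum m Z n s) / real n) \<longlonglongrightarrow> min r s * \<sigma>2"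
    and H0: "\<And>t. t \<ge> m \<Longrightarrow>
           AE \<omega> in M. real_cond_exp M (info M Y X t) (loss_diff L \<tau> Y f g t) \<omega> = 0"
    and "brownian_motion N B"
  shows "weak_conv_m (\<lambda>n. distr M borel (Qstat c m Z n)) (distr N borel (Qlimit B))"
proof -
  interpret prob_space M by fact
  have obs: "obs Y X t \<in> borel_measurable M" if "t \<ge> 1" for t
    unfolding obs_def[abs_def] using assms(2,3)[OF that] by (rule borel_measurable_Pair)
  have sub: "subalgebra M (info M Y X t)" for t
    unfolding info_def by (rule subalgebra_gen_sigma) (simp add: obs)
  have fgh: "f t \<in> borel_measurable M" "g t \<in> borel_measurable M" "h t \<in> borel_measurable M" if "t \<ge> m" for t
    using assms(6,7,11)[OF that] by (auto intro: measurable_from_subalg[OF sub])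
  have Lm: "(\<lambda>\<omega>. L (Y (t + \<tau>) \<omega>) (u \<omega>)) \<in> borel_measurable M" if "t \<ge> m" "u \<in> borel_measurable M" for t u
  proof -
    have "(\<lambda>\<omega>. (Y (t + \<tau>) \<omega>, u \<omega>)) \<in> M \<rightarrow>\<^sub>M borel \<Otimes>\<^sub>M borel"
      using assms(2)[of "t + \<tau>"] that assms(4) by (intro measurable_Pair) auto
    from measurable_compose[OF this assms(10)] show ?thesis by simp
  qed
  have D: "loss_diff L \<tau> Y f g t \<in> borel_measurable M" if "t \<ge> m" for t
    unfolding loss_diff_def[abs_def] by (intro borel_measurable_diff Lm fgh that)
  have Z_eq: "Z t = (\<lambda>\<omega>. h t \<omega> * loss_diff L \<tau> Y f g t \<omega>)" for t
    by (simp add: assms(12) transformed_loss_def fun_eq_iff)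
  have ZM: "Z t \<in> borel_measurable M" if "t \<ge> m" for t
    unfolding Z_eq by (intro borel_measurable_times fgh D that)
  define C where "C = enn2real (SUP t\<in>{m..}. \<integral>\<^sup>+ \<omega>. ennreal (\<bar>Z t \<omega>\<bar> powr (2 + \<eta>)) \<partial>M)"
  have Z_nn: "(\<integral>\<^sup>+ \<omega>. ennreal (\<bar>Z t \<omega>\<bar> powr (2 + \<eta>)) \<partial>M) \<le> ennreal C" if "t \<ge> m" for t
  proof -
    have "ennreal C = (SUP t\<in>{m..}. \<integral>\<^sup>+ \<omega>. ennreal (\<bar>Z t \<omega>\<bar> powr (2 + \<eta>)) \<partial>M)"
      unfolding C_def using assms(16) by (intro ennreal_enn2real) simp
    then show ?thesis using that by (auto intro: SUP_upper)
  qed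
  have Z_int: "integrable M (\<lambda>\<omega>. \<bar>Z t \<omega>\<bar> powr (2 + \<eta>))" if "t \<ge> m" for t
  proof (rule integrableI_nonneg)
    show "(\<lambda>\<omega>. \<bar>Z t \<omega>\<bar> powr (2 + \<eta>)) \<in> borel_measurable M" using ZM[OF that] by measurable
    show "(\<integral>\<^sup>+ \<omega>. ennreal (\<bar>Z t \<omega>\<bar> powr (2 + \<eta>)) \<partial>M) < \<infinity>"
      using Z_nn[OF that] by (rule le_less_trans) simp
  qed simp
  have Z_mom: "expectation (\<lambda>\<omega>. \<bar>Z t \<omega>\<bar> powr (2 + \<eta>)) \<le> C" if "t \<ge> m" for t
  proof -
    have "ennreal (expectation (\<lambda>\<omega>. \<bar>Z t \<omega>\<bar> powr (2 + \<eta>))) \<le> ennreal C"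
      using Z_nn[OF that] nn_integral_eq_integral[OF Z_int[OF that]] by simp
    then show ?thesis by (subst (asm) ennreal_le_iff) (simp_all add: C_def)
  qed
  have Z1: "integrable M (Z t)" if "t \<ge> m" for t
    using integrable_moment[OF ZM[OF that] _ Z_int[OF that]] assms(13) by simp
  \<comment> \<open>The null hypothesis enters here: h is known at time t and the product is
    integrable, so Z has mean 0.\<close>
  have Z_0: "expectation (Z t) = 0" if "t \<ge> m" for t
    unfolding Z_eq
    by (rule expectation_mult_cond_exp_0[OF sub assms(11)[OF that] D[OF that] Z1[OF that, unfolded Z_eq] H0[OF that]])
  define X' where "X' i = Z (m + i)" for i
  define \<beta> where "\<beta> k = max (mixing_coeff M m Z (Suc k)) ((1 / 2) ^ k)" for k
  have pq: "(2 + \<eta> - 2) / (2 + \<eta>) = \<eta> / (2 + \<eta>)" by simp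
  interpret mixing_seq M X' "2 + \<eta>" C \<beta>
  proof
    show "mixing_bound (gen_sigma M {..<t} X') (gen_sigma M {t + k..} X') (\<beta> k)" for t k
      unfolding X'_def[abs_def] by (rule mixing_bound_shift[OF ZM]) (simp_all add: \<beta>_def le_max_iff_disj)
    show "0 < \<beta> k" for k by (simp add: \<beta>_def less_max_iff_disj)
    show "summable (\<lambda>k. \<beta> k powr ((2 + \<eta> - 2) / (2 + \<eta>)))"
      unfolding pq \<beta>_def using assms(13) by (intro summable_max_powr assms(15)) simp
  qed (use assms(13) ZM Z_int Z_mom Z_0 in \<open>auto simp: X'_def\<close>)
  have psum: "psum m Z n r = (\<lambda>\<omega>. \<Sum>i<idx n r. X' i \<omega>)" for n r
    by (simp add: fun_eq_iff psum_eq X'_def)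
  \<comment> \<open>With centred partial sums the assumed covariance limit becomes the limit of
    mixed moments required by \<open>fclt_seq\<close>.\<close>
  have psum_0: "expectation (psum m Z n r) = 0" for n r
    unfolding psum using integrable_X X_0 by (simp add: Bochner_Integration.integral_sum)
  interpret fclt_brownian M X' "2 + \<eta>" C \<beta> \<sigma>2 N B
  proof unfold_locales
    fix r s :: real assume "r \<in> {0..1}" "s \<in> {0..1}"
    from assms(18)[OF this]
    show "(\<lambda>n. expectation (\<lambda>\<omega>. (\<Sum>i<idx n r. X' i \<omega>) * (\<Sum>i<idx n s. X' i \<omega>)) / real n) \<longlonglongrightarrow> min r s * \<sigma>2"
      by (simp add: covar_def psum_0) (simp add: psum)
  qed (use assms(17,20) in auto)
  have "Qstat c m Z n = Qn c n" for n
  proof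
    fix \<omega>
    have R: "Rstat m Z n \<omega> = range_stat n \<omega>" by (simp only: Rstat_eq range_stat_def X'_def)
    \<comment> \<open>For n = 0 both sides are 0, since division by 0 gives 0.\<close>
    have "real n * (sample_mean m Z n \<omega>)\<^sup>2 = (W n 0 1 \<omega>)\<^sup>2"
      by (cases "n = 0") (simp_all add: sample_mean_eq W_0 X'_def power_divide power2_eq_square)
    then show "Qstat c m Z n \<omega> = Qn c n \<omega>" by (simp add: Qstat_def Qn_def R)
  qed
  then show ?thesis using Qn_weak_conv[of c] by simp
qed

end
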